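(* Let $\alpha,c,\delta>0$ and let $\mathcal F=\{T^\tau(t)\}_{\tau>0}$ be the family of $C_0$-groups generated by $\mathcal A^\tau$ on $\mathbb H_0$. Assume that there is a constant $\gamma_0>0$ such that $\gamma^\tau\equiv \alpha-c^2\tau(b^\tau)^{-1}\ge\gamma_0$ for all $\tau>0$. Then there exist $\tau_0>0$ and constants $M=M(\tau_0)>0$, $\omega=\omega(\tau_0)>0$, both independent of $\tau$, such that $$\|T^\tau(t)\|_{\mathcal L(\mathbb H_0^\tau)}\le M e^{-\omega t}\quad\text{for all }\tau\in(0,\tau_0]\text{ and all }t\ge 0.$$
   Context: Let $\Omega\subset\mathbb R^n$ ($n=2,3$) be a bounded domain with $C^2$ boundary and let $A=-\Delta$ on $L^2(\Omega)$ with $\mathcal D(A)=H_0^1(\Omega)\cap H^2(\Omega)$ (a positive self-adjoint operator with compact resolvent); $\|\cdot\|_2$ is the $L^2(\Omega)$ norm and $\|u\|_{\mathcal D(A^{s})}=\|A^{s}u\|_2$. For $\tau>0$ put $b^\tau=\delta+\tau c^2$. The space is $\mathbb H_0=\mathcal D(A^{1/2})\times\mathcal D(A^{1/2})\times L^2(\Omega)$, and $\mathbb H_0^\tau$ denotes the same set equipped with the norm $\|(u,v,w)\|_{\tau,0}^2=\|A^{1/2}u\|_2^2+\|A^{1/2}v\|_2^2+\tau\|w\|_2^2$. $\mathcal L(\mathbb H_0^\tau)$ carries the operator norm induced by $\|\cdot\|_{\tau,0}$. The operator $\mathcal A^\tau$ on $\mathbb H_0$ is $$\mathcal A^\tau(u,v,w)=\big(v,\;w,\;-\tau^{-1}A(c^2u+b^\tau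 v)-\tau^{-1}\alpha w\big),$$ with natural domain $\mathcal D(\mathcal A^\tau)=\{(u,v,w)\in\mathbb H_0: w\in\mathcal D(A^{1/2}),\ c^2u+b^\tau v\in\mathcal D(A)\}$; for each $\tau>0$ it generates a $C_0$-group $T^\tau(t)$ on $\mathbb H_0$. It is the first-order form, with $U=(u,u_t,u_{tt})$, of $\tau u_{ttt}+\alpha u_{tt}+c^2Au+b^\tau Au_t=0$. *)

theory Defs
  imports "HOL-Analysis.Analysis"
begin

section \<open>The Hilbert space of square integrable real functions\<close>

definition sq_integrable :: "('a::euclidean_space \<Rightarrow> real) \<Rightarrow> bool" where
  "sq_integrable f \<longleftrightarrow> f \<in> borel_measurable lborel \<and> integrable lborel (\<lambda>x. (f x)\<^sup>2)"

definition l2_rel :: "('a::euclidean_space \<Rightarrow> real) \<Rightarrow> ('a \<Rightarrow> real) \<Rightarrow> bool" where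
  "l2_rel f g \<longleftrightarrow> sq_integrable f \<and> sq_integrable g \<and> (AE x in lborel. f x = g x)"

lemma sq_integrable_zero: "sq_integrable (\<lambda>x. 0)"
  by (simp add: sq_integrable_def)

lemma sq_integrable_mult:
  assumes "sq_integrable f" "sq_integrable g"
  shows "integrable lborel (\<lambda>x. f x * g x)"
proof (rule Bochner_Integration.integrable_bound)
  show "integrable lborel (\<lambda>x. (f x)\<^sup>2 + (g x)\<^sup>2)"
    using assms by (auto simp: sq_integrable_def)
  show "(\<lambda>x. f x * g x) \<in> borel_measurable lborel"
    using assms by (auto simp: sq_integrable_def)
  have "\<bar>a * b\<bar> \<le> a\<^sup>2 + b\<^sup>2" for a b :: real
  proof -
    have "0 \<le> (\<bar>a\<bar> - \<bar>b\<bar>)\<^sup>2" by simp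
    hence "2 * (\<bar>a\<bar> * \<bar>b\<bar>) \<le> a\<^sup>2 + b\<^sup>2" by (simp add: power2_diff)
    moreover have "0 \<le> \<bar>a\<bar> * \<bar>b\<bar>" by simp
    ultimately show ?thesis unfolding abs_mult by linarith
  qed
  thus "AE x in lborel. norm (f x * g x) \<le> norm ((f x)\<^sup>2 + (g x)\<^sup>2)"
    by simp
qed

lemma sq_integrable_add:
  assumes "sq_integrable f" "sq_integrable g"
  shows "sq_integrable (\<lambda>x. f x + g x)"
proof -
  have "integrable lborel (\<lambda>x. (f x)\<^sup>2 + (g x)\<^sup>2 + 2 * (f x * g x))"
    using assms sq_integrable_mult[OF assms] by (auto simp: sq_integrable_def)
  hence "integrable lborel (\<lambda>x. (f x + g x)\<^sup>2)"
    by (simp add: power2_sum algebra_simps)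
  thus ?thesis using assms by (auto simp: sq_integrable_def)
qed

lemma sq_integrable_scale: "sq_integrable f \<Longrightarrow> sq_integrable (\<lambda>x. c * f x)"
  by (auto simp: sq_integrable_def power_mult_distrib)

quotient_type (overloaded) 'a l2 = "'a::euclidean_space \<Rightarrow> real" / partial: l2_rel
proof (rule part_equivpI)
  show "\<exists>f::'a \<Rightarrow> real. l2_rel f f"
    by (rule exI[of _ "\<lambda>x. 0"]) (simp add: l2_rel_def sq_integrable_zero)
  show "symp (l2_rel :: ('a \<Rightarrow> real) \<Rightarrow> _)"
    by (auto simp: symp_def l2_rel_def eq_commute)
  show "transp (l2_rel :: ('a \<Rightarrow> real) \<Rightarrow> _)"
  proof (rule transpI)
    fix f g h :: "'a \<Rightarrow> real"
    assume "l2_rel f g" "l2_rel g h"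
    moreover from this have "AE x in lborel. f x = h x"
      unfolding l2_rel_def by (auto elim: eventually_elim2)
    ultimately show "l2_rel f h" by (simp add: l2_rel_def)
  qed
qed

instantiation l2 :: (euclidean_space) real_inner
begin

lift_definition zero_l2 :: "'a l2" is "\<lambda>x. 0"
  by (simp add: l2_rel_def sq_integrable_zero)

lift_definition plus_l2 :: "'a l2 \<Rightarrow> 'a l2 \<Rightarrow> 'a l2" is "\<lambda>f g x. f x + g x"
  by (auto simp: l2_rel_def sq_integrable_add elim: eventually_elim2)

lift_definition scaleR_l2 :: "real \<Rightarrow> 'a l2 \<Rightarrow> 'a l2" is "\<lambda>c f x. c * f x"
  by (auto simp: l2_rel_def sq_integrable_scale elim: eventually_mono)

lift_definition uminus_l2 :: "'a l2 \<Rightarrow> 'a l2" is "\<lambda>f x. - f x"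
  by (auto simp: l2_rel_def sq_integrable_def)

definition minus_l2 :: "'a l2 \<Rightarrow> 'a l2 \<Rightarrow> 'a l2" where
  "minus_l2 u v = u + - v"

lift_definition inner_l2 :: "'a l2 \<Rightarrow> 'a l2 \<Rightarrow> real" is
  "\<lambda>f g. \<integral>x. f x * g x \<partial>lborel"
proof -
  fix f f' g g' :: "'a \<Rightarrow> real"
  assume *: "l2_rel f f'" "l2_rel g g'"
  have ae: "AE x in lborel. f x * g x = f' x * g' x"
    using * unfolding l2_rel_def by (auto elim: eventually_elim2)
  have meas: "(\<lambda>x. f x * g x) \<in> borel_measurable lborel"
    "(\<lambda>x. f' x * g' x) \<in> borel_measurable lborel"
    using * by (auto simp: l2_rel_def sq_integrable_def)
  show "(\<integral>x. f x * g x \<partial>lborel) = (\<integral>x. f' x * g' x \<partial>lborel)"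
    by (rule integral_cong_AE[OF meas ae])
qed

definition norm_l2 :: "'a l2 \<Rightarrow> real" where
  "norm_l2 u = sqrt (inner u u)"

definition sgn_l2 :: "'a l2 \<Rightarrow> 'a l2" where
  "sgn_l2 u = scaleR (inverse (norm u)) u"

definition dist_l2 :: "'a l2 \<Rightarrow> 'a l2 \<Rightarrow> real" where
  "dist_l2 u v = norm (u - v)"

definition uniformity_l2 :: "('a l2 \<times> 'a l2) filter" where
  "uniformity_l2 = (INF e\<in>{0 <..}. principal {(x, y). dist x y < e})"

definition open_l2 :: "'a l2 set \<Rightarrow> bool" where
  "open_l2 U \<longleftrightarrow> (\<forall>x\<in>U. eventually (\<lambda>(x', y). x' = x \<longrightarrow> y \<in> U) uniformity)"

instance
proof
  fix a b c :: "'a l2" and r s :: real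
  show "a + b + c = a + (b + c)"
    by transfer (auto simp: l2_rel_def add.assoc intro!: sq_integrable_add)
  show "a + b = b + a"
    by transfer (auto simp: l2_rel_def add.commute intro!: sq_integrable_add)
  show "0 + a = a"
    by transfer (auto simp: l2_rel_def)
  show "- a + a = 0"
    by transfer (auto simp: l2_rel_def sq_integrable_zero)
  show "a - b = a + - b"
    by (rule minus_l2_def)
  show "r *\<^sub>R (a + b) = r *\<^sub>R a + r *\<^sub>R b"
    by transfer (auto simp: l2_rel_def algebra_simps intro!: sq_integrable_add sq_integrable_scale)
  show "(r + s) *\<^sub>R a = r *\<^sub>R a + s *\<^sub>R a"
    by transfer (auto simp: l2_rel_def ring_distribs intro!: sq_integrable_add sq_integrable_scale)
  show "r *\<^sub>R s *\<^sub>R a = (r * s) *\<^sub>R a"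
    by transfer (auto simp: l2_rel_def mult.assoc intro!: sq_integrable_scale)
  show "1 *\<^sub>R a = a"
    by transfer (auto simp: l2_rel_def)
  show "sgn a = scaleR (inverse (norm a)) a" by (rule sgn_l2_def)
  show "dist a b = norm (a - b)" by (rule dist_l2_def)
  show "uniformity = (INF e\<in>{0 <..}. principal {(x, y :: 'a l2). dist x y < e})"
    by (rule uniformity_l2_def)
  show "open U \<longleftrightarrow> (\<forall>x\<in>U. eventually (\<lambda>(x', y). x' = x \<longrightarrow> y \<in> U) uniformity)"
    for U :: "'a l2 set"
    by (rule open_l2_def)
  show "norm a = sqrt (inner a a)" by (rule norm_l2_def)
  show "inner a b = inner b a"
    by transfer (simp add: mult.commute)
  show "inner (a + b) c = inner a c + inner b c"
  proof transfer
    fix f g h :: "'a \<Rightarrow> real"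
    assume "l2_rel f f" "l2_rel g g" "l2_rel h h"
    hence "integrable lborel (\<lambda>x. f x * h x)" "integrable lborel (\<lambda>x. g x * h x)"
      by (auto simp: l2_rel_def intro: sq_integrable_mult)
    thus "(\<integral>x. (f x + g x) * h x \<partial>lborel) = (\<integral>x. f x * h x \<partial>lborel) + (\<integral>x. g x * h x \<partial>lborel)"
      by (simp add: distrib_right)
  qed
  show "inner (r *\<^sub>R a) b = r * inner a b"
    by transfer (simp add: mult.assoc)
  show "0 \<le> inner a a"
    by transfer simp
  show "inner a a = 0 \<longleftrightarrow> a = 0"
  proof transfer
    fix f :: "'a \<Rightarrow> real"
    assume f: "l2_rel f f"
    hence int: "integrable lborel (\<lambda>x. f x * f x)"
      by (auto simp: l2_rel_def intro: sq_integrable_mult)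
    have "(\<integral>x. f x * f x \<partial>lborel) = 0 \<longleftrightarrow> (AE x in lborel. f x * f x = 0)"
      by (rule integral_nonneg_eq_0_iff_AE[OF int]) simp
    thus "(\<integral>x. f x * f x \<partial>lborel) = 0 \<longleftrightarrow> l2_rel f (\<lambda>x. 0)"
      using f by (auto simp: l2_rel_def sq_integrable_zero)
  qed
qed

end

text \<open>
  \<open>L\<^sup>2(\<Omega>)\<close> is realised inside \<open>L\<^sup>2(\<real>\<^sup>n)\<close> by extending functions by zero outside \<open>\<Omega>\<close>; the
  norm of \<^typ>\<open>'a l2\<close> restricted to it is the norm of \<open>L\<^sup>2(\<Omega>)\<close>.  Here \<open>rep_l2 u\<close> is some
  square integrable representative of the class \<open>u\<close>.
\<close>

definition L2 :: "'a::euclidean_space set \<Rightarrow> 'a l2 set" where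
  "L2 \<Omega> = {u. AE x in lborel. x \<notin> \<Omega> \<longrightarrow> rep_l2 u x = 0}"


section \<open>Domains and Sobolev spaces\<close>

primrec C_k :: "nat \<Rightarrow> ('a::euclidean_space \<Rightarrow> real) \<Rightarrow> bool" where
  "C_k 0 f \<longleftrightarrow> continuous_on UNIV f"
| "C_k (Suc k) f \<longleftrightarrow>
     (\<exists>grad. (\<forall>x. (f has_derivative (\<lambda>h. grad x \<bullet> h)) (at x)) \<and>
             (\<forall>i\<in>Basis. C_k k (\<lambda>x. grad x \<bullet> i)))"

text \<open>
  Near each boundary point the domain is, in suitable Cartesian coordinates, the region strictly
  above the graph of a \<open>C\<^sup>2\<close> function: \<open>e\<close> is the vertical direction and \<open>y - (y \<bullet> e) e\<close>
  are the horizontal coordinates of \<open>y\<close> (a \<open>C\<^sup>2\<close> function on the hyperplane orthogonal to \<open>e\<close>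
  is the same as one on the whole space that is constant along \<open>e\<close>).
\<close>

definition C2_boundary :: "'a::euclidean_space set \<Rightarrow> bool" where
  "C2_boundary \<Omega> \<longleftrightarrow>
     (\<forall>x\<in>frontier \<Omega>. \<exists>r>0. \<exists>e g. norm e = 1 \<and> C_k 2 g \<and>
        \<Omega> \<inter> ball x r = {y \<in> ball x r. y \<bullet> e > g (y - (y \<bullet> e) *\<^sub>R e)})"

definition bounded_C2_domain :: "'a::euclidean_space set \<Rightarrow> bool" where
  "bounded_C2_domain \<Omega> \<longleftrightarrow>
     \<Omega> \<noteq> {} \<and> open \<Omega> \<and> connected \<Omega> \<and> bounded \<Omega> \<and> C2_boundary \<Omega>"

definition test_fun :: "'a::euclidean_space set \<Rightarrow> ('a \<Rightarrow> real) \<Rightarrow> bool" where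
  "test_fun \<Omega> \<phi> \<longleftrightarrow>
     (\<forall>k. C_k k \<phi>) \<and> compact (closure {x. \<phi> x \<noteq> 0}) \<and> closure {x. \<phi> x \<noteq> 0} \<subseteq> \<Omega>"

definition pderiv_fun :: "'a::euclidean_space \<Rightarrow> ('a \<Rightarrow> real) \<Rightarrow> 'a \<Rightarrow> real" where
  "pderiv_fun i \<phi> x = frechet_derivative \<phi> (at x) i"

definition has_weak_pderiv ::
    "'a::euclidean_space set \<Rightarrow> 'a \<Rightarrow> 'a l2 \<Rightarrow> 'a l2 \<Rightarrow> bool" where
  "has_weak_pderiv \<Omega> i u g \<longleftrightarrow> u \<in> L2 \<Omega> \<and> g \<in> L2 \<Omega> \<and>
     (\<forall>\<phi>. test_fun \<Omega> \<phi> \<longrightarrow>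
        (LINT x:\<Omega>|lborel. rep_l2 u x * pderiv_fun i \<phi> x) = - (LINT x:\<Omega>|lborel. rep_l2 g x * \<phi> x))"

definition weak_pderiv :: "'a::euclidean_space set \<Rightarrow> 'a \<Rightarrow> 'a l2 \<Rightarrow> 'a l2" where
  "weak_pderiv \<Omega> i u = (THE g. has_weak_pderiv \<Omega> i u g)"

definition H1 :: "'a::euclidean_space set \<Rightarrow> 'a l2 set" where
  "H1 \<Omega> = {u \<in> L2 \<Omega>. \<forall>i\<in>Basis. \<exists>g. has_weak_pderiv \<Omega> i u g}"

definition H2 :: "'a::euclidean_space set \<Rightarrow> 'a l2 set" where
  "H2 \<Omega> = {u \<in> H1 \<Omega>. \<forall>i\<in>Basis. weak_pderiv \<Omega> i u \<in> H1 \<Omega>}"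

text \<open>The closure of the test functions in the norm of \<open>H\<^sup>1(\<Omega>)\<close>.\<close>

definition H10 :: "'a::euclidean_space set \<Rightarrow> 'a l2 set" where
  "H10 \<Omega> = {u \<in> H1 \<Omega>. \<exists>\<phi>::nat \<Rightarrow> 'a \<Rightarrow> real. (\<forall>k. test_fun \<Omega> (\<phi> k)) \<and>
     (\<lambda>k. abs_l2 (\<phi> k)) \<longlonglongrightarrow> u \<and>
     (\<forall>i\<in>Basis. (\<lambda>k. abs_l2 (pderiv_fun i (\<phi> k))) \<longlonglongrightarrow> weak_pderiv \<Omega> i u)}"


section \<open>Unbounded operators on a closed subspace of a Hilbert space\<close>

text \<open>Unbounded operators are represented by their graphs; \<open>D(A)\<close> is \<open>Domain A\<close>.\<close>

definition op_app :: "('h \<times> 'h) set \<Rightarrow> 'h \<Rightarrow> 'h" where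
  "op_app A u = (THE f. (u, f) \<in> A)"

definition adjoint_on :: "'h::real_inner set \<Rightarrow> ('h \<times> 'h) set \<Rightarrow> ('h \<times> 'h) set" where
  "adjoint_on H A = {(v, g). v \<in> H \<and> g \<in> H \<and> (\<forall>(u, f)\<in>A. f \<bullet> v = u \<bullet> g)}"

definition self_adjoint_on :: "'h::real_inner set \<Rightarrow> ('h \<times> 'h) set \<Rightarrow> bool" where
  "self_adjoint_on H A \<longleftrightarrow>
     A \<subseteq> H \<times> H \<and> subspace A \<and> single_valued A \<and> H \<subseteq> closure (Domain A) \<and> A = adjoint_on H A"

definition nonneg_op :: "('h::real_inner \<times> 'h) set \<Rightarrow> bool" where
  "nonneg_op A \<longleftrightarrow> (\<forall>(u, f)\<in>A. 0 \<le> f \<bullet> u)"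

text \<open>
  The power \<open>A\<^bsup>1/2\<^esup>\<close> of a positive self-adjoint operator is its unique nonnegative self-adjoint
  square root, so the choice made here is immaterial.
\<close>

definition op_sqrt :: "'h::real_inner set \<Rightarrow> ('h \<times> 'h) set \<Rightarrow> ('h \<times> 'h) set" where
  "op_sqrt H A = (SOME S. self_adjoint_on H S \<and> nonneg_op S \<and> S O S = A)"

definition dirichlet_laplacian :: "'a::euclidean_space set \<Rightarrow> ('a l2 \<times> 'a l2) set" where
  "dirichlet_laplacian \<Omega> =
     {(u, f). u \<in> H10 \<Omega> \<inter> H2 \<Omega> \<and> f = - (\<Sum>i\<in>Basis. weak_pderiv \<Omega> i (weak_pderiv \<Omega> i u))}"

definition sqrt_laplacian :: "'a::euclidean_space set \<Rightarrow> ('a l2 \<times> 'a l2) set" where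
  "sqrt_laplacian \<Omega> = op_sqrt (L2 \<Omega>) (dirichlet_laplacian \<Omega>)"


section \<open>Operator groups on a normed space given by a carrier and a norm\<close>

definition banach_on :: "'v::real_vector set \<Rightarrow> ('v \<Rightarrow> real) \<Rightarrow> bool" where
  "banach_on V N \<longleftrightarrow> subspace V \<and>
     (\<forall>x\<in>V. 0 \<le> N x \<and> (N x = 0 \<longleftrightarrow> x = 0)) \<and>
     (\<forall>x\<in>V. \<forall>a. N (a *\<^sub>R x) = \<bar>a\<bar> * N x) \<and>
     (\<forall>x\<in>V. \<forall>y\<in>V. N (x + y) \<le> N x + N y) \<and>
     (\<forall>s. range s \<subseteq> V \<and> (\<forall>e>0. \<exists>K. \<forall>m\<ge>K. \<forall>n\<ge>K. N (s m - s n) < e) \<longrightarrow>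
        (\<exists>x\<in>V. (\<lambda>n. N (s n - x)) \<longlonglongrightarrow> 0))"

definition bounded_op_on :: "'v::real_vector set \<Rightarrow> ('v \<Rightarrow> real) \<Rightarrow> ('v \<Rightarrow> 'v) \<Rightarrow> bool" where
  "bounded_op_on V N F \<longleftrightarrow> F ` V \<subseteq> V \<and>
     (\<forall>x\<in>V. \<forall>y\<in>V. F (x + y) = F x + F y) \<and>
     (\<forall>x\<in>V. \<forall>a. F (a *\<^sub>R x) = a *\<^sub>R F x) \<and>
     (\<exists>K. \<forall>x\<in>V. N (F x) \<le> K * N x)"

text \<open>As for \<^const>\<open>onorm\<close>, the quotient at \<open>x = 0\<close> is \<open>0\<close>.\<close>

definition onorm_on :: "'v set \<Rightarrow> ('v \<Rightarrow> real) \<Rightarrow> ('v \<Rightarrow> 'v) \<Rightarrow> real" where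
  "onorm_on V N F = (SUP x\<in>V. N (F x) / N x)"

definition C0_group :: "'v::real_vector set \<Rightarrow> ('v \<Rightarrow> real) \<Rightarrow> (real \<Rightarrow> 'v \<Rightarrow> 'v) \<Rightarrow> bool" where
  "C0_group V N T \<longleftrightarrow> banach_on V N \<and>
     (\<forall>t. bounded_op_on V N (T t)) \<and>
     (\<forall>x\<in>V. T 0 x = x) \<and>
     (\<forall>s t. \<forall>x\<in>V. T (s + t) x = T s (T t x)) \<and>
     (\<forall>x\<in>V. ((\<lambda>t. N (T t x - x)) \<longlongrightarrow> 0) (at 0))"

definition generator_on ::
    "'v::real_vector set \<Rightarrow> ('v \<Rightarrow> real) \<Rightarrow> (real \<Rightarrow> 'v \<Rightarrow> 'v) \<Rightarrow> ('v \<times> 'v) set" where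
  "generator_on V N T =
     {(x, y). x \<in> V \<and> y \<in> V \<and> ((\<lambda>t. N ((T t x - x) /\<^sub>R t - y)) \<longlongrightarrow> 0) (at 0)}"


section \<open>The third order equation as a first order system\<close>

type_synonym 'a state = "'a l2 \<times> 'a l2 \<times> 'a l2"

definition b_coeff :: "real \<Rightarrow> real \<Rightarrow> real \<Rightarrow> real" where
  "b_coeff c \<delta> \<tau> = \<delta> + \<tau> * c\<^sup>2"

definition gamma_coeff :: "real \<Rightarrow> real \<Rightarrow> real \<Rightarrow> real \<Rightarrow> real" where
  "gamma_coeff \<alpha> c \<delta> \<tau> = \<alpha> - c\<^sup>2 * \<tau> * inverse (b_coeff c \<delta> \<tau>)"

definition phase_space :: "'a::euclidean_space set \<Rightarrow> 'a state set" where
  "phase_space \<Omega> = Domain (sqrt_laplacian \<Omega>) \<times> Domain (sqrt_laplacian \<Omega>) \<times> L2 \<Omega>"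

definition phase_norm :: "'a::euclidean_space set \<Rightarrow> real \<Rightarrow> 'a state \<Rightarrow> real" where
  "phase_norm \<Omega> \<tau> = (\<lambda>(u, v, w).
     sqrt ((norm (op_app (sqrt_laplacian \<Omega>) u))\<^sup>2 + (norm (op_app (sqrt_laplacian \<Omega>) v))\<^sup>2
           + \<tau> * (norm w)\<^sup>2))"

definition MGT_operator ::
    "'a::euclidean_space set \<Rightarrow> real \<Rightarrow> real \<Rightarrow> real \<Rightarrow> real \<Rightarrow> ('a state \<times> 'a state) set" where
  "MGT_operator \<Omega> \<alpha> c \<delta> \<tau> =
     {((u, v, w), (v, w, - (inverse \<tau> *\<^sub>R op_app (dirichlet_laplacian \<Omega>)
                                  (c\<^sup>2 *\<^sub>R u + b_coeff c \<delta> \<tau> *\<^sub>R v))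
                         - (inverse \<tau> * \<alpha>) *\<^sub>R w)) | u v w.
        (u, v, w) \<in> phase_space \<Omega> \<and> w \<in> Domain (sqrt_laplacian \<Omega>) \<and>
        c\<^sup>2 *\<^sub>R u + b_coeff c \<delta> \<tau> *\<^sub>R v \<in> Domain (dirichlet_laplacian \<Omega>)}"

end

theory Submission
  imports Defs
begin

text \<open>
  The multipliers \<open>u\<^sub>t\<^sub>t + k u\<^sub>t\<close> and \<open>u\<^sub>t + k u\<close> with \<open>k = c\<^sup>2 / b\<^sup>\<tau>\<close>, together with
  \<open>\<parallel>A\<^bsup>1/2\<^esup> u\<parallel>\<^sup>2\<close>, give a Lyapunov functional that is equivalent to the square of the phase norm and
  decays exponentially along classical solutions, with constants that do not depend on \<open>\<tau>\<close> once \<open>\<tau>\<close> is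
  small; density of the domain of the generator extends the estimate to all data.

  The properties of \<open>A\<^bsup>1/2\<^esup>\<close> used here require \<open>A\<close> to be self-adjoint on \<open>L\<^sup>2(\<Omega>)\<close>. Elliptic regularity
  up to the boundary is not needed for this: the resolvent of the generator, applied to \<open>(0, 0, h)\<close>, shows
  that \<open>A + \<mu>\<close> maps onto \<open>L\<^sup>2(\<Omega>)\<close> for some \<open>\<mu> \<ge> 0\<close>, and together with symmetry and the Poincare inequality
  this makes \<open>A\<close> invertible with a bounded positive self-adjoint inverse, whose square root is constructed by
  iteration. Completeness of \<open>L\<^sup>2(\<Omega>)\<close> is likewise read off from that of the phase space.
\<close>

section \<open>Groups of operators: the generator, its domain and its resolvent\<close>

text \<open>The phase space is itself built from \<open>sqrt_laplacian\<close>, a root selected by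
  \<open>SOME\<close>; nothing is known about it until one nonnegative self-adjoint root has been
  exhibited. That is why self-adjointness of A precedes every energy estimate. It is read off from
  the group at \<tau> = 1, since A does not depend on \<tau>.

  Origin of the multipliers: with k = c^2 / b and \<alpha> = \<gamma> + \<tau> k the equation reads
  \<tau> (u_ttt + k u_tt) + \<gamma> u_tt + b A (u_t + k u) = 0. Testing with u_tt + k u_t leaves
  exactly - \<gamma> |u_tt|^2, so the hypothesis on \<gamma> is the positivity of the damping. This
  dissipation sees neither A^(1/2) (u_t + k u) nor A^(1/2) u: the multiplier u_t + k u supplies the
  former, and the derivative of |A^(1/2) u|^2 the latter, both added with a small weight \<epsilon>.

  Uniformity in \<tau>: |u_tt|^2 is dissipated without the factor \<tau> that it carries in the
  norm, so the rate does not degenerate as \<tau> tends to 0.\<close>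

locale C0_group_on =
  fixes V :: "'v::real_vector set" and N :: "'v \<Rightarrow> real" and T :: "real \<Rightarrow> 'v \<Rightarrow> 'v"
  assumes C0: "C0_group V N T"
begin

lemma banach: "banach_on V N" using C0 by (simp add: C0_group_def)
lemma sub: "subspace V" using banach by (simp add: banach_on_def)
lemma V_add: "x \<in> V \<Longrightarrow> y \<in> V \<Longrightarrow> x + y \<in> V" using sub by (rule subspace_add)
lemma V_diff: "x \<in> V \<Longrightarrow> y \<in> V \<Longrightarrow> x - y \<in> V" using sub by (rule subspace_diff)
lemma V_scale: "x \<in> V \<Longrightarrow> a *\<^sub>R x \<in> V" using sub by (rule subspace_scale)
lemma V_0: "0 \<in> V" using sub by (rule subspace_0)
lemma V_sum: "(\<And>i. i \<in> I \<Longrightarrow> f i \<in> V) \<Longrightarrow> sum f I \<in> V" using sub by (rule subspace_sum)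
lemmas V_closed = V_add V_diff V_scale V_0 V_sum

lemma N_nonneg: "x \<in> V \<Longrightarrow> 0 \<le> N x" using banach by (simp add: banach_on_def)
lemma N_eq_0: "x \<in> V \<Longrightarrow> N x = 0 \<longleftrightarrow> x = 0" using banach by (simp add: banach_on_def)
lemma N_0: "N 0 = 0" using N_eq_0[OF V_0] by simp
lemma N_scale: "x \<in> V \<Longrightarrow> N (a *\<^sub>R x) = \<bar>a\<bar> * N x" using banach by (simp add: banach_on_def)
lemma N_add: "x \<in> V \<Longrightarrow> y \<in> V \<Longrightarrow> N (x + y) \<le> N x + N y" using banach by (simp add: banach_on_def)
lemma N_commute: "x \<in> V \<Longrightarrow> y \<in> V \<Longrightarrow> N (x - y) = N (y - x)"
  using N_scale[of "y - x" "-1"] V_diff by simp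
lemma N_diff: "x \<in> V \<Longrightarrow> y \<in> V \<Longrightarrow> N x \<le> N y + N (x - y)"
  using N_add[of y "x - y"] V_diff by simp
lemma N_tri: "x \<in> V \<Longrightarrow> y \<in> V \<Longrightarrow> z \<in> V \<Longrightarrow> N (x - z) \<le> N (x - y) + N (y - z)"
  using N_add[of "x - y" "y - z"] V_diff by simp
lemma N_sum: "(\<And>i. i \<in> I \<Longrightarrow> f i \<in> V) \<Longrightarrow> N (sum f I) \<le> (\<Sum>i\<in>I. N (f i))"
proof (induction I rule: infinite_finite_induct)
  case (insert i I)
  then have "N (f i + sum f I) \<le> N (f i) + N (sum f I)" by (intro N_add V_sum) auto
  then show ?case using insert by force
qed (auto simp: N_0)

lemma complete:
  assumes "\<And>n. s n \<in> V" "\<And>e. e > 0 \<Longrightarrow> \<exists>K. \<forall>m\<ge>K. \<forall>n\<ge>K. N (s m - s n) < e"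
  obtains x where "x \<in> V" "(\<lambda>n. N (s n - x)) \<longlonglongrightarrow> 0"
proof -
  have "range s \<subseteq> V" using assms(1) by auto
  moreover have "range s \<subseteq> V \<and> (\<forall>e>0. \<exists>K. \<forall>m\<ge>K. \<forall>n\<ge>K. N (s m - s n) < e) \<longrightarrow>
      (\<exists>x\<in>V. (\<lambda>n. N (s n - x)) \<longlonglongrightarrow> 0)"
    using banach unfolding banach_on_def by (elim conjE allE[of _ s])
  ultimately show ?thesis using assms(2) that by blast
qed

text \<open>Carries estimates proved for Riemann sums, or for times on a grid, over to their
  limits.\<close>

lemma N_limit_le:
  assumes "F \<noteq> bot" "\<And>n. s n \<in> V" "x \<in> V" "((\<lambda>n. N (s n - x)) \<longlongrightarrow> 0) F" 
    "(r \<longlongrightarrow> c) F" "\<forall>\<^sub>F n in F. N (s n) \<le> r n"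
  shows "N x \<le> c"
proof (rule tendsto_le[OF assms(1)])
  show "((\<lambda>n. r n + N (s n - x)) \<longlongrightarrow> c) F"
    using tendsto_add[OF assms(5,4)] by simp
  show "((\<lambda>n. N x) \<longlongrightarrow> N x) F" by simp
  show "\<forall>\<^sub>F n in F. N x \<le> r n + N (s n - x)"
    using assms(6)
  proof eventually_elim
    case (elim n)
    then show ?case using N_diff[OF assms(3) assms(2)[of n]] N_commute[OF assms(3) assms(2)[of n]] by linarith
  qed
qed

lemma N_tendsto_unique:
  assumes "F \<noteq> bot" "\<And>n. s n \<in> V" "x \<in> V" "y \<in> V"
    "((\<lambda>n. N (s n - x)) \<longlongrightarrow> 0) F" "((\<lambda>n. N (s n - y)) \<longlongrightarrow> 0) F"
  shows "x = y"
proof -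
  have "N (x - y) \<le> 0"
  proof (rule N_limit_le[of F "\<lambda>n. s n - y" _ "\<lambda>n. N (s n - y)"])
    show "((\<lambda>n. N (s n - y - (x - y))) \<longlongrightarrow> 0) F" using assms(5) by simp
  qed (use assms V_diff in auto)
  moreover have "x - y \<in> V" using assms(3,4) by (rule V_diff)
  ultimately show ?thesis using N_nonneg[of "x - y"] N_eq_0[of "x - y"] by simp
qed

lemma T_bounded: "bounded_op_on V N (T t)" using C0 by (simp add: C0_group_def)
lemma T_V: "x \<in> V \<Longrightarrow> T t x \<in> V" using T_bounded[of t] by (auto simp: bounded_op_on_def)
lemma T_add: "x \<in> V \<Longrightarrow> y \<in> V \<Longrightarrow> T t (x + y) = T t x + T t y"
  using T_bounded[of t] by (auto simp: bounded_op_on_def)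
lemma T_scale: "x \<in> V \<Longrightarrow> T t (a *\<^sub>R x) = a *\<^sub>R T t x"
  using T_bounded[of t] by (auto simp: bounded_op_on_def)
lemma T_diff: "x \<in> V \<Longrightarrow> y \<in> V \<Longrightarrow> T t (x - y) = T t x - T t y"
  using T_add[of x "(-1) *\<^sub>R y" t] T_scale[of y t "-1"] V_scale[of y "-1"] by simp
lemma T_zero: "T t 0 = 0" using T_diff[of 0 0] V_0 by simp
lemma T_sum: "(\<And>i. i \<in> I \<Longrightarrow> f i \<in> V) \<Longrightarrow> T t (sum f I) = (\<Sum>i\<in>I. T t (f i))"
  by (induction I rule: infinite_finite_induct) (auto simp: T_zero T_add V_sum)
lemma T_bound: obtains K where "K > 0" "\<And>x. x \<in> V \<Longrightarrow> N (T t x) \<le> K * N x"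
proof -
  obtain K where K: "\<forall>x\<in>V. N (T t x) \<le> K * N x" using T_bounded[of t] by (auto simp: bounded_op_on_def)
  have "N (T t x) \<le> max K 1 * N x" if "x \<in> V" for x
    using order_trans[OF bspec[OF K that] mult_right_mono[of K "max K 1", OF _ N_nonneg[OF that]]] by simp
  then show ?thesis using that[of "max K 1"] by simp
qed
lemma T_group: "x \<in> V \<Longrightarrow> T (s + t) x = T s (T t x)" using C0 by (simp add: C0_group_def)
lemma T_0: "x \<in> V \<Longrightarrow> T 0 x = x" using C0 by (simp add: C0_group_def)
lemma T_cont0: "x \<in> V \<Longrightarrow> ((\<lambda>t. N (T t x - x)) \<longlongrightarrow> 0) (at 0)" using C0 by (simp add: C0_group_def)

lemma T_tendsto:
  assumes "\<And>n. s n \<in> V" "x \<in> V" "((\<lambda>n. N (s n - x)) \<longlongrightarrow> 0) F"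
  shows "((\<lambda>n. N (T t (s n) - T t x)) \<longlongrightarrow> 0) F"
proof -
  obtain K where K: "\<And>x. x \<in> V \<Longrightarrow> N (T t x) \<le> K * N x" using T_bound by metis
  show ?thesis
  proof (rule tendsto_sandwich[OF _ _ tendsto_const])
    show "((\<lambda>n. K * N (s n - x)) \<longlongrightarrow> 0) F" using tendsto_mult_left[OF assms(3), of K] by simp
    show "\<forall>\<^sub>F n in F. 0 \<le> N (T t (s n) - T t x)"
      using assms by (intro always_eventually allI N_nonneg V_closed T_V)
    show "\<forall>\<^sub>F n in F. N (T t (s n) - T t x) \<le> K * N (s n - x)"
      using K[OF V_diff[OF assms(1,2)]] by (simp add: T_diff assms)
  qed
qed

section \<open>Continuity of orbits\<close>

lemma orbit_tendsto:
  assumes x: "x \<in> V"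
  shows "((\<lambda>s. N (T s x - T t x)) \<longlongrightarrow> 0) (at t)"
proof -
  have "((\<lambda>h. N (T t (T h x) - T t x)) \<longlongrightarrow> 0) (at 0)"
    using x by (intro T_tendsto T_cont0 T_V)
  then have "((\<lambda>h. N (T (h + t) x - T t x)) \<longlongrightarrow> 0) (at 0)"
    using x by (simp add: add.commute[of _ t] T_group)
  then show ?thesis
    using LIM_offset_zero_iff[of t "\<lambda>s. N (T s x - T t x)" 0] by (simp add: add.commute NO_MATCH_def)
qed

lemma orbit_isCont:
  assumes "x \<in> V"
  shows "((\<lambda>s. N (T s x - T t x)) \<longlongrightarrow> 0) (nhds t)"
  using orbit_tendsto[OF assms, of t] by (simp add: tendsto_nhds_iff N_0)

text \<open>The type of \<open>V\<close> has no topology of its own, so uniform continuity of an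
  orbit is extracted from this real function of two times, to which compactness arguments
  apply.\<close>

lemma orbit_dist_continuous:
  assumes x: "x \<in> V"
  shows "continuous_on UNIV (\<lambda>(s, t). N (T s x - T t x))"
proof -
  have "((\<lambda>p. N (T (fst p) x - T (snd p) x)) \<longlongrightarrow> N (T (fst q) x - T (snd q) x)) (at q)" for q
  proof (rule Lim_null_comparison[THEN LIM_zero_cancel])
    have f: "(fst \<longlongrightarrow> fst q) (at q)" "(snd \<longlongrightarrow> snd q) (at q)" 
      by (auto intro: tendsto_fst tendsto_snd)
    show "((\<lambda>p. N (T (fst p) x - T (fst q) x) + N (T (snd p) x - T (snd q) x)) \<longlongrightarrow> 0) (at q)"
      using tendsto_add[OF filterlim_compose[OF orbit_isCont[OF x] f(1)] filterlim_compose[OF orbit_isCont[OF x] f(2)]]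
      by simp
    show "\<forall>\<^sub>F p in at q. norm (N (T (fst p) x - T (snd p) x) - N (T (fst q) x - T (snd q) x))
       \<le> N (T (fst p) x - T (fst q) x) + N (T (snd p) x - T (snd q) x)"
    proof (rule always_eventually, rule allI)
      fix p
      show "norm (N (T (fst p) x - T (snd p) x) - N (T (fst q) x - T (snd q) x))
       \<le> N (T (fst p) x - T (fst q) x) + N (T (snd p) x - T (snd q) x)"
        using N_tri[of "T (fst p) x" "T (fst q) x" "T (snd p) x"]
          N_tri[of "T (fst q) x" "T (snd q) x" "T (snd p) x"]
          N_tri[of "T (fst q) x" "T (fst p) x" "T (snd q) x"]
          N_tri[of "T (fst p) x" "T (snd p) x" "T (snd q) x"]
          N_commute[of "T (fst p) x" "T (fst q) x"] N_commute[of "T (snd p) x" "T (snd q) x"] T_V[OF x]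
        by (simp add: abs_le_iff)
    qed
  qed
  then show ?thesis by (auto intro!: continuous_at_imp_continuous_on simp: isCont_def split_beta)
qed

lemma orbit_uniform:
  assumes x: "x \<in> V" and e: "e > 0"
  obtains d where "d > 0" "\<And>s t. s \<in> {a..b} \<Longrightarrow> t \<in> {a..b} \<Longrightarrow> \<bar>s - t\<bar> < d \<Longrightarrow> N (T s x - T t x) < e"
proof -
  let ?g = "\<lambda>(s, t). N (T s x - T t x)"
  have "uniformly_continuous_on ({a..b} \<times> {a..b}) ?g"
    by (intro compact_uniformly_continuous compact_Times continuous_on_subset[OF orbit_dist_continuous[OF x]]) auto
  then obtain d where d: "d > 0" 
    "\<And>p q. p \<in> {a..b} \<times> {a..b} \<Longrightarrow> q \<in> {a..b} \<times> {a..b} \<Longrightarrow> dist q p < d \<Longrightarrow> dist (?g q) (?g p) < e"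
    using e unfolding uniformly_continuous_on_def by metis
  show ?thesis
  proof (rule that[OF d(1)])
    fix s t assume "s \<in> {a..b}" "t \<in> {a..b}" "\<bar>s - t\<bar> < d"
    \<comment> \<open>The function vanishes on the diagonal, so comparison with (t, t) bounds its
      value at (s, t).\<close>
    then have "dist (?g (s, t)) (?g (t, t)) < e"
      by (intro d(2)) (auto simp: dist_Pair_Pair dist_real_def)
    then show "N (T s x - T t x) < e" by (simp add: N_0 dist_real_def)
  qed
qed

section \<open>Integrals of orbits over [0, h] as limits of left-endpoint sums\<close>

definition riemann :: "real \<Rightarrow> 'v \<Rightarrow> nat \<Rightarrow> 'v" where
  "riemann h x n = (h / n) *\<^sub>R (\<Sum>k<n. T (real k * h / real n) x)"

lemma riemann_V: "x \<in> V \<Longrightarrow> riemann h x n \<in> V"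
  unfolding riemann_def by (intro V_scale V_sum T_V)

text \<open>Each value of the coarse sum is repeated \<open>m\<close> times, so the difference
  becomes one sum over the fine nodes, and every fine node is within h / n of the left end of its
  coarse cell.\<close>

lemma riemann_refine:
  assumes x: "x \<in> V" and h: "h > 0" and n: "n > 0" and m: "m > 0"
    and e: "\<And>s t. s \<in> {0..h} \<Longrightarrow> t \<in> {0..h} \<Longrightarrow> \<bar>s - t\<bar> \<le> h / n \<Longrightarrow> N (T s x - T t x) \<le> e"
  shows "N (riemann h x (n * m) - riemann h x n) \<le> h * e"
proof -
  let ?g = "\<lambda>i j. T (real j * h / (real n * real m)) x - T (real i * h / real n) x"
  have *: "N (?g i j) \<le> e" if ij: "i < n" "j \<in> {i * m..<i * m + m}" for i j :: nat
  proof (rule e)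
    have 1: "real i * m \<le> j" "real j \<le> real i * m + m" using ij(2) by (simp_all flip: of_nat_mult of_nat_add)
    have 2: "real i + 1 \<le> n" using ij(1) by simp
    have "real i * m + m \<le> real n * m" using mult_right_mono[OF 2, of m] by (simp add: algebra_simps)
    then have 3: "real j \<le> real n * m" using 1 by linarith
    have nm: "real n * real m > 0" using n m by simp
    show "real j * h / (real n * real m) \<in> {0..h}"
      using 3 h n m nm by (simp add: divide_le_eq mult.commute mult_left_mono)
    show "real i * h / real n \<in> {0..h}" using 2 h n by (simp add: divide_le_eq mult.commute mult_left_mono)
    have "real j * h / (real n * real m) - i * h / n = (real j - real i * m) * (h / (real n * real m))"
      using n m by (simp add: field_simps)
    also have "\<bar>\<dots>\<bar> \<le> m * (h / (real n * real m))"
    proof -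
      have "\<bar>real j - real i * m\<bar> \<le> m" using 1 by simp
      then show ?thesis unfolding abs_mult using h n m by (intro mult_mono) auto
    qed
    also have "\<dots> = h / n" using m by simp
    finally show "\<bar>real j * h / (real n * real m) - i * h / n\<bar> \<le> h / n" .
  qed
  have "riemann h x n = (h / (real n * real m)) *\<^sub>R (\<Sum>i<n. \<Sum>j\<in>{i * m..<i * m + m}. T (real i * h / real n) x)"
  proof -
    have "(\<Sum>i<n. \<Sum>j\<in>{i * m..<i * m + m}. T (real i * h / real n) x) = real m *\<^sub>R (\<Sum>i<n. T (real i * h / real n) x)"
      by (simp only: sum_constant_scaleR card_atLeastLessThan scaleR_sum_right) simp
    then show ?thesis using m by (simp add: riemann_def)
  qed
  moreover have "riemann h x (n * m) = (h / (real n * real m)) *\<^sub>R (\<Sum>i<n. \<Sum>j\<in>{i * m..<i * m + m}. T (real j * h / (real n * real m)) x)"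
    by (simp add: riemann_def sum.nat_group)
  ultimately have eq: "riemann h x (n * m) - riemann h x n = (h / (real n * real m)) *\<^sub>R (\<Sum>i<n. \<Sum>j\<in>{i * m..<i * m + m}. ?g i j)"
    by (simp only: sum_subtractf scaleR_diff_right)
  have "N (riemann h x (n * m) - riemann h x n) = (h / (real n * real m)) * N (\<Sum>i<n. \<Sum>j\<in>{i * m..<i * m + m}. ?g i j)"
    unfolding eq using x h by (subst N_scale) (simp_all add: V_sum V_diff T_V)
  also have "\<dots> \<le> (h / (n * m)) * (\<Sum>i<n. \<Sum>j\<in>{i * m..<i * m + m}. e)"
  proof -
    have "N (\<Sum>j\<in>{i * m..<i * m + m}. ?g i j) \<le> (\<Sum>j\<in>{i * m..<i * m + m}. e)" if "i < n" for i
      by (rule order_trans[OF N_sum sum_mono]) (erule *[OF that] | intro V_diff T_V x)+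
    then have "N (\<Sum>i<n. \<Sum>j\<in>{i * m..<i * m + m}. ?g i j) \<le> (\<Sum>i<n. \<Sum>j\<in>{i * m..<i * m + m}. e)"
      by (rule order_trans[OF N_sum sum_mono, rotated]) (simp, intro V_sum V_diff T_V x)
    from mult_left_mono[OF this, of "h / (n * m)"] show ?thesis using h by simp
  qed
  also have "\<dots> = h * e" using n m by simp
  finally show ?thesis .
qed

text \<open>Two sums are compared through their common refinement with \<open>Suc n * Suc m\<close>
  cells, each comparison costing at most e / 3. Indices are successors because the sum with 0 cells
  is 0 by the convention for division.\<close>

lemma riemann_convergent:
  assumes x: "x \<in> V" and h: "h > 0"
  obtains y where "y \<in> V" "(\<lambda>n. N (riemann h x (Suc n) - y)) \<longlonglongrightarrow> 0"
proof -
  have cauchy: "\<exists>K. \<forall>m\<ge>K. \<forall>n\<ge>K. N (riemann h x (Suc m) - riemann h x (Suc n)) < e" if e: "e > 0" for e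
  proof -
  have "e / (3 * h) > 0" using h e by simp
  then obtain d where d: "d > 0" 
    "\<And>s t. s \<in> {0..h} \<Longrightarrow> t \<in> {0..h} \<Longrightarrow> \<bar>s - t\<bar> < d \<Longrightarrow> N (T s x - T t x) < e / (3 * h)"
    using orbit_uniform[OF x] by metis
  obtain K :: nat where K: "h / d < K" using reals_Archimedean2 by blast
  have *: "N (riemann h x (Suc n * Suc m) - riemann h x (Suc n)) \<le> e / 3" if "n \<ge> K" for n m
  proof -
    have "h / d < Suc n" using K that by linarith
    then have "h / Suc n < d" using d(1) by (simp add: field_simps)
    then have "N (riemann h x (Suc n * Suc m) - riemann h x (Suc n)) \<le> h * (e / (3 * h))"
      using d(2) by (intro riemann_refine[OF x h]) (auto intro!: less_imp_le)
    then show ?thesis using h by simp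
  qed
  have "N (riemann h x (Suc m) - riemann h x (Suc n)) < e" if "m \<ge> K" "n \<ge> K" for m n
  proof -
    have "N (riemann h x (Suc m) - riemann h x (Suc n)) \<le> e / 3 + e / 3"
      using N_tri[OF riemann_V[OF x, of h "Suc m"] riemann_V[OF x, of h "Suc n * Suc m"] riemann_V[OF x, of h "Suc n"]]
        *[OF that(1), of n] *[OF that(2), of m] 
        N_commute[OF riemann_V[OF x] riemann_V[OF x], of h "Suc m" h "Suc n * Suc m"] 
      unfolding mult.commute[of "Suc m" "Suc n"] by linarith
    then show ?thesis using e by simp
  qed
  then show ?thesis by blast
  qed
  show ?thesis
  proof (rule complete[of "\<lambda>n. riemann h x (Suc n)", OF riemann_V[OF x] cauchy])
    fix y assume "y \<in> V" "(\<lambda>n. N (riemann h x (Suc n) - y)) \<longlonglongrightarrow> 0"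
    then show ?thesis by (rule that)
  qed
qed

text \<open>A shift by one cell makes the sum telescope and leaves only the two end terms, (h / n) T
  b (T h x - x); \<open>p\<close> such shifts are added up.\<close>

lemma riemann_shift:
  fixes p :: nat
  assumes x: "x \<in> V" and n: "n > 0"
  shows "T (a + real p * h / n) (riemann h x n) - T a (riemann h x n)
       = (h / n) *\<^sub>R (\<Sum>k<p. T (a + real k * h / real n) (T h x - x))"
proof (induction p)
  case 0
  show ?case by simp
next
  case (Suc p)
  let ?b = "a + real p * h / n"
  have shift: "T (?b + r) (riemann h x n) = (h / n) *\<^sub>R (\<Sum>k<n. T (?b + (real k * h / n + r)) x)" for r
  proof -
    have "T (?b + r) (riemann h x n) = (h / n) *\<^sub>R (\<Sum>k<n. T (?b + r) (T (real k * h / real n) x))"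
      unfolding riemann_def using x by (simp add: T_scale T_sum V_sum T_V)
    then show ?thesis using x by (simp add: add_ac flip: T_group)
  qed
  have e: "a + real (Suc p) * h / n = ?b + h / n" by (simp add: add_divide_distrib distrib_right)
  have "T (a + real (Suc p) * h / n) (riemann h x n) - T ?b (riemann h x n)
      = (h / n) *\<^sub>R ((\<Sum>k<n. T (?b + real (Suc k) * h / n) x) - (\<Sum>k<n. T (?b + real k * h / n) x))"
    unfolding e using shift[of "h / n"] shift[of 0] 
    by (simp add: scaleR_diff_right add_divide_distrib distrib_right add_ac)
  also have "\<dots> = (h / n) *\<^sub>R (T (?b + real n * h / n) x - T (?b + 0 * h / n) x)"
    using sum_lessThan_telescope[of "\<lambda>k. T (?b + real k * h / n) x" n] by (simp add: sum_subtractf)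
  also have "\<dots> = (h / n) *\<^sub>R T ?b (T h x - x)" using x n by (simp add: T_diff T_V T_group)
  finally have "T (a + real (Suc p) * h / n) (riemann h x n) = T ?b (riemann h x n) + (h / n) *\<^sub>R T ?b (T h x - x)"
    by (simp add: algebra_simps)
  then show ?case using Suc.IH by (simp add: scaleR_add_right)
qed

text \<open>For y the integral of T s x over [0, h], the increment of T y over [a, a + \<epsilon>]
  is the integral of T s (T h x - x) over that interval. Only this quantitative consequence is
  proved, which avoids a second integral.\<close>

lemma integral_increment:
  assumes x: "x \<in> V" and h: "h > 0" and y: "y \<in> V" "(\<lambda>n. N (riemann h x (Suc n) - y)) \<longlonglongrightarrow> 0"
    and eps: "\<epsilon> \<ge> 0" and eta: "\<And>s. s \<in> {a..a + \<epsilon>} \<Longrightarrow> N (T s (T h x - x) - (T h x - x)) \<le> \<eta>"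
  shows "N (T (a + \<epsilon>) y - T a y - \<epsilon> *\<^sub>R (T h x - x)) \<le> \<epsilon> * \<eta>"
proof -
  let ?z = "T h x - x"
  have z: "?z \<in> V" using x by (intro V_closed T_V)
  \<comment> \<open>Shifts that are rational multiples of h consist of whole cells of every grid
    with \<open>Suc q * Suc m\<close> cells, where \<open>riemann_shift\<close> is exact.\<close>
  have rat: "N (T (a + \<epsilon>') y - T a y - \<epsilon>' *\<^sub>R ?z) \<le> \<epsilon>' * \<eta>" 
    if r: "\<epsilon>' = real p * h / real (Suc q)" "\<epsilon>' \<le> \<epsilon>" for p q :: nat and \<epsilon>'
  proof (rule N_limit_le[OF sequentially_bot])
    define R where "R m = riemann h x (Suc q * Suc m)" for m
    have R: "R m \<in> V" for m by (simp add: R_def riemann_V[OF x] del: mult_Suc mult_Suc_right)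
    \<comment> \<open>The 1 is subtracted because \<open>y\<close> is a limit along
      \<open>Suc n\<close>.\<close>
    have "filterlim (\<lambda>m. Suc q * Suc m - 1) at_top sequentially"
      by (rule filterlim_subseq) (auto simp: strict_mono_Suc_iff)
    from filterlim_compose[OF y(2) this] have lim: "(\<lambda>m. N (R m - y)) \<longlonglongrightarrow> 0"
      by (simp add: R_def del: mult_Suc mult_Suc_right) 
    show "T (a + \<epsilon>') (R m) - T a (R m) - \<epsilon>' *\<^sub>R ?z \<in> V" for m
      using x R by (intro V_closed T_V)
    show "T (a + \<epsilon>') y - T a y - \<epsilon>' *\<^sub>R ?z \<in> V" using x y by (intro V_closed T_V)
    show "(\<lambda>m. N (T (a + \<epsilon>') (R m) - T a (R m) - \<epsilon>' *\<^sub>R ?z - (T (a + \<epsilon>') y - T a y - \<epsilon>' *\<^sub>R ?z))) \<longlonglongrightarrow> 0"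
    proof (rule tendsto_sandwich[OF _ _ tendsto_const])
      show "(\<lambda>m. N (T (a + \<epsilon>') (R m) - T (a + \<epsilon>') y) + N (T a (R m) - T a y)) \<longlonglongrightarrow> 0"
        using tendsto_add[OF T_tendsto[OF R y(1) lim] T_tendsto[OF R y(1) lim]] by simp
      show "\<forall>\<^sub>F m in sequentially. 0 \<le> N (T (a + \<epsilon>') (R m) - T a (R m) - \<epsilon>' *\<^sub>R ?z - (T (a + \<epsilon>') y - T a y - \<epsilon>' *\<^sub>R ?z))"
        using x y R by (intro always_eventually allI N_nonneg V_closed T_V)
      have "N (T (a + \<epsilon>') (R m) - T a (R m) - \<epsilon>' *\<^sub>R ?z - (T (a + \<epsilon>') y - T a y - \<epsilon>' *\<^sub>R ?z))
         \<le> N (T (a + \<epsilon>') (R m) - T (a + \<epsilon>') y) + N (T a (R m) - T a y)" for m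
      proof -
        have "T (a + \<epsilon>') (R m) - T a (R m) - \<epsilon>' *\<^sub>R ?z - (T (a + \<epsilon>') y - T a y - \<epsilon>' *\<^sub>R ?z)
          = (T (a + \<epsilon>') (R m) - T (a + \<epsilon>') y) + (T a y - T a (R m))" by simp
        then show ?thesis 
          using N_add[of "T (a + \<epsilon>') (R m) - T (a + \<epsilon>') y" "T a y - T a (R m)"] 
            N_commute[of "T a y" "T a (R m)"] V_diff T_V R y(1) by (simp only:)
      qed
      then show "\<forall>\<^sub>F m in sequentially. N (T (a + \<epsilon>') (R m) - T a (R m) - \<epsilon>' *\<^sub>R ?z - (T (a + \<epsilon>') y - T a y - \<epsilon>' *\<^sub>R ?z))
         \<le> N (T (a + \<epsilon>') (R m) - T (a + \<epsilon>') y) + N (T a (R m) - T a y)" by simp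
    qed
    show "(\<lambda>_. \<epsilon>' * \<eta>) \<longlonglongrightarrow> \<epsilon>' * \<eta>" by simp
    have "N (T (a + \<epsilon>') (R m) - T a (R m) - \<epsilon>' *\<^sub>R ?z) \<le> \<epsilon>' * \<eta>" for m
    proof -
      let ?n = "Suc q * Suc m" and ?p = "p * Suc m"
      have n: "?n > 0" by simp
      have "real ?n = real (Suc q) * real (Suc m)" "real ?p = real p * real (Suc m)" by (simp_all only: of_nat_mult)
      then have e': "\<epsilon>' = real ?p * h / real ?n" unfolding r(1) by (simp only:) (simp del: of_nat_Suc)
      have "T (a + \<epsilon>') (R m) - T a (R m) = (h / ?n) *\<^sub>R (\<Sum>k<?p. T (a + real k * h / real ?n) ?z)"
        unfolding e' R_def by (rule riemann_shift[OF x n])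
      moreover have "\<epsilon>' *\<^sub>R ?z = (h / ?n) *\<^sub>R (\<Sum>k<?p. ?z)"
        unfolding e' by (simp only: sum_constant_scaleR card_lessThan) simp
      ultimately have eq: "T (a + \<epsilon>') (R m) - T a (R m) - \<epsilon>' *\<^sub>R ?z = (h / ?n) *\<^sub>R (\<Sum>k<?p. T (a + real k * h / real ?n) ?z - ?z)"
        by (simp only: sum_subtractf scaleR_diff_right)
      have "N (T (a + \<epsilon>') (R m) - T a (R m) - \<epsilon>' *\<^sub>R ?z) = (h / ?n) * N (\<Sum>k<?p. T (a + real k * h / real ?n) ?z - ?z)"
        unfolding eq using h z by (subst N_scale) (simp_all add: V_sum V_diff T_V)
      also have "\<dots> \<le> (h / ?n) * (\<Sum>k<?p. \<eta>)"
      proof (rule mult_left_mono)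
        have "N (T (a + real k * h / real ?n) ?z - ?z) \<le> \<eta>" if k: "k < ?p" for k
        proof (rule eta)
          have "real k \<le> real ?p" using k by (intro of_nat_mono less_imp_le)
          then have "real k * h / ?n \<le> \<epsilon>'" unfolding e' using h
            by (intro divide_right_mono mult_right_mono) auto
          then show "a + real k * h / ?n \<in> {a..a + \<epsilon>}" using h r(2) by auto
        qed
        then show "N (\<Sum>k<?p. T (a + real k * h / real ?n) ?z - ?z) \<le> (\<Sum>k<?p. \<eta>)"
          using z by (intro order_trans[OF N_sum sum_mono]) (simp_all add: V_diff T_V)
      qed (use h in simp)
      also have "\<dots> = \<epsilon>' * \<eta>" unfolding e' by simp
      finally show ?thesis .
    qed
    then show "\<forall>\<^sub>F m in sequentially. N (T (a + \<epsilon>') (R m) - T a (R m) - \<epsilon>' *\<^sub>R ?z) \<le> \<epsilon>' * \<eta>" by simp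
  qed
  \<comment> \<open>Rational multiples of h approach \<epsilon> from below, so that the bound
    \<eta>, known only up to a + \<epsilon>, stays applicable.\<close>
  define r where "r q = nat \<lfloor>\<epsilon> * Suc q / h\<rfloor> * h / Suc q" for q
  have r_le: "r q \<le> \<epsilon>" and r_ge: "\<epsilon> - h / Suc q \<le> r q" for q
  proof -
    have "real (nat \<lfloor>\<epsilon> * Suc q / h\<rfloor>) = of_int \<lfloor>\<epsilon> * Suc q / h\<rfloor>" using eps h by simp
    then have 1: "real (nat \<lfloor>\<epsilon> * Suc q / h\<rfloor>) \<le> \<epsilon> * Suc q / h" "\<epsilon> * Suc q / h - 1 \<le> real (nat \<lfloor>\<epsilon> * Suc q / h\<rfloor>)"
      by linarith+
    show "r q \<le> \<epsilon>" using mult_right_mono[OF 1(1), of "h / Suc q"] h by (simp add: r_def)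
    show "\<epsilon> - h / Suc q \<le> r q" using mult_right_mono[OF 1(2), of "h / Suc q"] h 
      by (simp add: r_def left_diff_distrib diff_divide_distrib del: of_nat_Suc)
  qed
  have r: "r \<longlonglongrightarrow> \<epsilon>"
  proof (rule tendsto_sandwich[OF _ _ _ tendsto_const])
    show "(\<lambda>q. \<epsilon> - h / Suc q) \<longlonglongrightarrow> \<epsilon>"
      using tendsto_diff[OF tendsto_const, OF LIMSEQ_Suc[OF lim_const_over_n[of h]], of \<epsilon>] by simp
  qed (use r_le r_ge in auto)
  show ?thesis
  proof (rule N_limit_le[OF sequentially_bot])
    show "T (a + r q) y - T a y - r q *\<^sub>R ?z \<in> V" for q using x y by (intro V_closed T_V)
    show "T (a + \<epsilon>) y - T a y - \<epsilon> *\<^sub>R ?z \<in> V" using x y by (intro V_closed T_V)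
    show "(\<lambda>q. N (T (a + r q) y - T a y - r q *\<^sub>R ?z - (T (a + \<epsilon>) y - T a y - \<epsilon> *\<^sub>R ?z))) \<longlonglongrightarrow> 0"
    proof (rule tendsto_sandwich[OF _ _ tendsto_const])
      have "(\<lambda>q. a + r q) \<longlonglongrightarrow> a + \<epsilon>" using r by (intro tendsto_intros)
      from filterlim_compose[OF orbit_isCont[OF y(1)] this] 
      have "(\<lambda>q. N (T (a + r q) y - T (a + \<epsilon>) y) + \<bar>\<epsilon> - r q\<bar> * N ?z) \<longlonglongrightarrow> 0 + \<bar>\<epsilon> - \<epsilon>\<bar> * N ?z"
        using r by (intro tendsto_intros)
      then show "(\<lambda>q. N (T (a + r q) y - T (a + \<epsilon>) y) + \<bar>\<epsilon> - r q\<bar> * N ?z) \<longlonglongrightarrow> 0" by simp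
      show "\<forall>\<^sub>F q in sequentially. 0 \<le> N (T (a + r q) y - T a y - r q *\<^sub>R ?z - (T (a + \<epsilon>) y - T a y - \<epsilon> *\<^sub>R ?z))"
        using x y by (intro always_eventually allI N_nonneg V_closed T_V)
      have "N (T (a + r q) y - T a y - r q *\<^sub>R ?z - (T (a + \<epsilon>) y - T a y - \<epsilon> *\<^sub>R ?z))
        \<le> N (T (a + r q) y - T (a + \<epsilon>) y) + \<bar>\<epsilon> - r q\<bar> * N ?z" for q
      proof -
        have "T (a + r q) y - T a y - r q *\<^sub>R ?z - (T (a + \<epsilon>) y - T a y - \<epsilon> *\<^sub>R ?z)
          = (T (a + r q) y - T (a + \<epsilon>) y) + (\<epsilon> - r q) *\<^sub>R ?z" by (simp add: scaleR_diff_left)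
        then show ?thesis using N_add[of "T (a + r q) y - T (a + \<epsilon>) y" "(\<epsilon> - r q) *\<^sub>R ?z"] N_scale[OF z]
          V_diff T_V y(1) V_scale z by (simp only:)
      qed
      then show "\<forall>\<^sub>F q in sequentially. N (T (a + r q) y - T a y - r q *\<^sub>R ?z - (T (a + \<epsilon>) y - T a y - \<epsilon> *\<^sub>R ?z))
        \<le> N (T (a + r q) y - T (a + \<epsilon>) y) + \<bar>\<epsilon> - r q\<bar> * N ?z" by simp
    qed
    show "(\<lambda>q. r q * \<eta>) \<longlonglongrightarrow> \<epsilon> * \<eta>" using r by (intro tendsto_intros)
    show "\<forall>\<^sub>F q in sequentially. N (T (a + r q) y - T a y - r q *\<^sub>R ?z) \<le> r q * \<eta>"
      using rat r_le by (auto simp: r_def)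
  qed
qed

text \<open>Integrals of orbits lie in the domain of the generator:
  \<open>integral_increment\<close> near time 0, with \<eta> small by continuity of the orbit of T h
  x - x, is the difference quotient estimate.\<close>

lemma integral_in_generator:
  assumes x: "x \<in> V" and h: "h > 0" and y: "y \<in> V" "(\<lambda>n. N (riemann h x (Suc n) - y)) \<longlonglongrightarrow> 0"
  shows "(y, T h x - x) \<in> generator_on V N T"
proof -
  let ?z = "T h x - x"
  have z: "?z \<in> V" using x by (intro V_closed T_V)
  have "((\<lambda>t. N ((T t y - y) /\<^sub>R t - ?z)) \<longlongrightarrow> 0) (at 0)"
  proof (rule tendstoI)
    fix e :: real assume e: "e > 0"
    then have "\<forall>\<^sub>F s in nhds 0. dist (N (T s ?z - T 0 ?z)) 0 < e / 2"
      by (intro tendstoD[OF orbit_isCont[OF z]]) simp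
    then obtain d where d: "d > 0" "\<forall>s. dist s 0 < d \<longrightarrow> dist (N (T s ?z - T 0 ?z)) 0 < e / 2"
      unfolding eventually_nhds_metric by blast
    have d': "N (T s ?z - ?z) \<le> e / 2" if "\<bar>s\<bar> < d" for s
      using d(2)[rule_format, of s] that by (simp add: T_0[OF z] dist_real_def)
    have "N ((T t y - y) /\<^sub>R t - ?z) < e" if t: "t \<noteq> 0" "\<bar>t\<bar> < d" for t
    proof -
      have tV: "T t y - y - t *\<^sub>R ?z \<in> V" using x y by (intro V_closed T_V)
      have "N (T t y - y - t *\<^sub>R ?z) \<le> \<bar>t\<bar> * (e / 2)"
      proof (cases "t > 0")
        case True
        then show ?thesis
          using integral_increment[OF x h y, of t 0 "e / 2"] d' t y by (simp add: T_0)
      next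
        case False
        \<comment> \<open>For negative t the increment is taken from a = t over the length - t, that
          is, up to time 0.\<close>
        then have "N (T (t + - t) y - T t y - (- t) *\<^sub>R ?z) \<le> (- t) * (e / 2)"
          using t d' by (intro integral_increment[OF x h y]) auto
        then have "N (y - T t y + t *\<^sub>R ?z) \<le> (- t) * (e / 2)" by (simp add: T_0[OF y(1)])
        moreover have "y - T t y + t *\<^sub>R ?z = (-1) *\<^sub>R (T t y - y - t *\<^sub>R ?z)" by simp
        ultimately show ?thesis using N_scale[OF tV, of "-1"] False by simp
      qed
      moreover have "(T t y - y) /\<^sub>R t - ?z = (1 / t) *\<^sub>R (T t y - y - t *\<^sub>R ?z)"
        using t(1) by (simp add: scaleR_diff_right divide_inverse)
      ultimately have "N ((T t y - y) /\<^sub>R t - ?z) \<le> e / 2"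
        using N_scale[OF tV, of "1 / t"] t(1) by (simp add: pos_divide_le_eq mult.commute)
      then show ?thesis using e by simp
    qed
    then show "\<forall>\<^sub>F t in at 0. dist (N ((T t y - y) /\<^sub>R t - ?z)) 0 < e"
      unfolding eventually_at using d(1) N_nonneg[of "(T t y - y) /\<^sub>R t - ?z" for t] V_closed T_V y z 
      by (intro exI[of _ d]) (auto simp: dist_real_def)
  qed
  then show ?thesis unfolding generator_on_def using y(1) z by simp
qed

lemma generator_scale:
  assumes "(y, z) \<in> generator_on V N T"
  shows "(a *\<^sub>R y, a *\<^sub>R z) \<in> generator_on V N T"
proof -
  have yz: "y \<in> V" "z \<in> V" "((\<lambda>t. N ((T t y - y) /\<^sub>R t - z)) \<longlongrightarrow> 0) (at 0)"
    using assms by (auto simp: generator_on_def)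
  have "(T t (a *\<^sub>R y) - a *\<^sub>R y) /\<^sub>R t - a *\<^sub>R z = a *\<^sub>R ((T t y - y) /\<^sub>R t - z)" for t
    using yz by (simp add: T_scale scaleR_diff_right mult.commute)
  then have "N ((T t (a *\<^sub>R y) - a *\<^sub>R y) /\<^sub>R t - a *\<^sub>R z) = \<bar>a\<bar> * N ((T t y - y) /\<^sub>R t - z)" for t
    using yz by (simp add: N_scale V_closed T_V)
  then show ?thesis using yz tendsto_mult_left[OF yz(3), of "\<bar>a\<bar>"] by (simp add: generator_on_def V_scale)
qed

text \<open>The mean of the orbit over a short interval [0, h] is close to x. The sum with one cell
  is exactly h x, so \<open>riemann_refine\<close> with n = 1 already measures the distance.\<close>

lemma generator_dense:
  assumes x: "x \<in> V" and e: "e > 0"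
  obtains y z where "(y, z) \<in> generator_on V N T" "N (y - x) < e"
proof -
  have "e / 2 > 0" using e by simp
  then obtain d where d: "d > 0" 
    "\<And>s t. s \<in> {0..1} \<Longrightarrow> t \<in> {0..1} \<Longrightarrow> \<bar>s - t\<bar> < d \<Longrightarrow> N (T s x - T t x) < e / 2"
    using orbit_uniform[OF x] by metis
  define h where "h = min 1 (d / 2)"
  have h: "h > 0" "h \<le> 1" "h < d" using d(1) by (auto simp: h_def min_def)
  obtain y where y: "y \<in> V" "(\<lambda>n. N (riemann h x (Suc n) - y)) \<longlonglongrightarrow> 0"
    using riemann_convergent[OF x h(1)] by metis
  have "N (y - h *\<^sub>R x) \<le> h * (e / 2)"
  proof (rule N_limit_le[OF sequentially_bot])
    show "(\<lambda>n. N (riemann h x (Suc n) - h *\<^sub>R x - (y - h *\<^sub>R x))) \<longlonglongrightarrow> 0" using y by simp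
    have "riemann h x 1 = h *\<^sub>R x" by (simp add: riemann_def T_0 x lessThan_Suc)
    moreover have "N (riemann h x (1 * Suc n) - riemann h x 1) \<le> h * (e / 2)" for n
      using d(2) h by (intro riemann_refine[OF x h(1)]) (auto intro!: less_imp_le)
    ultimately show "\<forall>\<^sub>F n in sequentially. N (riemann h x (Suc n) - h *\<^sub>R x) \<le> h * (e / 2)" by simp
    show "(\<lambda>_. h * (e / 2)) \<longlonglongrightarrow> h * (e / 2)" by simp
  qed (use x y in \<open>simp_all add: V_diff V_scale riemann_V\<close>)
  moreover have "(1 / h) *\<^sub>R y - x = (1 / h) *\<^sub>R (y - h *\<^sub>R x)" using h by (simp add: scaleR_diff_right)
  ultimately have "N ((1 / h) *\<^sub>R y - x) \<le> e / 2"
    using N_scale[of "y - h *\<^sub>R x" "1 / h"] V_diff[OF y(1) V_scale[OF x]] h 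
    by (simp add: pos_divide_le_eq mult.commute)
  moreover have "((1 / h) *\<^sub>R y, (1 / h) *\<^sub>R (T h x - x)) \<in> generator_on V N T"
    by (rule generator_scale[OF integral_in_generator[OF x h(1) y]])
  ultimately show ?thesis using that e by fastforce
qed

lemma generator_invariant:
  assumes "(x, y) \<in> generator_on V N T"
  shows "(T t x, T t y) \<in> generator_on V N T"
    and "((\<lambda>s. N ((T (t + s) x - T t x) /\<^sub>R s - T t y)) \<longlongrightarrow> 0) (at 0)"
proof -
  have xy: "x \<in> V" "y \<in> V" "((\<lambda>t. N ((T t x - x) /\<^sub>R t - y)) \<longlongrightarrow> 0) (at 0)"
    using assms by (auto simp: generator_on_def)
  have "((\<lambda>s. N (T t ((T s x - x) /\<^sub>R s) - T t y)) \<longlongrightarrow> 0) (at 0)"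
    using xy by (intro T_tendsto V_closed T_V) auto
  then show 1: "((\<lambda>s. N ((T (t + s) x - T t x) /\<^sub>R s - T t y)) \<longlongrightarrow> 0) (at 0)"
    using xy by (simp add: T_scale T_diff T_V V_diff T_group)
  have "T (t + s) x = T s (T t x)" for s
    using xy(1) by (simp add: T_group add.commute[of t])
  then show "(T t x, T t y) \<in> generator_on V N T" 
    using 1 xy by (simp add: generator_on_def T_V)
qed

section \<open>The resolvent, by exponential rescaling\<close>

definition rescaled :: "real \<Rightarrow> real \<Rightarrow> 'v \<Rightarrow> 'v" where
  "rescaled \<mu> t x = exp (- \<mu> * t) *\<^sub>R T t x"

lemma C0_group_rescaled: "C0_group V N (rescaled \<mu>)"
  unfolding C0_group_def
proof (intro conjI allI ballI)
  fix t
  obtain K where K: "K > 0" "\<And>x. x \<in> V \<Longrightarrow> N (T t x) \<le> K * N x" using T_bound by metis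
  have "\<forall>x\<in>V. N (rescaled \<mu> t x) \<le> exp (- \<mu> * t) * K * N x"
    using K by (simp add: rescaled_def N_scale T_V mult_left_mono mult.assoc)
  then show "bounded_op_on V N (rescaled \<mu> t)"
    unfolding bounded_op_on_def
    by (auto simp: rescaled_def T_add T_scale scaleR_add_right intro!: V_scale T_V)
next
  fix s t x assume "x \<in> V"
  then show "rescaled \<mu> (s + t) x = rescaled \<mu> s (rescaled \<mu> t x)"
    by (simp add: rescaled_def T_scale T_V T_group ring_distribs flip: exp_add)
next
  fix x assume x: "x \<in> V"
  show "((\<lambda>t. N (rescaled \<mu> t x - x)) \<longlongrightarrow> 0) (at 0)"
  proof (rule tendsto_sandwich[OF _ _ tendsto_const])
    show "\<forall>\<^sub>F t in at 0. 0 \<le> N (rescaled \<mu> t x - x)"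
      using x by (simp add: rescaled_def N_nonneg V_closed T_V)
    have "N (rescaled \<mu> t x - x) \<le> exp (- \<mu> * t) * N (T t x - x) + \<bar>exp (- \<mu> * t) - 1\<bar> * N x" for t
    proof -
      have "rescaled \<mu> t x - x = exp (- \<mu> * t) *\<^sub>R (T t x - x) + (exp (- \<mu> * t) - 1) *\<^sub>R x"
        by (simp add: rescaled_def algebra_simps)
      then show ?thesis 
        using N_add[of "exp (- \<mu> * t) *\<^sub>R (T t x - x)" "(exp (- \<mu> * t) - 1) *\<^sub>R x"] x
        by (simp add: N_scale V_closed T_V)
    qed
    then show "\<forall>\<^sub>F t in at 0. N (rescaled \<mu> t x - x) \<le> exp (- \<mu> * t) * N (T t x - x) + \<bar>exp (- \<mu> * t) - 1\<bar> * N x"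
      by simp
    have "((\<lambda>t. exp (- \<mu> * t) * N (T t x - x) + \<bar>exp (- \<mu> * t) - 1\<bar> * N x)
       \<longlongrightarrow> exp (- \<mu> * 0) * 0 + \<bar>exp (- \<mu> * 0) - 1\<bar> * N x) (at 0)"
      by (intro tendsto_intros T_cont0 x)
    then show "((\<lambda>t. exp (- \<mu> * t) * N (T t x - x) + \<bar>exp (- \<mu> * t) - 1\<bar> * N x) \<longlongrightarrow> 0) (at 0)"
      by simp
  qed
qed (auto simp: rescaled_def T_0 banach)

text \<open>Rescaling subtracts \<mu> from the generator. The bound is the product rule for exp
  (\<mu> t) times the rescaled orbit, one summand for each of its three error terms.\<close>

lemma generator_rescaled:
  assumes "(y, z) \<in> generator_on V N (rescaled \<mu>)"
  shows "(y, z + \<mu> *\<^sub>R y) \<in> generator_on V N T"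
proof -
  have y: "y \<in> V" and z: "z \<in> V" and lim: "((\<lambda>t. N ((rescaled \<mu> t y - y) /\<^sub>R t - z)) \<longlongrightarrow> 0) (at 0)"
    using assms by (auto simp: generator_on_def)
  have rV: "rescaled \<mu> t y \<in> V" for t by (simp add: rescaled_def V_scale T_V y)
  let ?B = "\<lambda>t. exp (\<mu> * t) * N ((rescaled \<mu> t y - y) /\<^sub>R t - z) + \<bar>exp (\<mu> * t) - 1\<bar> * N z
     + \<bar>(exp (\<mu> * t) - 1) / t - \<mu>\<bar> * N y"
  have "((\<lambda>t. N ((T t y - y) /\<^sub>R t - (z + \<mu> *\<^sub>R y))) \<longlongrightarrow> 0) (at 0)"
  proof (rule tendsto_sandwich[OF _ _ tendsto_const])
    show "\<forall>\<^sub>F t in at 0. 0 \<le> N ((T t y - y) /\<^sub>R t - (z + \<mu> *\<^sub>R y))"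
      using y z by (simp add: N_nonneg V_closed T_V)
    have "N ((T t y - y) /\<^sub>R t - (z + \<mu> *\<^sub>R y)) \<le> ?B t" for t
    proof -
      let ?a = "exp (\<mu> * t) *\<^sub>R ((rescaled \<mu> t y - y) /\<^sub>R t - z)" and ?b = "(exp (\<mu> * t) - 1) *\<^sub>R z"
        and ?c = "((exp (\<mu> * t) - 1) / t - \<mu>) *\<^sub>R y"
      have "T t y = exp (\<mu> * t) *\<^sub>R rescaled \<mu> t y" by (simp add: rescaled_def flip: exp_add)
      then have "(T t y - y) /\<^sub>R t - (z + \<mu> *\<^sub>R y) = ?a + ?b + ?c"
        by (simp add: algebra_simps divide_inverse)
      moreover have "N (?a + ?b + ?c) \<le> (N ?a + N ?b) + N ?c"
      proof -
        have "?a \<in> V" "?b \<in> V" "?c \<in> V" using y z rV by (intro V_closed; simp)+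
        then show ?thesis by (intro order_trans[OF N_add add_right_mono[OF N_add]] V_add)
      qed
      moreover have "N ?a = exp (\<mu> * t) * N ((rescaled \<mu> t y - y) /\<^sub>R t - z)" 
        "N ?b = \<bar>exp (\<mu> * t) - 1\<bar> * N z" "N ?c = \<bar>(exp (\<mu> * t) - 1) / t - \<mu>\<bar> * N y"
        using y z rV by (simp_all add: N_scale V_diff V_scale)
      ultimately show ?thesis by (simp only:)
    qed
    then show "\<forall>\<^sub>F t in at 0. N ((T t y - y) /\<^sub>R t - (z + \<mu> *\<^sub>R y)) \<le> ?B t" by simp
    have "((\<lambda>t. exp (\<mu> * t)) has_field_derivative \<mu>) (at 0)"
      by (auto intro!: derivative_eq_intros)
    then have "((\<lambda>t. (exp (\<mu> * t) - 1) / t) \<longlongrightarrow> \<mu>) (at 0)"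
      by (simp add: DERIV_def)
    then have "(?B \<longlongrightarrow> exp (\<mu> * 0) * 0 + \<bar>exp (\<mu> * 0) - 1\<bar> * N z + \<bar>\<mu> - \<mu>\<bar> * N y) (at 0)"
      by (intro tendsto_intros lim)
    then show "(?B \<longlongrightarrow> 0) (at 0)" by simp
  qed
  then show ?thesis using y z by (simp add: generator_on_def V_closed)
qed

text \<open>\<open>X\<close> is the sum of the iterates T (k h) x, which the group law identifies
  with the powers of T h; the hypothesis gives geometric decay.\<close>

lemma neumann_series:
  assumes Q: "\<And>x. x \<in> V \<Longrightarrow> N (T h x) \<le> N x / 2" and x: "x \<in> V"
  obtains X where "X \<in> V" "T h X = X - x"
proof -
  have pow: "N (T (real k * h) x) \<le> (1 / 2) ^ k * N x" for k
  proof (induction k)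
    case (Suc k)
    have "T (real (Suc k) * h) x = T h (T (real k * h) x)" using x by (simp add: distrib_right flip: T_group)
    then show ?case using Q[OF T_V[OF x], of "real k * h"] Suc by simp
  qed (use x in \<open>simp add: T_0\<close>)
  define s where "s n = (\<Sum>k<n. T (real k * h) x)" for n
  define r where "r n = (\<Sum>k<n. (1 / 2 :: real) ^ k * N x)" for n
  have sV: "s n \<in> V" for n unfolding s_def using x by (intro V_sum T_V)
  have le: "N (s m - s n) \<le> dist (r m) (r n)" if "n \<le> m" for m n
  proof -
    have "s m - s n = (\<Sum>k\<in>{n..<m}. T (real k * h) x)" "r m - r n = (\<Sum>k\<in>{n..<m}. (1 / 2) ^ k * N x)"
      using that sum_diff_nat_ivl[of 0 n m] by (auto simp: s_def r_def lessThan_atLeast0)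
    moreover have "N (\<Sum>k\<in>{n..<m}. T (real k * h) x) \<le> (\<Sum>k\<in>{n..<m}. (1 / 2) ^ k * N x)"
      by (rule order_trans[OF N_sum sum_mono]) (auto intro: pow T_V x)
    ultimately show ?thesis by (simp add: dist_real_def)
  qed
  have "r \<longlonglongrightarrow> (\<Sum>k. (1 / 2) ^ k * N x)"
    unfolding r_def by (intro summable_LIMSEQ summable_mult2 summable_geometric) simp
  then have "Cauchy r" by (intro LIMSEQ_imp_Cauchy)
  then have "\<exists>K. \<forall>m\<ge>K. \<forall>n\<ge>K. N (s m - s n) < e" if e: "e > 0" for e
  proof -
    obtain K where K: "\<And>m n. m \<ge> K \<Longrightarrow> n \<ge> K \<Longrightarrow> dist (r m) (r n) < e"
      using \<open>Cauchy r\<close> e unfolding Cauchy_def by metis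
    have "N (s m - s n) < e" if "m \<ge> K" "n \<ge> K" for m n
      using le[of n m] le[of m n] K[OF that] K[OF that(2,1)] N_commute[OF sV sV, of m n] by linarith
    then show ?thesis by blast
  qed
  then obtain X where X: "X \<in> V" "(\<lambda>n. N (s n - X)) \<longlonglongrightarrow> 0" using complete[of s] sV by metis
  have step: "T h (s n) = s (Suc n) - x" for n
  proof -
    have "T h (s n) = (\<Sum>k<n. T (real (Suc k) * h) x)"
      unfolding s_def using x by (simp add: T_sum T_V distrib_right flip: T_group)
    also have "\<dots> = s (Suc n) - x" unfolding s_def sum.lessThan_Suc_shift by (simp add: T_0 x)
    finally show ?thesis .
  qed
  have "T h X = X - x"
  proof (rule N_tendsto_unique[OF sequentially_bot, of "\<lambda>n. T h (s n)"])
    show "(\<lambda>n. N (T h (s n) - T h X)) \<longlonglongrightarrow> 0" by (intro T_tendsto sV X)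
    show "(\<lambda>n. N (T h (s n) - (X - x))) \<longlonglongrightarrow> 0" using LIMSEQ_Suc[OF X(2)] by (simp add: step)
  qed (use sV X x in \<open>auto intro!: T_V V_diff\<close>)
  then show ?thesis using that X by blast
qed

text \<open>A Laplace transform over the half line is avoided. Let Q be the rescaled operator at
  time 1 and X solve X - Q X = x; the rescaled integral y of X over [0, 1] has generator value Q X -
  X = - x, and undoing the rescaling gives \<mu> y - x.\<close>

lemma generator_resolvent:
  obtains \<mu> where "\<mu> > 0" "\<And>x. x \<in> V \<Longrightarrow> \<exists>y. (y, \<mu> *\<^sub>R y - x) \<in> generator_on V N T"
proof -
  obtain K where K: "K > 0" "\<And>x. x \<in> V \<Longrightarrow> N (T 1 x) \<le> K * N x" using T_bound by metis
  \<comment> \<open>The logarithm makes exp (- \<mu>) K at most 1 / 2, so the rescaled operator at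
    time 1 halves the norm; the 1 keeps \<mu> positive.\<close>
  define \<mu> where "\<mu> = max 1 (ln (2 * K))"
  interpret R: C0_group_on V N "rescaled \<mu>" by unfold_locales (rule C0_group_rescaled)
  have "exp (ln (2 * K)) \<le> exp \<mu>" by (simp add: \<mu>_def)
  then have "exp (- \<mu>) * K \<le> 1 / 2" using K(1) by (simp add: exp_minus field_simps)
  then have Q: "N (rescaled \<mu> 1 x) \<le> N x / 2" if "x \<in> V" for x
  proof -
    have "N (rescaled \<mu> 1 x) = exp (- \<mu>) * N (T 1 x)" using that by (simp add: rescaled_def N_scale T_V)
    also have "\<dots> \<le> exp (- \<mu>) * (K * N x)" using K(2)[OF that] by (intro mult_left_mono) auto
    also have "\<dots> = (exp (- \<mu>) * K) * N x" by simp
    also have "\<dots> \<le> 1 / 2 * N x" by (rule mult_right_mono) (fact, rule N_nonneg[OF that])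
    finally show ?thesis by simp
  qed
  have "\<exists>y. (y, \<mu> *\<^sub>R y - x) \<in> generator_on V N T" if x: "x \<in> V" for x
  proof -
    obtain X where X: "X \<in> V" "rescaled \<mu> 1 X = X - x" using R.neumann_series[OF Q x] by metis
    obtain y where "y \<in> V" "(\<lambda>n. N (R.riemann 1 X (Suc n) - y)) \<longlonglongrightarrow> 0"
      using R.riemann_convergent[OF X(1) zero_less_one] by metis
    from R.integral_in_generator[OF X(1) zero_less_one this]
    have "(y, - x) \<in> generator_on V N (rescaled \<mu>)" by (simp add: X(2))
    from generator_rescaled[OF this] show ?thesis by (auto simp: algebra_simps)
  qed
  moreover have "\<mu> > 0" by (simp add: \<mu>_def)
  ultimately show ?thesis using that by blast
qed

end

section \<open>The square root of a positive operator with bounded inverse\<close>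

text \<open>Symmetry with a full range stands in for self-adjointness, which is not assumed; density
  of the domain is a consequence, \<open>range_K_dense\<close>.\<close>

locale positive_surjective =
  fixes H :: "'h::real_inner set" and A :: "('h \<times> 'h) set" and \<kappa> :: real
  assumes sub: "subspace H"
    and complete: "complete H"
    and in_H: "A \<subseteq> H \<times> H"
    and sv: "single_valued A"
    and symmetric: "(u, f) \<in> A \<Longrightarrow> (v, g) \<in> A \<Longrightarrow> f \<bullet> v = u \<bullet> g"
    and coercive: "(u, f) \<in> A \<Longrightarrow> \<kappa> * (norm u)\<^sup>2 \<le> f \<bullet> u"
    and kappa: "\<kappa> > 0"
    and onto: "f \<in> H \<Longrightarrow> \<exists>u. (u, f) \<in> A"
begin

definition K :: "'h \<Rightarrow> 'h" where "K f = (SOME u. (u, f) \<in> A)"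

lemma K_A: "f \<in> H \<Longrightarrow> (K f, f) \<in> A"
  unfolding K_def using onto by (rule someI_ex)

lemma K_H: "f \<in> H \<Longrightarrow> K f \<in> H" using K_A in_H by blast

lemma orth_H: "x \<in> H \<Longrightarrow> (\<And>y. y \<in> H \<Longrightarrow> x \<bullet> y = 0) \<Longrightarrow> x = 0"
  by (metis inner_eq_zero_iff)

lemma K_sym: "f \<in> H \<Longrightarrow> g \<in> H \<Longrightarrow> K f \<bullet> g = f \<bullet> K g"
  using symmetric[OF K_A K_A] by simp

text \<open>Every y in \<open>H\<close> is a value of A, so by symmetry u - K f is orthogonal to all
  of \<open>H\<close>. The same duality gives linearity of \<open>K\<close>.\<close>

lemma K_unique: 
  assumes "(u, f) \<in> A" shows "u = K f"
proof -
  have f: "f \<in> H" "u \<in> H" using assms in_H by auto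
  have "(u - K f) \<bullet> y = 0" if "y \<in> H" for y
    using symmetric[OF assms K_A[OF that]] K_sym[OF f(1) that] by (simp add: inner_diff_left)
  then show ?thesis using orth_H[of "u - K f"] f K_H sub by (simp add: subspace_diff)
qed

lemma K_add: "f \<in> H \<Longrightarrow> g \<in> H \<Longrightarrow> K (f + g) = K f + K g"
  using orth_H[of "K (f + g) - (K f + K g)"] K_H sub
  by (simp add: subspace_diff subspace_add inner_diff_left inner_add_left K_sym)

lemma K_scale: "f \<in> H \<Longrightarrow> K (a *\<^sub>R f) = a *\<^sub>R K f"
  using orth_H[of "K (a *\<^sub>R f) - a *\<^sub>R K f"] K_H sub
  by (simp add: subspace_diff subspace_scale inner_diff_left K_sym)

lemma norm_K:
  assumes f: "f \<in> H" shows "\<kappa> * norm (K f) \<le> norm f"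
proof (cases "K f = 0")
  case False
  have "\<kappa> * norm (K f) * norm (K f) \<le> norm f * norm (K f)"
    using coercive[OF K_A[OF f]] Cauchy_Schwarz_ineq2[of f "K f"] by (simp add: power2_eq_square)
  then show ?thesis using False by simp
qed simp

section \<open>Square root of the bounded inverse, by iteration\<close>

definition C :: "'h \<Rightarrow> 'h" where "C f = f - \<kappa> *\<^sub>R K f"

lemma C_H: "f \<in> H \<Longrightarrow> C f \<in> H"
  unfolding C_def using K_H sub by (intro subspace_diff subspace_scale)

lemma C_sym: "f \<in> H \<Longrightarrow> g \<in> H \<Longrightarrow> C f \<bullet> g = f \<bullet> C g"
  unfolding C_def using K_sym[of f g] by (simp add: inner_diff_left inner_diff_right)

lemma C_linear: "f \<in> H \<Longrightarrow> g \<in> H \<Longrightarrow> C (f + g) = C f + C g" "f \<in> H \<Longrightarrow> C (a *\<^sub>R f) = a *\<^sub>R C f"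
  unfolding C_def by (simp_all add: K_add K_scale algebra_simps)

text \<open>Expanding the square, coercivity in the form \<kappa> |K f|^2 \<le> f . K f lets the
  mixed term outweigh the quadratic one.\<close>

lemma norm_C: assumes f: "f \<in> H" shows "norm (C f) \<le> norm f"
proof (rule power2_le_imp_le)
  have "(norm (C f))\<^sup>2 = (norm f)\<^sup>2 - 2 * \<kappa> * (f \<bullet> K f) + \<kappa>\<^sup>2 * (norm (K f))\<^sup>2"
    unfolding C_def power2_norm_eq_inner by (simp add: algebra_simps inner_commute power2_eq_square)
  moreover have "\<kappa>\<^sup>2 * (norm (K f))\<^sup>2 \<le> \<kappa> * (f \<bullet> K f)"
    using mult_left_mono[OF coercive[OF K_A[OF f]], of \<kappa>] kappa by (simp add: power2_eq_square)
  moreover have "0 \<le> \<kappa> * (f \<bullet> K f)"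
    using coercive[OF K_A[OF f]] kappa by (meson mult_nonneg_nonneg order_trans zero_le_power2 less_imp_le)
  ultimately show "(norm (C f))\<^sup>2 \<le> (norm f)\<^sup>2" by linarith
qed simp

text \<open>Iteration for L = (C + L^2) / 2. A solution satisfies (I - L)^2 = I - C = \<kappa> K, so
  I - L is a root of \<kappa> K.\<close>

primrec B :: "nat \<Rightarrow> 'h \<Rightarrow> 'h" where
  "B 0 f = 0"
| "B (Suc n) f = (1 / 2) *\<^sub>R (C f + B n (B n f))"

text \<open>Scalar majorant of \<open>B\<close>: the same recursion with the contraction
  \<open>C\<close> replaced by 1. It increases and stays below 1.\<close>

primrec b :: "nat \<Rightarrow> real" where
  "b 0 = 0"
| "b (Suc n) = (1 + (b n)\<^sup>2) / 2"

lemma b_bounds: "0 \<le> b n \<and> b n \<le> 1"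
proof (induction n)
  case (Suc n)
  then have "(b n)\<^sup>2 \<le> 1" by (simp add: power_le_one)
  then show ?case by simp
qed simp

lemma b_mono: "b n \<le> b (Suc n)"
  using sum_squares_bound[of 1 "b n"] by simp

lemma b_le: "n \<le> m \<Longrightarrow> b n \<le> b m"
  using lift_Suc_mono_le[of b n m] b_mono by simp

lemma B_H: "f \<in> H \<Longrightarrow> B n f \<in> H"
proof (induction n arbitrary: f)
  case 0 then show ?case using sub by (simp add: subspace_0)
next
  case (Suc n) then show ?case using sub C_H by (simp add: subspace_add subspace_scale)
qed

lemma B_linear: "f \<in> H \<Longrightarrow> g \<in> H \<Longrightarrow> B n (f + g) = B n f + B n g" 
  "f \<in> H \<Longrightarrow> B n (a *\<^sub>R f) = a *\<^sub>R B n f"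
proof (induction n arbitrary: f g)
  case (Suc n)
  { case 1 then show ?case using Suc.IH(1) B_H by (simp add: C_linear algebra_simps) }
  { case 2 then show ?case using Suc.IH(2) B_H by (simp add: C_linear algebra_simps) }
qed simp_all

lemma B_diff: "f \<in> H \<Longrightarrow> g \<in> H \<Longrightarrow> B n (f - g) = B n f - B n g" 
  using B_linear(1)[of f "- g" n] B_linear(2)[of g n "-1"] sub by (simp add: subspace_neg)

lemma B_sym: "f \<in> H \<Longrightarrow> g \<in> H \<Longrightarrow> B n f \<bullet> g = f \<bullet> B n g"
proof (induction n arbitrary: f g)
  case (Suc n)
  have "B n (B n f) \<bullet> g = f \<bullet> B n (B n g)" using Suc B_H by simp
  then show ?case using Suc.prems C_sym by (simp add: inner_add_left inner_add_right)
qed simp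

lemma norm_B: "f \<in> H \<Longrightarrow> norm (B n f) \<le> b n * norm f"
proof (induction n arbitrary: f)
  case (Suc n)
  have "norm (B n (B n f)) \<le> b n * norm (B n f)" using Suc B_H by simp
  also have "\<dots> \<le> b n * (b n * norm f)" using Suc b_bounds by (intro mult_left_mono) auto
  finally have "norm (C f + B n (B n f)) \<le> norm f + b n * (b n * norm f)"
    using norm_C[OF Suc.prems] by (intro norm_triangle_le) simp
  then show ?case by (simp add: power2_eq_square distrib_right mult.assoc)
qed simp

lemma norm_B_le: "f \<in> H \<Longrightarrow> norm (B n f) \<le> norm f"
  using norm_B[of f n] b_bounds[of n] mult_right_mono[of "b n" 1 "norm f"] by simp

text \<open>With D the difference of consecutive iterates, the difference of their squares is B
  (n+1) D + D B n, a splitting that requires no commutation; the factors b (n+1) and b n then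
  rebuild the difference of squares of the majorant.\<close>

lemma norm_B_step: "f \<in> H \<Longrightarrow> norm (B (Suc n) f - B n f) \<le> (b (Suc n) - b n) * norm f"
proof (induction n arbitrary: f)
  case 0 then show ?case using norm_C[of f] by simp
next
  case (Suc n)
  let ?D = "\<lambda>g. B (Suc n) g - B n g"
  have DH: "?D f \<in> H" using B_H[OF Suc.prems] sub by (intro subspace_diff)
  have "B (Suc (Suc n)) f - B (Suc n) f = (1 / 2) *\<^sub>R (B (Suc n) (B (Suc n) f) - B n (B n f))"
    by (simp add: algebra_simps)
  also have "B (Suc n) (B (Suc n) f) - B n (B n f) = B (Suc n) (?D f) + ?D (B n f)"
    using B_diff[OF B_H B_H, OF Suc.prems Suc.prems, of "Suc n" "Suc n" n] by simp
  finally have eq: "B (Suc (Suc n)) f - B (Suc n) f = (1 / 2) *\<^sub>R (B (Suc n) (?D f) + ?D (B n f))" .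
  have "norm (B (Suc n) (?D f)) \<le> b (Suc n) * ((b (Suc n) - b n) * norm f)"
    using norm_B[OF DH, of "Suc n"] Suc.IH[OF Suc.prems] b_bounds[of "Suc n"]
    by (meson mult_left_mono order_trans)
  moreover have "norm (?D (B n f)) \<le> (b (Suc n) - b n) * (b n * norm f)"
    using Suc.IH[OF B_H[OF Suc.prems], of n] norm_B[OF Suc.prems, of n] b_mono[of n]
    by (meson diff_ge_0_iff_ge mult_left_mono order_trans)
  ultimately have "norm (B (Suc n) (?D f) + ?D (B n f)) 
      \<le> b (Suc n) * ((b (Suc n) - b n) * norm f) + (b (Suc n) - b n) * (b n * norm f)"
    by (rule norm_triangle_mono)
  also have "\<dots> = ((b (Suc n))\<^sup>2 - (b n)\<^sup>2) * norm f" by (simp only: power2_eq_square algebra_simps)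
  also have "\<dots> = 2 * ((b (Suc (Suc n)) - b (Suc n)) * norm f)" 
    unfolding b.simps(2)[of "Suc n"] b.simps(2)[of n] by (simp add: field_simps)
  finally show ?case unfolding eq by simp
qed

lemma norm_B_diff:
  assumes "f \<in> H" "n \<le> m" 
  shows "norm (B m f - B n f) \<le> (b m - b n) * norm f"
  using assms(2)
proof (induction m rule: dec_induct)
  case (step m)
  have "norm (B (Suc m) f - B n f) \<le> norm (B (Suc m) f - B m f) + norm (B m f - B n f)"
    using norm_triangle_ineq[of "B (Suc m) f - B m f" "B m f - B n f"] by simp
  also have "\<dots> \<le> (b (Suc m) - b m) * norm f + (b m - b n) * norm f"
    using norm_B_step[OF assms(1)] step.IH by (rule add_mono)
  finally show ?case by (simp add: algebra_simps)
qed simp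

lemma b_Cauchy: "Cauchy b"
proof (rule convergent_Cauchy, rule Bseq_monoseq_convergent)
  show "Bseq b" using b_bounds by (intro BseqI[of 1]) auto
  show "monoseq b" unfolding monoseq_Suc using b_mono by blast
qed

lemma B_convergent: assumes f: "f \<in> H" shows "\<exists>g\<in>H. (\<lambda>n. B n f) \<longlonglongrightarrow> g"
proof -
  have le: "norm (B m f - B n f) \<le> dist (b m) (b n) * norm f" for m n
  proof (cases "n \<le> m")
    case True
    then have "b n \<le> b m" by (rule b_le)
    then show ?thesis using norm_B_diff[OF f True] by (simp add: dist_real_def)
  next
    case False
    then have "b m \<le> b n" by (intro b_le) simp
    then show ?thesis using norm_B_diff[OF f, of m n] False by (simp add: dist_real_def norm_minus_commute)
  qed
  have "Cauchy (\<lambda>n. B n f)"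
  proof (rule metric_CauchyI)
    fix e :: real assume e: "e > 0"
    have "e / (norm f + 1) > 0" using e by (intro divide_pos_pos) (auto intro: add_nonneg_pos)
    then obtain M where M: "\<forall>m\<ge>M. \<forall>n\<ge>M. dist (b m) (b n) < e / (norm f + 1)"
      using b_Cauchy unfolding Cauchy_def by blast
    have "dist (B m f) (B n f) < e" if "m \<ge> M" "n \<ge> M" for m n
    proof -
      have "dist (b m) (b n) * norm f \<le> dist (b m) (b n) * (norm f + 1)" by (intro mult_left_mono) auto
      also have "\<dots> < e" using M that by (simp add: pos_less_divide_eq add_nonneg_pos)
      finally show ?thesis using le[of m n] by (simp add: dist_norm)
    qed
    then show "\<exists>M. \<forall>m\<ge>M. \<forall>n\<ge>M. dist (B m f) (B n f) < e" by blast
  qed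
  then show ?thesis using complete[unfolded complete_def, rule_format, of "\<lambda>n. B n f"] B_H[OF f] by blast
qed

definition L :: "'h \<Rightarrow> 'h" where "L f = lim (\<lambda>n. B n f)"

lemma L_lim: "f \<in> H \<Longrightarrow> (\<lambda>n. B n f) \<longlonglongrightarrow> L f" and L_H: "f \<in> H \<Longrightarrow> L f \<in> H"
proof -
  assume f: "f \<in> H"
  obtain g where g: "g \<in> H" "(\<lambda>n. B n f) \<longlonglongrightarrow> g" using B_convergent[OF f] by blast
  show "(\<lambda>n. B n f) \<longlonglongrightarrow> L f" "L f \<in> H" using g by (simp_all add: L_def limI)
qed

lemma norm_L: "f \<in> H \<Longrightarrow> norm (L f) \<le> norm f"
  by (rule LIMSEQ_le_const2[OF tendsto_norm[OF L_lim]]) (auto intro: norm_B_le)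

lemma L_add: "f \<in> H \<Longrightarrow> g \<in> H \<Longrightarrow> L (f + g) = L f + L g"
  using L_lim[of "f + g"] tendsto_add[OF L_lim[of f] L_lim[of g]] sub
  by (simp add: B_linear subspace_add LIMSEQ_unique)

lemma L_scale: "f \<in> H \<Longrightarrow> L (a *\<^sub>R f) = a *\<^sub>R L f"
  using L_lim[of "a *\<^sub>R f"] tendsto_scaleR[OF tendsto_const L_lim[of f], of a] sub
  by (simp add: B_linear subspace_scale LIMSEQ_unique)

lemma L_sym: "f \<in> H \<Longrightarrow> g \<in> H \<Longrightarrow> L f \<bullet> g = f \<bullet> L g"
  using tendsto_inner[OF L_lim[of f] tendsto_const, of g] tendsto_inner[OF tendsto_const L_lim[of g], of f]
  by (simp add: B_sym LIMSEQ_unique)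

text \<open>The limit is taken in the recursion. All \<open>B n\<close> are contractions, so the
  inner argument B n f may be replaced by its limit.\<close>

lemma L_square: assumes f: "f \<in> H" shows "L (L f) = 2 *\<^sub>R L f - C f"
proof -
  have "(\<lambda>n. B n (B n f) - B n (L f)) \<longlonglongrightarrow> 0"
  proof (rule Lim_null_comparison)
    show "(\<lambda>n. norm (B n f - L f)) \<longlonglongrightarrow> 0"
      using L_lim[OF f] by (simp add: LIM_zero tendsto_norm_zero)
    have "norm (B n (B n f) - B n (L f)) \<le> norm (B n f - L f)" for n
      using norm_B_le[of "B n f - L f" n] B_diff[of "B n f" "L f" n] B_H[OF f] L_H[OF f] sub 
      by (simp add: subspace_diff)
    then show "\<forall>\<^sub>F n in sequentially. norm (B n (B n f) - B n (L f)) \<le> norm (B n f - L f)" by simp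
  qed
  from tendsto_add[OF this L_lim[OF L_H[OF f]]] have "(\<lambda>n. B n (B n f)) \<longlonglongrightarrow> L (L f)" by simp
  then have "(\<lambda>n. B (Suc n) f) \<longlonglongrightarrow> (1 / 2) *\<^sub>R (C f + L (L f))"
    by (simp only: B.simps) (intro tendsto_intros)
  from LIMSEQ_unique[OF this LIMSEQ_Suc[OF L_lim[OF f]]]
  have "(1 / 2) *\<^sub>R (C f + L (L f)) = L f" .
  then have "2 *\<^sub>R ((1 / 2) *\<^sub>R (C f + L (L f))) = 2 *\<^sub>R L f" by (simp only:)
  then have "C f + L (L f) = 2 *\<^sub>R L f" by simp
  then show ?thesis by (simp add: algebra_simps)
qed

text \<open>This is A^(-1/2): its square is \<open>K\<close>, the inverse of A.\<close>

definition R :: "'h \<Rightarrow> 'h" where "R f = (1 / sqrt \<kappa>) *\<^sub>R (f - L f)"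

lemma R_H: "f \<in> H \<Longrightarrow> R f \<in> H" unfolding R_def using L_H sub by (intro subspace_scale subspace_diff)

lemma R_add: "f \<in> H \<Longrightarrow> g \<in> H \<Longrightarrow> R (f + g) = R f + R g" 
  unfolding R_def by (simp add: L_add algebra_simps)
lemma R_scale: "f \<in> H \<Longrightarrow> R (a *\<^sub>R f) = a *\<^sub>R R f" 
  unfolding R_def by (simp add: L_scale algebra_simps)

lemma R_sym: "f \<in> H \<Longrightarrow> g \<in> H \<Longrightarrow> R f \<bullet> g = f \<bullet> R g"
  unfolding R_def using L_sym[of f g] by (simp add: inner_diff_left inner_diff_right)

lemma R_nonneg: assumes f: "f \<in> H" shows "0 \<le> f \<bullet> R f"
proof -
  have "f \<bullet> L f \<le> norm f * norm f" 
    using norm_cauchy_schwarz[of f "L f"] norm_L[OF f] mult_left_mono[OF norm_L[OF f], of "norm f"] by simp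
  then show ?thesis unfolding R_def using kappa by (simp add: inner_diff_right norm_eq_sqrt_inner)
qed

lemma R_square: assumes f: "f \<in> H" shows "R (R f) = K f"
proof -
  have "L (f - L f) = L f - L (L f)"
    using L_add[OF f, of "(-1) *\<^sub>R L f"] L_scale[OF L_H[OF f], of "-1"] L_H[OF f] sub by (simp add: subspace_neg)
  then have "(f - L f) - L (f - L f) = \<kappa> *\<^sub>R K f" 
    unfolding L_square[OF f] C_def by (simp add: algebra_simps scaleR_2)
  then have "R (R f) = (1 / sqrt \<kappa>) *\<^sub>R (1 / sqrt \<kappa>) *\<^sub>R (\<kappa> *\<^sub>R K f)"
    unfolding R_def[of f] using f L_H sub by (subst R_scale) (auto simp: R_def subspace_diff)
  then show ?thesis using kappa by simp
qed

lemma R_inj: assumes "f \<in> H" "g \<in> H" "R f = R g" shows "f = g"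
proof -
  have "K f = K g" using assms R_square by metis
  then show ?thesis using K_A[OF assms(1)] K_A[OF assms(2)] sv by (metis single_valuedD)
qed

section \<open>Density of the range of \<open>K\<close>\<close>

primrec Cpow :: "nat \<Rightarrow> 'h \<Rightarrow> 'h" where
  "Cpow 0 f = f"
| "Cpow (Suc n) f = C (Cpow n f)"

lemma Cpow_H: "f \<in> H \<Longrightarrow> Cpow n f \<in> H" by (induction n) (auto intro: C_H)

lemma Cpow_C: "Cpow n (C f) = C (Cpow n f)" by (induction n) auto

lemma Cpow_add: "Cpow (m + n) f = Cpow m (Cpow n f)" by (induction m) auto

lemma Cpow_sym: "f \<in> H \<Longrightarrow> g \<in> H \<Longrightarrow> Cpow n f \<bullet> g = f \<bullet> Cpow n g"
proof (induction n arbitrary: f g)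
  case (Suc n) then show ?case using C_sym[OF Cpow_H] C_H by (simp add: Cpow_C)
qed simp

lemma norm_Cpow_antimono:
  assumes "f \<in> H" "m \<le> n" shows "norm (Cpow n f) \<le> norm (Cpow m f)"
  using assms(2)
proof (induction n rule: dec_induct)
  case (step n) then show ?case using norm_C[OF Cpow_H[OF assms(1)], of n] by simp
qed simp

text \<open>Telescoping: each further factor C = I - \<kappa> K changes the difference by \<kappa> K
  applied to the previous power. Density thus reduces to letting powers of \<open>C\<close> tend to
  0.\<close>

lemma Cpow_range: assumes f: "f \<in> H" shows "\<exists>g\<in>H. f - Cpow n f = K g"
proof (induction n)
  case 0
  have "K 0 = 0" using K_scale[of 0 0] sub by (simp add: subspace_0)
  then show ?case using sub by (auto simp: subspace_0)
next
  case (Suc n)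
  then obtain g where g: "g \<in> H" "f - Cpow n f = K g" by blast
  have "f - Cpow (Suc n) f = K g + \<kappa> *\<^sub>R K (Cpow n f)" by (simp add: C_def flip: g(2))
  also have "\<dots> = K (g + \<kappa> *\<^sub>R Cpow n f)"
    using g Cpow_H[OF f] sub by (simp add: K_add K_scale subspace_scale)
  finally show ?case using g Cpow_H[OF f] sub by (blast intro: subspace_add subspace_scale)
qed

lemma C_nonneg: assumes f: "f \<in> H" shows "0 \<le> C f \<bullet> f"
proof -
  have "\<kappa> * (K f \<bullet> f) \<le> \<kappa> * norm (K f) * norm f" 
    using norm_cauchy_schwarz[of "K f" f] kappa by (simp add: mult_left_mono mult.assoc)
  also have "\<dots> \<le> norm f * norm f" using norm_K[OF f] by (intro mult_right_mono) auto
  finally show ?thesis unfolding C_def by (simp add: inner_diff_left norm_eq_sqrt_inner)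
qed

text \<open>C maps z = C f - f to - z, and a nonnegative operator admits this only for z = 0. Then K
  f = 0, and single-valuedness of A at 0 gives f = 0.\<close>

lemma C_fixpoint: assumes f: "f \<in> H" "C (C f) = f" shows "f = 0"
proof -
  let ?z = "C f - f"
  have z: "?z \<in> H" using C_H[OF f(1)] f(1) sub by (intro subspace_diff)
  have "C ?z = - ?z" 
    using C_linear(1)[OF C_H[OF f(1)], of "- f"] C_linear(2)[OF f(1), of "-1"] f sub by (simp add: subspace_neg)
  then have "0 \<le> - (?z \<bullet> ?z)" using C_nonneg[OF z] by (simp only: inner_minus_left)
  then have "?z \<bullet> ?z = 0" using inner_ge_zero[of ?z] by linarith
  then have "?z = 0" by (simp only: inner_eq_zero_iff)
  then have "K f = 0" using kappa by (simp add: C_def)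
  moreover have "K 0 = 0" using K_scale[of 0 0] sub by (simp add: subspace_0)
  ultimately show ?thesis using K_A[OF f(1)] K_A[OF subspace_0[OF sub]] sv by (metis single_valuedD)
qed

text \<open>For commuting self-adjoint contractions the squared distance of \<open>C\<^sup>2\<^sup>n f\<close> and \<open>C\<^sup>2\<^sup>m f\<close> is
  a second difference of the decreasing sequence \<open>\<parallel>C\<^sup>j f\<parallel>\<^sup>2\<close>, so the even powers converge, and
  their limit is a fixed point of \<open>C\<^sup>2\<close>.\<close>

lemma Cpow_tendsto_0: assumes f: "f \<in> H" shows "(\<lambda>n. Cpow (2 * n) f) \<longlonglongrightarrow> 0"
proof -
  define q where "q j = (norm (Cpow j f))\<^sup>2" for j
  have cross: "Cpow (2 * n) f \<bullet> Cpow (2 * m) f = q (n + m)" for n m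
  proof -
    have "Cpow (2 * n) f \<bullet> Cpow (2 * m) f = Cpow n (Cpow n f) \<bullet> Cpow m (Cpow m f)"
      by (simp add: mult_2 Cpow_add)
    also have "\<dots> = Cpow m (Cpow n (Cpow n f)) \<bullet> Cpow m f" 
      using Cpow_sym[OF Cpow_H[OF Cpow_H[OF f]] Cpow_H[OF f]] by simp
    also have "Cpow m (Cpow n (Cpow n f)) = Cpow n (Cpow (n + m) f)"
      by (simp add: add_ac flip: Cpow_add)
    also have "\<dots> \<bullet> Cpow m f = Cpow (n + m) f \<bullet> Cpow (n + m) f"
      by (subst Cpow_sym) (simp_all add: Cpow_H f flip: Cpow_add)
    finally show ?thesis by (simp add: q_def power2_norm_eq_inner)
  qed
  have dist: "(dist (Cpow (2 * n) f) (Cpow (2 * m) f))\<^sup>2 = q (n + n) - 2 * q (n + m) + q (m + m)" for n m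
    unfolding dist_norm power2_norm_eq_inner inner_diff_left inner_diff_right cross 
    by (simp only: add.commute[of m n])
  have "decseq q" unfolding decseq_def q_def using norm_Cpow_antimono[OF f] by (simp add: power_mono)
  then obtain l where l: "q \<longlonglongrightarrow> l" "\<And>j. l \<le> q j"
    using decseq_convergent[of q 0] by (auto simp: q_def)
  have "Cauchy (\<lambda>n. Cpow (2 * n) f)"
  proof (rule metric_CauchyI)
    fix e :: real assume e: "e > 0"
    then obtain M where M: "\<And>j. j \<ge> M \<Longrightarrow> q j < l + e\<^sup>2 / 4"
      using order_tendstoD(2)[OF l(1), of "l + e\<^sup>2 / 4"] unfolding eventually_sequentially by auto
    have "dist (Cpow (2 * m) f) (Cpow (2 * n) f) < e" if "m \<ge> M" "n \<ge> M" for m n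
    proof (rule power2_less_imp_less)
      show "(dist (Cpow (2 * m) f) (Cpow (2 * n) f))\<^sup>2 < e\<^sup>2"
        using M[of "m + m"] M[of "n + n"] l(2)[of "m + n"] that e zero_less_power[OF e, of 2] unfolding dist by linarith
    qed (use e in simp)
    then show "\<exists>M. \<forall>m\<ge>M. \<forall>n\<ge>M. dist (Cpow (2 * m) f) (Cpow (2 * n) f) < e" by blast
  qed
  then obtain y where y: "y \<in> H" "(\<lambda>n. Cpow (2 * n) f) \<longlonglongrightarrow> y"
    using complete[unfolded complete_def, rule_format, of "\<lambda>n. Cpow (2 * n) f"] Cpow_H[OF f] by blast
  have "(\<lambda>n. Cpow (2 * Suc n) f - C (C y)) \<longlonglongrightarrow> 0"
  proof (rule Lim_null_comparison)
    show "(\<lambda>n. norm (Cpow (2 * n) f - y)) \<longlonglongrightarrow> 0" using y(2) by (simp add: LIM_zero tendsto_norm_zero)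
    have "norm (Cpow (2 * Suc n) f - C (C y)) \<le> norm (Cpow (2 * n) f - y)" for n
    proof -
      let ?d = "Cpow (2 * n) f - y"
      have d: "?d \<in> H" using Cpow_H[OF f] y(1) sub by (simp add: subspace_diff)
      have C_diff: "C (u - v) = C u - C v" if "u \<in> H" "v \<in> H" for u v
        using C_linear(1)[OF that(1), of "- v"] C_linear(2)[OF that(2), of "-1"] that sub by (simp add: subspace_neg)
      have "Cpow (2 * Suc n) f - C (C y) = C (C ?d)"
        using C_diff C_H Cpow_H[OF f] y(1) by simp
      then show ?thesis using norm_C[OF C_H[OF d]] norm_C[OF d] by simp
    qed
    then show "\<forall>\<^sub>F n in sequentially. norm (Cpow (2 * Suc n) f - C (C y)) \<le> norm (Cpow (2 * n) f - y)" by simp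
  qed
  then have "(\<lambda>n. Cpow (2 * Suc n) f) \<longlonglongrightarrow> C (C y)" by (rule LIM_zero_cancel)
  then have "C (C y) = y" using LIMSEQ_unique LIMSEQ_Suc[OF y(2)] by blast
  then show ?thesis using C_fixpoint[OF y(1)] y(2) by simp
qed

lemma range_K_dense: "H \<subseteq> closure (K ` H)"
proof
  fix f assume f: "f \<in> H"
  have "(\<lambda>n. f - Cpow (2 * n) f) \<longlonglongrightarrow> f - 0" by (intro tendsto_intros Cpow_tendsto_0 f)
  then show "f \<in> closure (K ` H)"
    unfolding closure_sequential using Cpow_range[OF f] by (intro exI[of _ "\<lambda>n. f - Cpow (2 * n) f"]) auto
qed

section \<open>The unbounded root as the inverse of \<open>R\<close>\<close>

definition sqrt_graph :: "('h \<times> 'h) set" where "sqrt_graph = {(R f, f) | f. f \<in> H}"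

lemma sqrt_graph_square: "sqrt_graph O sqrt_graph = A"
proof
  show "sqrt_graph O sqrt_graph \<subseteq> A" using R_square K_A by (fastforce simp: sqrt_graph_def)
  show "A \<subseteq> sqrt_graph O sqrt_graph"
  proof (rule subrelI)
    fix u f assume uf: "(u, f) \<in> A"
    then have f: "f \<in> H" using in_H by auto
    have "u = R (R f)" using K_unique[OF uf] R_square[OF f] by simp
    then show "(u, f) \<in> sqrt_graph O sqrt_graph" using f R_H by (auto simp: sqrt_graph_def)
  qed
qed

text \<open>Because \<open>R\<close> is symmetric and defined on all of \<open>H\<close>, the
  adjoint relation f . v = R f . g for all f forces v = R g. The domain contains the range of K = R
  R and is therefore dense.\<close>

lemma sqrt_graph_self_adjoint: "self_adjoint_on H sqrt_graph"
  unfolding self_adjoint_on_def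
proof (intro conjI)
  show "sqrt_graph \<subseteq> H \<times> H" using R_H by (auto simp: sqrt_graph_def)
  show "single_valued sqrt_graph" using R_inj by (auto simp: single_valued_def sqrt_graph_def)
  have "R 0 = 0" using R_scale[of 0 0] sub by (simp add: subspace_0)
  then show "subspace sqrt_graph" unfolding sqrt_graph_def using R_add R_scale sub
    by (auto simp: subspace_def zero_prod_def)
  have "K ` H \<subseteq> Domain sqrt_graph" using R_square R_H by (force simp: sqrt_graph_def)
  then show "H \<subseteq> closure (Domain sqrt_graph)" using range_K_dense closure_mono by blast
  show "sqrt_graph = adjoint_on H sqrt_graph"
  proof
    show "sqrt_graph \<subseteq> adjoint_on H sqrt_graph" using R_H R_sym by (auto simp: sqrt_graph_def adjoint_on_def)
    show "adjoint_on H sqrt_graph \<subseteq> sqrt_graph"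
    proof (rule subrelI)
      fix v g assume "(v, g) \<in> adjoint_on H sqrt_graph"
      then have vg: "v \<in> H" "g \<in> H" "\<And>f. f \<in> H \<Longrightarrow> f \<bullet> v = R f \<bullet> g"
        by (auto simp: adjoint_on_def sqrt_graph_def)
      have "(v - R g) \<bullet> f = 0" if "f \<in> H" for f
        using vg(3)[OF that] R_sym[OF that vg(2)] by (simp add: inner_diff_left inner_diff_right inner_commute[of _ f])
      then have "v = R g" using orth_H[of "v - R g"] vg R_H sub by (simp add: subspace_diff)
      then show "(v, g) \<in> sqrt_graph" using vg by (auto simp: sqrt_graph_def)
    qed
  qed
qed

lemma sqrt_graph_nonneg: "nonneg_op sqrt_graph"
  using R_nonneg by (auto simp: nonneg_op_def sqrt_graph_def inner_commute)

text \<open>The constructed root is only a witness for the choice; later arguments rest on these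
  three properties of whichever root was chosen.\<close>

lemma op_sqrt_props: "self_adjoint_on H (op_sqrt H A)" "nonneg_op (op_sqrt H A)" "op_sqrt H A O op_sqrt H A = A"
proof -
  have "\<exists>S. self_adjoint_on H S \<and> nonneg_op S \<and> S O S = A"
    using sqrt_graph_self_adjoint sqrt_graph_nonneg sqrt_graph_square by blast
  then have "self_adjoint_on H (op_sqrt H A) \<and> nonneg_op (op_sqrt H A) \<and> op_sqrt H A O op_sqrt H A = A"
    unfolding op_sqrt_def by (rule someI_ex)
  then show "self_adjoint_on H (op_sqrt H A)" "nonneg_op (op_sqrt H A)" "op_sqrt H A O op_sqrt H A = A" by auto
qed

end

section \<open>The Dirichlet Laplacian\<close>

definition flat :: "real poly \<Rightarrow> real \<Rightarrow> real" where
  "flat p t = (if t > 0 then poly p (1 / t) * exp (- (1 / t)) else 0)"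

lemma poly_exp_tendsto_0: "((\<lambda>s. poly p s * exp (- s)) \<longlongrightarrow> (0::real)) at_top"
proof -
  have "((\<lambda>s. \<Sum>i\<le>degree p. coeff p i * (s ^ i / exp s)) \<longlongrightarrow> (\<Sum>i\<le>degree p. coeff p i * 0)) at_top"
    by (intro tendsto_intros tendsto_power_div_exp_0)
  moreover have "poly p s * exp (- s) = (\<Sum>i\<le>degree p. coeff p i * (s ^ i / exp s))" for s :: real
    by (simp add: poly_altdef sum_distrib_right exp_minus divide_inverse mult.assoc)
  ultimately show ?thesis by simp
qed

lemma flat_at_right_0: "(flat p \<longlongrightarrow> 0) (at_right 0)"
proof -
  have "((\<lambda>t. poly p (inverse t) * exp (- inverse t)) \<longlongrightarrow> 0) (at_right 0)"
    by (rule filterlim_compose[OF poly_exp_tendsto_0 filterlim_inverse_at_top_right])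
  moreover have "\<forall>\<^sub>F t in at_right 0. poly p (inverse t) * exp (- inverse t) = flat p t"
    by (auto simp: flat_def eventually_at_right_field inverse_eq_divide intro!: exI[of _ 1])
  ultimately show ?thesis by (rule Lim_transform_eventually)
qed

text \<open>In s = 1 / t differentiation turns p into s^2 (p - p'), so the family is closed under
  derivatives. At 0 the difference quotient from the right is again a member, with polynomial s
  p(s), and members vanish in the limit.\<close>

lemma flat_has_derivative:
  "(flat p has_field_derivative flat ([:0, 0, 1:] * (p - pderiv p)) t) (at t)"
proof -
  consider "t > 0" | "t < 0" | "t = 0" by linarith
  then show ?thesis
  proof cases
    case 1
    have "((\<lambda>t. poly p (1 / t) * exp (- (1 / t))) has_field_derivative flat ([:0, 0, 1:] * (p - pderiv p)) t) (at t)"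
      using 1 by (auto intro!: derivative_eq_intros DERIV_chain2[OF poly_DERIV]
        simp: flat_def field_simps power2_eq_square)
    then show ?thesis
      by (rule has_field_derivative_transform_within_open[of _ _ _ "{0<..}"]) (use 1 in \<open>auto simp: flat_def\<close>)
  next
    case 2
    have "((\<lambda>t. 0) has_field_derivative flat ([:0, 0, 1:] * (p - pderiv p)) t) (at t)"
      using 2 by (simp add: flat_def)
    then show ?thesis
      by (rule has_field_derivative_transform_within_open[of _ _ _ "{..<0}"]) (use 2 in \<open>auto simp: flat_def\<close>)
  next
    case 3
    have "((\<lambda>h. flat p h / h) \<longlongrightarrow> 0) (at 0)"
    proof (rule filterlim_split_at)
      have "\<forall>\<^sub>F h in at_left 0. 0 = flat p h / h"
        by (auto simp: flat_def eventually_at_left_field intro!: exI[of _ "-1"])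
      then show "((\<lambda>h. flat p h / h) \<longlongrightarrow> 0) (at_left 0)"
        by (rule Lim_transform_eventually[OF tendsto_const])
      have "\<forall>\<^sub>F h in at_right 0. flat ([:0, 1:] * p) h = flat p h / h"
        by (auto simp: flat_def eventually_at_right_field intro!: exI[of _ 1])
      then show "((\<lambda>h. flat p h / h) \<longlongrightarrow> 0) (at_right 0)"
        by (rule Lim_transform_eventually[OF flat_at_right_0])
    qed
    then show ?thesis using 3 by (simp add: DERIV_def flat_def)
  qed
qed

text \<open>An algebra of functions that is closed under partial derivatives.\<close>

inductive smooth_alg :: "('a::euclidean_space \<Rightarrow> real) \<Rightarrow> bool" where
  const: "smooth_alg (\<lambda>x. c)"
| flat: "smooth_alg (\<lambda>x. flat p (c * (x \<bullet> i) + d))"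
| add: "smooth_alg f \<Longrightarrow> smooth_alg g \<Longrightarrow> smooth_alg (\<lambda>x. f x + g x)"
| mult: "smooth_alg f \<Longrightarrow> smooth_alg g \<Longrightarrow> smooth_alg (\<lambda>x. f x * g x)"

lemma smooth_alg_gradient:
  "smooth_alg f \<Longrightarrow> \<exists>grad. (\<forall>x. (f has_derivative (\<lambda>h. grad x \<bullet> h)) (at x)) \<and> (\<forall>j. smooth_alg (\<lambda>x. grad x \<bullet> j))"
proof (induction rule: smooth_alg.induct)
  case (const c)
  show ?case using smooth_alg.const[of 0] by (intro exI[of _ "\<lambda>x. 0"]) auto
next
  case (flat p c i d)
  let ?q = "[:0, 0, 1:] * (p - pderiv p)"
  let ?G = "\<lambda>x. (c * flat ?q (c * (x \<bullet> i) + d)) *\<^sub>R i"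
  have "((\<lambda>x. flat p (c * (x \<bullet> i) + d)) has_derivative (\<lambda>h. ?G x \<bullet> h)) (at x)" for x
  proof -
    have "((\<lambda>x. c * (x \<bullet> i) + d) has_derivative (\<lambda>h. c * (h \<bullet> i))) (at x)"
      by (auto intro!: derivative_eq_intros)
    from has_derivative_compose[OF this flat_has_derivative[THEN has_field_derivative_imp_has_derivative], of p]
    show ?thesis by (simp add: inner_commute mult_ac del: mult_pCons_left mult_pCons_right)
  qed
  moreover have "smooth_alg (\<lambda>x. ?G x \<bullet> j)" for j
    using smooth_alg.mult[OF smooth_alg.const[of "c * (i \<bullet> j)"] smooth_alg.flat[of ?q c i d]]
    by (simp add: mult_ac del: mult_pCons_left mult_pCons_right)
  ultimately show ?case by (intro exI[of _ ?G] conjI allI)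
next
  case (add f g)
  obtain F where F: "\<forall>x. (f has_derivative (\<lambda>h. F x \<bullet> h)) (at x)" "\<forall>j. smooth_alg (\<lambda>x. F x \<bullet> j)"
    using add.IH(1) by (elim exE conjE)
  obtain G where G: "\<forall>x. (g has_derivative (\<lambda>h. G x \<bullet> h)) (at x)" "\<forall>j. smooth_alg (\<lambda>x. G x \<bullet> j)"
    using add.IH(2) by (elim exE conjE)
  have "((\<lambda>x. f x + g x) has_derivative (\<lambda>h. (F x + G x) \<bullet> h)) (at x)" for x
    using has_derivative_add[OF F(1)[rule_format] G(1)[rule_format], of x] by (simp add: inner_add_left)
  moreover have "smooth_alg (\<lambda>x. (F x + G x) \<bullet> j)" for j
    unfolding inner_add_left using F G by (intro smooth_alg.add) auto
  ultimately show ?case by (intro exI[of _ "\<lambda>x. F x + G x"] conjI allI)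
next
  case (mult f g)
  obtain F where F: "\<forall>x. (f has_derivative (\<lambda>h. F x \<bullet> h)) (at x)" "\<forall>j. smooth_alg (\<lambda>x. F x \<bullet> j)"
    using mult.IH(1) by (elim exE conjE)
  obtain G where G: "\<forall>x. (g has_derivative (\<lambda>h. G x \<bullet> h)) (at x)" "\<forall>j. smooth_alg (\<lambda>x. G x \<bullet> j)"
    using mult.IH(2) by (elim exE conjE)
  have "((\<lambda>x. f x * g x) has_derivative (\<lambda>h. (f x *\<^sub>R G x + g x *\<^sub>R F x) \<bullet> h)) (at x)" for x
    using has_derivative_mult[OF F(1)[rule_format] G(1)[rule_format], of x]
    by (simp add: inner_add_left mult.commute)
  moreover have "smooth_alg (\<lambda>x. (f x *\<^sub>R G x + g x *\<^sub>R F x) \<bullet> j)" for j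
    unfolding inner_add_left inner_scaleR_left using mult.hyps F G 
    by (intro smooth_alg.add smooth_alg.mult) auto
  ultimately show ?case by (intro exI[of _ "\<lambda>x. f x *\<^sub>R G x + g x *\<^sub>R F x"] conjI allI)
qed

lemma smooth_alg_C_k: "smooth_alg f \<Longrightarrow> C_k k f"
proof (induction k arbitrary: f)
  case 0
  then obtain grad where "\<And>x. (f has_derivative (\<lambda>h. grad x \<bullet> h)) (at x)" using smooth_alg_gradient by blast
  then show ?case by (auto intro!: continuous_at_imp_continuous_on has_derivative_continuous)
next
  case (Suc k)
  then obtain grad where "\<forall>x. (f has_derivative (\<lambda>h. grad x \<bullet> h)) (at x)" "\<forall>j. smooth_alg (\<lambda>x. grad x \<bullet> j)" 
    using smooth_alg_gradient by blast
  then show ?case using Suc.IH by auto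
qed

lemma smooth_alg_prod: 
  "finite I \<Longrightarrow> (\<And>i. i \<in> I \<Longrightarrow> smooth_alg (f i)) \<Longrightarrow> smooth_alg (\<lambda>x. \<Prod>i\<in>I. f i x)"
  by (induction I rule: finite_induct) (auto intro: smooth_alg.intros)

definition bump :: "'a::euclidean_space \<Rightarrow> 'a \<Rightarrow> real \<Rightarrow> 'a \<Rightarrow> real" where
  "bump a b r x = (\<Prod>i\<in>Basis. flat 1 (r * (x \<bullet> i) + - r * (a \<bullet> i)) * flat 1 (- r * (x \<bullet> i) + r * (b \<bullet> i)))"

lemma bump_nonzero: "r > 0 \<Longrightarrow> bump a b r x \<noteq> 0 \<longleftrightarrow> x \<in> box a b"
proof -
  assume r: "r > 0"
  have "flat 1 t = 0 \<longleftrightarrow> t \<le> 0" for t by (simp add: flat_def)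
  then show ?thesis using r by (simp add: bump_def mem_box not_le algebra_simps) (auto simp: algebra_simps)
qed

lemma bump_bounds: "0 \<le> bump a b r x" "bump a b r x \<le> 1"
proof -
  have f: "0 \<le> flat 1 t" "flat 1 t \<le> 1" for t by (auto simp: flat_def)
  show "0 \<le> bump a b r x" unfolding bump_def using f by (intro prod_nonneg) auto
  show "bump a b r x \<le> 1" unfolding bump_def using f by (intro prod_le_1) (auto intro: mult_le_one)
qed

lemma test_fun_bump:
  assumes "cbox a b \<subseteq> \<Omega>" "r > 0" shows "test_fun \<Omega> (bump a b r)"
proof -
  have "{x. bump a b r x \<noteq> 0} = box a b" using bump_nonzero[OF assms(2)] by auto
  moreover have "closure (box a b) \<subseteq> cbox a b" by (intro closure_minimal box_subset_cbox closed_cbox)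
  moreover have "smooth_alg (bump a b r)"
    unfolding bump_def by (intro smooth_alg_prod smooth_alg.intros finite_Basis)
  ultimately show ?thesis using assms smooth_alg_C_k by (auto simp: test_fun_def compact_closure bounded_box)
qed

text \<open>For t > 0 a factor exp (- 1 / (r t)) tends to 1 as r grows, while the set where
  \<open>bump\<close> is nonzero remains the same open box.\<close>

lemma bump_tendsto: "(\<lambda>n. bump a b (real (Suc n)) x) \<longlonglongrightarrow> indicat_real (box a b) x"
proof (cases "x \<in> box a b")
  case True
  have "(\<lambda>n. flat 1 (real (Suc n) * t)) \<longlonglongrightarrow> 1" if "t > 0" for t
  proof -
    have "(\<lambda>n. exp (- (1 / t / real (Suc n)))) \<longlonglongrightarrow> exp (- 0)"
      by (intro tendsto_intros LIMSEQ_Suc[OF lim_const_over_n])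
    then show ?thesis using that by (simp add: flat_def mult.commute)
  qed
  then have "(\<lambda>n. \<Prod>i\<in>Basis. flat 1 (real (Suc n) * (x \<bullet> i - a \<bullet> i)) * flat 1 (real (Suc n) * (b \<bullet> i - x \<bullet> i))) 
    \<longlonglongrightarrow> (\<Prod>i\<in>(Basis :: 'a set). 1 * 1)"
    using True by (intro tendsto_prod tendsto_mult) (auto simp: mem_box)
  then show ?thesis using True by (simp add: bump_def right_diff_distrib del: of_nat_Suc)
next
  case False
  then have "bump a b (real (Suc n)) x = 0" for n using bump_nonzero[of "real (Suc n)" a b x] by simp
  then show ?thesis using False by simp
qed

section \<open>Representatives of classes, and test functions as elements of
  \<open>l2\<close>\<close>

lemma rep_l2_sq_integrable: "sq_integrable (rep_l2 u)"
  using Quotient3_rep_reflp[OF Quotient3_l2, of u] by (simp add: l2_rel_def)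

lemma rep_l2_eqI: "AE x in lborel. rep_l2 u x = rep_l2 v x \<Longrightarrow> u = v"
  using Quotient3_rel_rep[OF Quotient3_l2, of u v] rep_l2_sq_integrable by (auto simp: l2_rel_def)

lemma rep_abs_l2: "sq_integrable f \<Longrightarrow> AE x in lborel. rep_l2 (abs_l2 f) x = f x"
  using rep_abs_rsp_left[OF Quotient3_l2, of f f] by (simp add: l2_rel_def)

lemma abs_rep_l2: "abs_l2 (rep_l2 u) = u"
  using Quotient3_abs_rep[OF Quotient3_l2] .

lemma rep_l2_add: "AE x in lborel. rep_l2 (u + v) x = rep_l2 u x + rep_l2 v x"
proof -
  have "u + v = abs_l2 (\<lambda>x. rep_l2 u x + rep_l2 v x)"
    using plus_l2.abs_eq[of "rep_l2 u" "rep_l2 v"] rep_l2_sq_integrable[of u] rep_l2_sq_integrable[of v] by (simp add: abs_rep_l2 l2_rel_def)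
  then show ?thesis using rep_abs_l2[OF sq_integrable_add[OF rep_l2_sq_integrable rep_l2_sq_integrable]] by simp
qed

lemma rep_l2_scale: "AE x in lborel. rep_l2 (c *\<^sub>R u) x = c * rep_l2 u x"
proof -
  have "c *\<^sub>R u = abs_l2 (\<lambda>x. c * rep_l2 u x)"
    using scaleR_l2.abs_eq[of "rep_l2 u" c] rep_l2_sq_integrable[of u] by (simp add: abs_rep_l2 l2_rel_def)
  then show ?thesis using rep_abs_l2[OF sq_integrable_scale[OF rep_l2_sq_integrable]] by simp
qed

lemma inner_abs_l2: "sq_integrable f \<Longrightarrow> u \<bullet> abs_l2 f = (\<integral>x. rep_l2 u x * f x \<partial>lborel)"
  using inner_l2.abs_eq[of "rep_l2 u" f] rep_l2_sq_integrable[of u] by (simp add: abs_rep_l2 l2_rel_def)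

lemma inner_abs_abs_l2: "sq_integrable f \<Longrightarrow> sq_integrable g \<Longrightarrow> abs_l2 f \<bullet> abs_l2 g = (\<integral>x. f x * g x \<partial>lborel)"
  using inner_l2.abs_eq[of f g] by (simp add: l2_rel_def)

lemma subspace_L2: "subspace (L2 \<Omega>)"
  unfolding subspace_def
proof (intro conjI ballI allI)
  have "AE x in lborel. rep_l2 (0 :: 'a l2) x = 0" using rep_l2_scale[of 0 0] by simp
  then have "AE x in lborel. x \<notin> \<Omega> \<longrightarrow> rep_l2 (0 :: 'a l2) x = 0" by eventually_elim simp
  then show "0 \<in> L2 \<Omega>" unfolding L2_def by simp
next
  fix u v assume "u \<in> L2 \<Omega>" "v \<in> L2 \<Omega>"
  then have "AE x in lborel. x \<notin> \<Omega> \<longrightarrow> rep_l2 u x = 0" "AE x in lborel. x \<notin> \<Omega> \<longrightarrow> rep_l2 v x = 0"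
    by (auto simp: L2_def)
  then have "AE x in lborel. x \<notin> \<Omega> \<longrightarrow> rep_l2 (u + v) x = 0" using rep_l2_add[of u v] by eventually_elim simp
  then show "u + v \<in> L2 \<Omega>" by (simp add: L2_def)
next
  fix c u assume "u \<in> L2 \<Omega>"
  then have "AE x in lborel. x \<notin> \<Omega> \<longrightarrow> rep_l2 u x = 0" by (auto simp: L2_def)
  then have "AE x in lborel. x \<notin> \<Omega> \<longrightarrow> rep_l2 (c *\<^sub>R u) x = 0" using rep_l2_scale[of c u] by eventually_elim simp
  then show "c *\<^sub>R u \<in> L2 \<Omega>" by (simp add: L2_def)
qed

text \<open>Translates the set integrals that define weak derivatives into inner products, which
  pass to limits.\<close>

lemma L2_set_integral:
  assumes u: "u \<in> L2 \<Omega>" and f: "sq_integrable f" and \<Omega>: "open \<Omega>"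
  shows "(LINT x:\<Omega>|lborel. rep_l2 u x * f x) = u \<bullet> abs_l2 f"
proof -
  have m: "rep_l2 u \<in> borel_measurable lborel" "f \<in> borel_measurable lborel"
    using f rep_l2_sq_integrable by (auto simp: sq_integrable_def)
  have [measurable]: "\<Omega> \<in> sets borel" using \<Omega> by simp
  have "(\<integral>x. indicat_real \<Omega> x *\<^sub>R (rep_l2 u x * f x) \<partial>lborel) = (\<integral>x. rep_l2 u x * f x \<partial>lborel)"
  proof (rule integral_cong_AE)
    have "AE x in lborel. x \<notin> \<Omega> \<longrightarrow> rep_l2 u x = 0" using u by (simp add: L2_def)
    then show "AE x in lborel. indicat_real \<Omega> x *\<^sub>R (rep_l2 u x * f x) = rep_l2 u x * f x"
      by eventually_elim (auto simp: indicator_def)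
  qed (use m in measurable)
  then show ?thesis by (simp add: set_lebesgue_integral_def inner_abs_l2[OF f])
qed

lemma sq_integrable_compact_support:
  assumes "continuous_on UNIV f" "compact S" "\<And>x. x \<notin> S \<Longrightarrow> f x = 0"
  shows "sq_integrable f"
  unfolding sq_integrable_def
proof
  show "f \<in> borel_measurable lborel" using borel_measurable_continuous_onI[OF assms(1)] by simp
  have "integrable lborel (\<lambda>x. indicator S x *\<^sub>R (f x)\<^sup>2)"
    using assms by (intro borel_integrable_compact continuous_intros) (auto intro: continuous_on_subset)
  moreover have "(\<lambda>x. indicator S x *\<^sub>R (f x)\<^sup>2) = (\<lambda>x. (f x)\<^sup>2)" using assms(3) by (fastforce simp: indicator_def)
  ultimately show "integrable lborel (\<lambda>x. (f x)\<^sup>2)" by simp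
qed

lemma integrable_compact_support:
  fixes f :: "'a::euclidean_space \<Rightarrow> real"
  assumes "continuous_on UNIV f" "compact S" "\<And>x. x \<notin> S \<Longrightarrow> f x = 0"
  shows "integrable lborel f"
proof -
  have "integrable lborel (\<lambda>x. indicator S x *\<^sub>R f x)"
    using assms by (intro borel_integrable_compact) (auto intro: continuous_on_subset)
  moreover have "(\<lambda>x. indicator S x *\<^sub>R f x) = f" using assms(3) by (fastforce simp: indicator_def)
  ultimately show ?thesis by simp
qed

lemma test_fun_facts:
  assumes "test_fun \<Omega> \<phi>"
  obtains grad S where "compact S" "S \<subseteq> \<Omega>" "\<And>x. x \<notin> S \<Longrightarrow> \<phi> x = 0" 
    "\<And>x. (\<phi> has_derivative (\<lambda>h. grad x \<bullet> h)) (at x)" "continuous_on UNIV \<phi>"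
    "\<And>i. i \<in> Basis \<Longrightarrow> continuous_on UNIV (\<lambda>x. grad x \<bullet> i)" "\<And>x. x \<notin> S \<Longrightarrow> grad x = 0"
    "\<And>i. pderiv_fun i \<phi> = (\<lambda>x. grad x \<bullet> i)"
proof -
  let ?S = "closure {x. \<phi> x \<noteq> 0}"
  have S: "compact ?S" "?S \<subseteq> \<Omega>" using assms by (auto simp: test_fun_def)
  have 0: "\<phi> x = 0" if "x \<notin> ?S" for x using that closure_subset[of "{x. \<phi> x \<noteq> 0}"] by auto
  have "C_k (Suc 0) \<phi>" using assms by (simp only: test_fun_def)
  then obtain grad where grad: "\<And>x. (\<phi> has_derivative (\<lambda>h. grad x \<bullet> h)) (at x)" 
    "\<And>i. i \<in> Basis \<Longrightarrow> continuous_on UNIV (\<lambda>x. grad x \<bullet> i)" by auto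
  have grad0: "grad x = 0" if x: "x \<notin> ?S" for x
  proof -
    have "((\<lambda>x. 0) has_derivative (\<lambda>h. grad x \<bullet> h)) (at x)"
    proof (rule has_derivative_transform_within_open[OF grad(1)])
      show "open (- ?S)" by (intro open_Compl closed_closure)
      show "x \<in> - ?S" using x by simp
      show "\<phi> y = 0" if "y \<in> - ?S" for y by (rule 0[OF ComplD[OF that]])
    qed
    then have "(\<lambda>h. grad x \<bullet> h) = (\<lambda>h. 0)" by (rule has_derivative_unique) simp
    from fun_cong[OF this, of "grad x"] show ?thesis by simp
  qed
  have p: "pderiv_fun i \<phi> = (\<lambda>x. grad x \<bullet> i)" for i
  proof
    show "pderiv_fun i \<phi> x = grad x \<bullet> i" for x
      unfolding pderiv_fun_def by (simp flip: frechet_derivative_at[OF grad(1)])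
  qed
  have c: "continuous_on UNIV \<phi>"
    using grad(1) by (auto intro!: continuous_at_imp_continuous_on has_derivative_continuous)
  show ?thesis by (rule that[of ?S grad, OF S 0 grad(1) c grad(2) grad0 p])
qed

lemma test_fun_sq_integrable:
  assumes "test_fun \<Omega> \<phi>" shows "sq_integrable \<phi>" "i \<in> Basis \<Longrightarrow> sq_integrable (pderiv_fun i \<phi>)"
proof -
  obtain grad S where *: "compact S" "S \<subseteq> \<Omega>" "\<And>x. x \<notin> S \<Longrightarrow> \<phi> x = 0" 
    "\<And>x. (\<phi> has_derivative (\<lambda>h. grad x \<bullet> h)) (at x)" "continuous_on UNIV \<phi>"
    "\<And>i. i \<in> Basis \<Longrightarrow> continuous_on UNIV (\<lambda>x. grad x \<bullet> i)" "\<And>x. x \<notin> S \<Longrightarrow> grad x = 0"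
    "\<And>i. pderiv_fun i \<phi> = (\<lambda>x. grad x \<bullet> i)"
    by (rule test_fun_facts[OF assms], rule that)
  show "sq_integrable \<phi>" by (rule sq_integrable_compact_support[OF *(5,1,3)])
  show "sq_integrable (pderiv_fun i \<phi>)" if "i \<in> Basis"
    unfolding *(8) by (rule sq_integrable_compact_support[OF *(6)[OF that] *(1)]) (simp add: *(7))
qed

text \<open>The fundamental lemma of the calculus of variations: bumps converge to indicators of
  boxes, boxes generate the Borel sets, and countably many boxes cover \<Omega>.\<close>

lemma L2_orthogonal_test_fun:
  assumes \<Omega>: "open \<Omega>" and u: "u \<in> L2 \<Omega>" and orth: "\<And>\<phi>. test_fun \<Omega> \<phi> \<Longrightarrow> u \<bullet> abs_l2 \<phi> = 0"
  shows "u = 0"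
proof -
  define g where "g = rep_l2 u"
  have gsq: "sq_integrable g" unfolding g_def by (rule rep_l2_sq_integrable)
  have gm[measurable]: "g \<in> borel_measurable borel" using gsq by (simp add: sq_integrable_def)
  have ind: "sq_integrable (indicat_real (cbox a b))" for a b :: 'a
  proof -
    have "(indicat_real (cbox a b) x)\<^sup>2 = indicat_real (cbox a b) x" for x by (simp add: indicator_def)
    moreover have "integrable lborel (indicat_real (cbox a b))"
      by (intro integrable_real_indicator emeasure_lborel_cbox_finite) simp
    ultimately show ?thesis by (simp add: sq_integrable_def)
  qed
  \<comment> \<open>Dominated convergence along steeper bumps; the majorant is integrable because g
    is square integrable and the closed box has finite measure.\<close>
  have box0: "(\<integral>x. indicat_real (box a b) x * g x \<partial>lborel) = 0" if ab: "cbox a b \<subseteq> \<Omega>" for a b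
  proof -
    have "(\<lambda>n. \<integral>x. bump a b (real (Suc n)) x * g x \<partial>lborel) \<longlonglongrightarrow> (\<integral>x. indicat_real (box a b) x * g x \<partial>lborel)"
    proof (rule integral_dominated_convergence)
      show "integrable lborel (\<lambda>x. \<bar>indicat_real (cbox a b) x * g x\<bar>)"
        using sq_integrable_mult[OF ind gsq] by (rule integrable_abs)
      show "(\<lambda>x. bump a b (real (Suc n)) x * g x) \<in> borel_measurable lborel" for n
      proof -
        have "bump a b (real (Suc n)) \<in> borel_measurable lborel"
          using test_fun_sq_integrable(1)[OF test_fun_bump[OF ab, of "real (Suc n)"]] unfolding sq_integrable_def by simp
        then show ?thesis by (intro borel_measurable_times) simp_all
      qed
      show "AE x in lborel. (\<lambda>n. bump a b (real (Suc n)) x * g x) \<longlonglongrightarrow> indicat_real (box a b) x * g x"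
        by (intro AE_I2 tendsto_mult bump_tendsto tendsto_const)
      show "AE x in lborel. norm (bump a b (real (Suc n)) x * g x) \<le> \<bar>indicat_real (cbox a b) x * g x\<bar>" for n
      proof (rule AE_I2)
        fix x
        show "norm (bump a b (real (Suc n)) x * g x) \<le> \<bar>indicat_real (cbox a b) x * g x\<bar>"
        proof (cases "x \<in> box a b")
          case True
          then have "x \<in> cbox a b" using box_subset_cbox by blast
          then show ?thesis using bump_bounds[of a b "real (Suc n)" x] 
            by (simp add: abs_mult mult_left_le_one_le del: of_nat_Suc)
        next
          case False
          then show ?thesis using bump_nonzero[of "real (Suc n)" a b x] by simp
        qed
      qed
    qed simp_all
    moreover have "(\<integral>x. bump a b (real (Suc n)) x * g x \<partial>lborel) = 0" for n
    proof -
      have t: "test_fun \<Omega> (bump a b (real (Suc n)))" by (intro test_fun_bump[OF ab]) simp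
      show ?thesis using orth[OF t] inner_abs_l2[OF test_fun_sq_integrable(1)[OF t], of u]
        by (simp add: g_def mult.commute)
    qed
    ultimately show ?thesis by (simp add: LIMSEQ_const_iff)
  qed
  have AE_box: "AE x in lborel. x \<in> box a b \<longrightarrow> g x = 0" if ab: "cbox a b \<subseteq> \<Omega>" for a b
  proof -
    let ?f = "\<lambda>x. indicat_real (box a b) x * g x"
    have "integrable lborel (\<lambda>x. indicat_real (box a b) x *\<^sub>R (indicat_real (cbox a b) x * g x))"
      using sq_integrable_mult[OF ind gsq] by (intro integrable_mult_indicator) auto
    moreover have "indicat_real (box a b) x *\<^sub>R (indicat_real (cbox a b) x * g x) = ?f x" for x
      using box_subset_cbox[of a b] by (auto simp: indicator_def)
    ultimately have f: "integrable lborel ?f" by (simp only:)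
    \<comment> \<open>It suffices that the integral over every Borel set vanishes. This spreads from
      the intersection-stable family of boxes to all Borel sets; in the complement case the total
      integral is 0 by \<open>box0\<close>.\<close>
    have "AE x in lborel. ?f x = 0"
    proof (rule sigma_finite_measure.density_zero[OF sigma_finite_lborel f])
      let ?G = "range (\<lambda>(c, d). box c d :: 'a set)"
      fix A :: "'a set" assume "A \<in> sets lborel"
      then have A: "A \<in> sigma_sets UNIV ?G" by (simp add: borel_eq_box)
      have G: "Int_stable ?G" "?G \<subseteq> Pow UNIV" by (auto simp: Int_stable_def box_Int_box)
      from G A show "set_lebesgue_integral lborel A ?f = 0"
      proof (induction rule: sigma_sets_induct_disjoint)
        case (basic A)
        then obtain c d where A: "A = box c d" by auto
        let ?e = "\<Sum>i\<in>Basis. max (a \<bullet> i) (c \<bullet> i) *\<^sub>R i" and ?h = "\<Sum>i\<in>Basis. min (b \<bullet> i) (d \<bullet> i) *\<^sub>R i"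
        have eq: "box a b \<inter> box c d = box ?e ?h" by (rule box_Int_box)
        have "cbox ?e ?h \<subseteq> cbox a b" by (auto simp: mem_box)
        then have "(\<integral>x. indicat_real (box ?e ?h) x * g x \<partial>lborel) = 0" using ab by (intro box0) auto
        then show ?case unfolding A set_lebesgue_integral_def eq[symmetric]
          by (simp add: indicator_inter_arith mult_ac)
      next
        case empty
        show ?case by (simp add: set_lebesgue_integral_def)
      next
        case (compl A)
        then have A: "A \<in> sets lborel" by (simp add: borel_eq_box)
        have "set_lebesgue_integral lborel (- A) ?f = integral\<^sup>L lborel ?f - set_lebesgue_integral lborel A ?f"
        proof -
          have "integrable lborel (\<lambda>x. indicat_real A x *\<^sub>R ?f x)" using A f by (rule integrable_mult_indicator)
          from Bochner_Integration.integral_diff[OF f this]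
          have "integral\<^sup>L lborel ?f - set_lebesgue_integral lborel A ?f = (\<integral>x. ?f x - indicat_real A x *\<^sub>R ?f x \<partial>lborel)"
            by (simp only: set_lebesgue_integral_def)
          also have "\<dots> = set_lebesgue_integral lborel (- A) ?f"
            unfolding set_lebesgue_integral_def by (rule Bochner_Integration.integral_cong) (auto simp: indicator_def)
          finally show ?thesis by (rule sym)
        qed
        then show ?case using compl box0[OF ab] by (simp add: Compl_eq_Diff_UNIV)
      next
        case (union A)
        have "(LINT x:(\<Union>i. A i)|lborel. ?f x) = (\<Sum>i. LINT x:A i|lborel. ?f x)"
        proof (rule lebesgue_integral_countable_add)
          show "A i \<in> sets lborel" for i using union(2) by (auto simp: borel_eq_box)
          then show "set_integrable lborel (\<Union>i. A i) ?f"
            unfolding set_integrable_def by (intro integrable_mult_indicator f) auto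
          show "A i \<inter> A j = {}" if "i \<noteq> j" for i j using union(1) that by (auto simp: disjoint_family_on_def)
        qed
        then show ?case using union(3) by simp
      qed
    qed
    then show ?thesis by eventually_elim (auto simp: indicator_def)
  qed
  \<comment> \<open>A countable subcover turns the statements on single boxes into one almost
    everywhere statement on \<Omega>.\<close>
  let ?F = "{box a b | a b. cbox a b \<subseteq> \<Omega>}"
  obtain D where D: "D \<subseteq> ?F" "countable D" "\<Union>D = \<Union>?F"
    using Lindelof[of ?F] by (auto simp: open_box)
  have cover: "\<Omega> \<subseteq> \<Union>?F"
  proof
    fix x assume "x \<in> \<Omega>"
    then obtain e where e: "e > 0" "cball x e \<subseteq> \<Omega>" using \<Omega> open_contains_cball by blast
    obtain a b where ab: "x \<in> box a b" "box a b \<subseteq> ball x e" using rational_boxes[OF e(1)] by metis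
    have "cbox a b = closure (box a b)" using ab(1) by (intro closure_box[symmetric]) auto
    also have "\<dots> \<subseteq> cball x e" using ab(2) ball_subset_cball by (intro closure_minimal) auto
    finally have "cbox a b \<subseteq> \<Omega>" using e(2) by blast
    then show "x \<in> \<Union>?F" using ab(1) by blast
  qed
  have "AE x in lborel. \<forall>X\<in>D. x \<in> X \<longrightarrow> g x = 0"
    using D(1) AE_box by (subst AE_ball_countable[OF D(2)]) auto
  moreover have "AE x in lborel. x \<notin> \<Omega> \<longrightarrow> g x = 0" using u by (simp add: L2_def g_def)
  ultimately have "AE x in lborel. g x = 0"
  proof eventually_elim
    case (elim x)
    show ?case
    proof (cases "x \<in> \<Omega>")
      case True
      then have "x \<in> \<Union>D" unfolding D(3) using cover by (rule subsetD[rotated])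
      then obtain X where "X \<in> D" "x \<in> X" by (rule UnionE)
      then show ?thesis by (rule bspec[OF elim(1), THEN mp])
    next
      case False
      then show ?thesis using elim(2) by simp
    qed
  qed
  moreover have "AE x in lborel. rep_l2 (0 :: 'a l2) x = 0" using rep_l2_scale[of 0 0] by simp
  ultimately have "AE x in lborel. g x = rep_l2 0 x" by eventually_elim simp
  then show ?thesis unfolding g_def by (rule rep_l2_eqI)
qed


section \<open>Weak derivatives and Green's formula\<close>

lemma has_weak_pderiv_iff:
  assumes "open \<Omega>" "i \<in> Basis"
  shows "has_weak_pderiv \<Omega> i u g \<longleftrightarrow> u \<in> L2 \<Omega> \<and> g \<in> L2 \<Omega> \<and>
    (\<forall>\<phi>. test_fun \<Omega> \<phi> \<longrightarrow> u \<bullet> abs_l2 (pderiv_fun i \<phi>) = - (g \<bullet> abs_l2 \<phi>))"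
  using L2_set_integral[OF _ test_fun_sq_integrable(1) assms(1)]
    L2_set_integral[OF _ test_fun_sq_integrable(2)[OF _ assms(2)] assms(1)]
  by (auto simp: has_weak_pderiv_def)

text \<open>Two candidates differ by an element of \<open>L2\<close> orthogonal to all test
  functions; this uniqueness makes the description in \<open>weak_pderiv\<close> denote.\<close>

lemma weak_pderiv_eqI:
  assumes "open \<Omega>" "i \<in> Basis" "has_weak_pderiv \<Omega> i u g"
  shows "weak_pderiv \<Omega> i u = g"
  unfolding weak_pderiv_def
proof (rule the_equality)
  show "has_weak_pderiv \<Omega> i u g" by (rule assms(3))
  fix g' assume "has_weak_pderiv \<Omega> i u g'"
  then have orth: "(g' - g) \<bullet> abs_l2 \<phi> = 0" if "test_fun \<Omega> \<phi>" for \<phi>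
    using assms(3) that by (auto simp: has_weak_pderiv_iff[OF assms(1,2)] inner_diff_left)
  have "g' - g \<in> L2 \<Omega>"
    using \<open>has_weak_pderiv \<Omega> i u g'\<close> assms(3) by (auto simp: has_weak_pderiv_def intro: subspace_diff[OF subspace_L2])
  from L2_orthogonal_test_fun[OF assms(1) this orth] show "g' = g" by simp
qed

lemma H1_weak_pderiv:
  assumes "open \<Omega>" "u \<in> H1 \<Omega>" "i \<in> Basis"
  shows "has_weak_pderiv \<Omega> i u (weak_pderiv \<Omega> i u)"
proof -
  obtain g where "has_weak_pderiv \<Omega> i u g" using assms by (auto simp: H1_def)
  then show ?thesis using weak_pderiv_eqI[OF assms(1,3)] by simp
qed

lemma weak_pderiv_L2: "open \<Omega> \<Longrightarrow> u \<in> H1 \<Omega> \<Longrightarrow> i \<in> Basis \<Longrightarrow> weak_pderiv \<Omega> i u \<in> L2 \<Omega>"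
  using H1_weak_pderiv by (auto simp: has_weak_pderiv_def)

text \<open>With a test function in place of \<open>u\<close> this is the definition of the weak
  derivative of \<open>w\<close>. The approximating sequence that comes with \<open>H10\<close>
  carries it over, so no boundary traces occur.\<close>

lemma H10_integration_by_parts:
  assumes "open \<Omega>" "u \<in> H10 \<Omega>" "w \<in> H1 \<Omega>" "i \<in> Basis"
  shows "w \<bullet> weak_pderiv \<Omega> i u = - (weak_pderiv \<Omega> i w \<bullet> u)"
proof -
  obtain \<phi> where \<phi>: "\<And>k. test_fun \<Omega> (\<phi> k)" "(\<lambda>k. abs_l2 (\<phi> k)) \<longlonglongrightarrow> u"
    "(\<lambda>k. abs_l2 (pderiv_fun i (\<phi> k))) \<longlonglongrightarrow> weak_pderiv \<Omega> i u"
    using assms(2,4) by (auto simp: H10_def)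
  have "w \<bullet> abs_l2 (pderiv_fun i (\<phi> k)) = - (weak_pderiv \<Omega> i w \<bullet> abs_l2 (\<phi> k))" for k
    using H1_weak_pderiv[OF assms(1,3,4)] \<phi>(1) by (simp add: has_weak_pderiv_iff[OF assms(1,4)])
  moreover have "(\<lambda>k. w \<bullet> abs_l2 (pderiv_fun i (\<phi> k))) \<longlonglongrightarrow> w \<bullet> weak_pderiv \<Omega> i u"
    "(\<lambda>k. - (weak_pderiv \<Omega> i w \<bullet> abs_l2 (\<phi> k))) \<longlonglongrightarrow> - (weak_pderiv \<Omega> i w \<bullet> u)"
    by (intro tendsto_intros \<phi>)+
  ultimately show ?thesis using LIMSEQ_unique by simp
qed

text \<open>Green's formula; it yields symmetry when both arguments lie in the domain, and
  coercivity for v = u.\<close>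

lemma dirichlet_laplacian_form:
  assumes "open \<Omega>" "(u, f) \<in> dirichlet_laplacian \<Omega>" "v \<in> H10 \<Omega>"
  shows "f \<bullet> v = (\<Sum>i\<in>Basis. weak_pderiv \<Omega> i u \<bullet> weak_pderiv \<Omega> i v)"
proof -
  have u: "u \<in> H2 \<Omega>" and f: "f = - (\<Sum>i\<in>Basis. weak_pderiv \<Omega> i (weak_pderiv \<Omega> i u))"
    using assms(2) by (auto simp: dirichlet_laplacian_def)
  have "weak_pderiv \<Omega> i (weak_pderiv \<Omega> i u) \<bullet> v = - (weak_pderiv \<Omega> i u \<bullet> weak_pderiv \<Omega> i v)" if "i \<in> Basis" for i
    using H10_integration_by_parts[OF assms(1,3) _ that] u that by (simp add: H2_def)
  then show ?thesis unfolding f by (simp add: inner_sum_left sum_negf)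
qed

lemma dirichlet_laplacian_symmetric:
  assumes "open \<Omega>" "(u, f) \<in> dirichlet_laplacian \<Omega>" "(v, g) \<in> dirichlet_laplacian \<Omega>"
  shows "f \<bullet> v = u \<bullet> g"
proof -
  have uv: "u \<in> H10 \<Omega>" "v \<in> H10 \<Omega>" using assms(2,3) by (auto simp: dirichlet_laplacian_def)
  have "f \<bullet> v = (\<Sum>i\<in>Basis. weak_pderiv \<Omega> i u \<bullet> weak_pderiv \<Omega> i v)"
    by (rule dirichlet_laplacian_form[OF assms(1,2) uv(2)])
  also have "\<dots> = (\<Sum>i\<in>Basis. weak_pderiv \<Omega> i v \<bullet> weak_pderiv \<Omega> i u)"
    by (intro sum.cong refl inner_commute)
  also have "\<dots> = g \<bullet> u" by (rule dirichlet_laplacian_form[OF assms(1,3) uv(1), symmetric])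
  finally show ?thesis by (simp add: inner_commute)
qed

lemma dirichlet_laplacian_subset:
  assumes "open \<Omega>" shows "dirichlet_laplacian \<Omega> \<subseteq> L2 \<Omega> \<times> L2 \<Omega>"
proof (rule subrelI)
  fix u f assume "(u, f) \<in> dirichlet_laplacian \<Omega>"
  then have u: "u \<in> H2 \<Omega>" and f: "f = - (\<Sum>i\<in>Basis. weak_pderiv \<Omega> i (weak_pderiv \<Omega> i u))"
    by (auto simp: dirichlet_laplacian_def)
  have "f \<in> L2 \<Omega>" unfolding f using u
    by (intro subspace_neg[OF subspace_L2] subspace_sum[OF subspace_L2] weak_pderiv_L2[OF assms]) (auto simp: H2_def)
  moreover have "u \<in> L2 \<Omega>" using u by (auto simp: H2_def H1_def)
  ultimately show "(u, f) \<in> L2 \<Omega> \<times> L2 \<Omega>" by simp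
qed

lemma single_valued_dirichlet_laplacian: "single_valued (dirichlet_laplacian \<Omega>)"
  by (auto simp: single_valued_def dirichlet_laplacian_def)

section \<open>The Poincare inequality\<close>

lemma integral_translate:
  fixes f :: "'a::euclidean_space \<Rightarrow> real"
  assumes "integrable lborel f"
  shows "integrable lborel (\<lambda>x. f (c + x))" "(\<integral>x. f (c + x) \<partial>lborel) = integral\<^sup>L lborel f"
proof -
  have [measurable]: "f \<in> borel_measurable borel" using assms by auto
  have "integrable (distr lborel borel ((+) c)) f" using assms by (simp add: lborel_distr_plus)
  then show "integrable lborel (\<lambda>x. f (c + x))" by (subst (asm) integrable_distr_eq) auto
  have "integral\<^sup>L (distr lborel borel ((+) c)) f = (\<integral>x. f (c + x) \<partial>lborel)"
    by (rule integral_distr) auto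
  then show "(\<integral>x. f (c + x) \<partial>lborel) = integral\<^sup>L lborel f" by (simp add: lborel_distr_plus)
qed

text \<open>Difference quotients have integral 0 by translation invariance, and dominated
  convergence passes this to the derivative.\<close>

lemma integral_directional_derivative_eq_0:
  fixes \<eta> :: "'a::euclidean_space \<Rightarrow> real"
  assumes der: "\<And>x. (\<eta> has_derivative (\<lambda>h. G x \<bullet> h)) (at x)"
    and cont: "continuous_on UNIV (\<lambda>x. G x \<bullet> i)"
    and S: "compact S" "\<And>x. x \<notin> S \<Longrightarrow> \<eta> x = 0" "\<And>x. x \<notin> S \<Longrightarrow> G x = 0"
    and i: "norm i = 1"
  shows "(\<integral>x. G x \<bullet> i \<partial>lborel) = 0"
proof -
  have c\<eta>: "continuous_on UNIV \<eta>" using der by (auto intro!: continuous_at_imp_continuous_on has_derivative_continuous)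
  have int: "integrable lborel \<eta>" by (rule integrable_compact_support[OF c\<eta> S(1,2)])
  have der1: "((\<lambda>s. \<eta> (x + s *\<^sub>R i)) has_field_derivative G (x + s *\<^sub>R i) \<bullet> i) (at s)" for x s
  proof -
    have "((\<lambda>s. x + s *\<^sub>R i) has_derivative (\<lambda>h. h *\<^sub>R i)) (at s)" by (auto intro!: derivative_eq_intros)
    moreover have "(\<lambda>h. G (x + s *\<^sub>R i) \<bullet> (h *\<^sub>R i)) = (*) (G (x + s *\<^sub>R i) \<bullet> i)" by (simp add: fun_eq_iff)
    ultimately show ?thesis
      using has_derivative_compose[OF _ der, of "\<lambda>s. x + s *\<^sub>R i"] unfolding has_field_derivative_def by metis
  qed
  obtain R where R: "\<And>x. x \<in> S \<Longrightarrow> norm x \<le> R" using compact_imp_bounded[OF S(1)] by (auto simp: bounded_iff)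
  have "compact ((\<lambda>x. G x \<bullet> i) ` S)" 
    by (intro compact_continuous_image S continuous_on_subset[OF cont]) simp
  then obtain B where B: "\<And>x. x \<in> S \<Longrightarrow> \<bar>G x \<bullet> i\<bar> \<le> B"
    using compact_imp_bounded by (force simp: bounded_iff)
  have GB: "\<bar>G x \<bullet> i\<bar> \<le> max B 0" for x using B[of x] S(3)[of x] by (cases "x \<in> S") auto
  define D where "D n x = (\<eta> (x + (1 / real (Suc n)) *\<^sub>R i) - \<eta> x) / (1 / real (Suc n))" for n x
  have "(\<lambda>n. \<integral>x. D n x \<partial>lborel) \<longlonglongrightarrow> (\<integral>x. G x \<bullet> i \<partial>lborel)"
  proof (rule integral_dominated_convergence)
    \<comment> \<open>The mean value theorem bounds the quotients by the bound of the derivative.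
      Steps have length at most 1, so outside the ball of radius R + 1 both points miss the
      support.\<close>
    let ?w = "\<lambda>x. max B 0 * indicat_real (cball 0 (R + 1)) x"
    show "integrable lborel ?w"
      by (intro integrable_mult_right integrable_real_indicator emeasure_bounded_finite bounded_cball) simp
    show "(\<lambda>x. G x \<bullet> i) \<in> borel_measurable lborel"
      using borel_measurable_continuous_onI[OF cont] by simp
    have "continuous_on UNIV (D n)" for n
      unfolding D_def by (intro continuous_intros continuous_on_compose2[OF c\<eta>]) auto
    then show "D n \<in> borel_measurable lborel" for n
      using borel_measurable_continuous_onI[of "D n"] by simp
    show "AE x in lborel. (\<lambda>n. D n x) \<longlonglongrightarrow> G x \<bullet> i"
    proof (rule AE_I2)
      fix x
      have "((\<lambda>h. (\<eta> (x + h *\<^sub>R i) - \<eta> x) / h) \<longlongrightarrow> G x \<bullet> i) (at 0)"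
        using der1[of x 0] by (simp add: DERIV_def)
      moreover have "filterlim (\<lambda>n. 1 / real (Suc n)) (at 0) sequentially"
        unfolding filterlim_at using LIMSEQ_Suc[OF lim_const_over_n[of 1]] by (simp add: eventually_sequentially del: of_nat_Suc)
      ultimately show "(\<lambda>n. D n x) \<longlonglongrightarrow> G x \<bullet> i" unfolding D_def by (rule filterlim_compose)
    qed
    show "AE x in lborel. norm (D n x) \<le> ?w x" for n
    proof (rule AE_I2)
      fix x
      let ?s = "1 / real (Suc n)"
      have s: "0 < ?s" "?s \<le> 1" by auto
      obtain z where z: "\<eta> (x + ?s *\<^sub>R i) - \<eta> (x + 0 *\<^sub>R i) = (?s - 0) * (G (x + z *\<^sub>R i) \<bullet> i)"
        using MVT2[OF s(1), of "\<lambda>s. \<eta> (x + s *\<^sub>R i)" "\<lambda>s. G (x + s *\<^sub>R i) \<bullet> i"] der1 by blast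
      then have "D n x = G (x + z *\<^sub>R i) \<bullet> i" using s by (simp add: D_def)
      then have le: "\<bar>D n x\<bar> \<le> max B 0" using GB by simp
      show "norm (D n x) \<le> ?w x"
      proof (cases "norm x \<le> R + 1")
        case True
        then show ?thesis using le by simp
      next
        case False
        have "norm x \<le> norm (x + ?s *\<^sub>R i) + ?s"
          using norm_triangle_ineq4[of "x + ?s *\<^sub>R i" "?s *\<^sub>R i"] i s(1) by simp
        then have "x \<notin> S" "x + ?s *\<^sub>R i \<notin> S" using False R[of x] R[of "x + ?s *\<^sub>R i"] s by linarith+
        then show ?thesis using S(2) by (simp add: D_def)
      qed
    qed
  qed
  moreover have "(\<integral>x. D n x \<partial>lborel) = 0" for n
    using integral_translate[OF int, of "(1 / real (Suc n)) *\<^sub>R i"] int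
    by (simp add: D_def add.commute del: of_nat_Suc)
  ultimately show ?thesis by (simp add: LIMSEQ_const_iff)
qed

text \<open>The i-th derivative of x_i \<phi>^2 is \<phi>^2 + 2 x_i \<phi> d_i \<phi> and integrates
  to 0. Since |x_i| \<le> r on \<Omega>, Cauchy-Schwarz gives the factor 2 r.\<close>

lemma test_fun_Poincare:
  assumes \<phi>: "test_fun \<Omega> \<phi>" and \<Omega>: "\<Omega> \<subseteq> cball 0 r" and i: "i \<in> Basis" and r: "r \<ge> 0"
  shows "norm (abs_l2 \<phi>) \<le> 2 * r * norm (abs_l2 (pderiv_fun i \<phi>))"
proof -
  obtain grad S where *: "compact S" "S \<subseteq> \<Omega>" "\<And>x. x \<notin> S \<Longrightarrow> \<phi> x = 0" 
    "\<And>x. (\<phi> has_derivative (\<lambda>h. grad x \<bullet> h)) (at x)" "continuous_on UNIV \<phi>"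
    "\<And>i. i \<in> Basis \<Longrightarrow> continuous_on UNIV (\<lambda>x. grad x \<bullet> i)" "\<And>x. x \<notin> S \<Longrightarrow> grad x = 0"
    "\<And>i. pderiv_fun i \<phi> = (\<lambda>x. grad x \<bullet> i)"
    by (rule test_fun_facts[OF \<phi>], rule that)
  let ?\<psi> = "\<lambda>x. (x \<bullet> i) * \<phi> x"
  let ?G = "\<lambda>x. (\<phi> x)\<^sup>2 *\<^sub>R i + (2 * (x \<bullet> i) * \<phi> x) *\<^sub>R grad x"
  have sq: "sq_integrable \<phi>" "sq_integrable (pderiv_fun i \<phi>)" using test_fun_sq_integrable[OF \<phi>] i by auto
  have "sq_integrable ?\<psi>"
    by (rule sq_integrable_compact_support[OF _ *(1)]) (auto intro!: continuous_intros *(5) simp: *(3))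
  have "(\<integral>x. ?G x \<bullet> i \<partial>lborel) = 0"
  proof (rule integral_directional_derivative_eq_0[of "\<lambda>x. (x \<bullet> i) * (\<phi> x)\<^sup>2", OF _ _ *(1)])
    show "((\<lambda>x. (x \<bullet> i) * (\<phi> x)\<^sup>2) has_derivative (\<lambda>h. ?G x \<bullet> h)) (at x)" for x
      by (rule derivative_eq_intros *(4) refl | simp add: fun_eq_iff inner_add_left inner_commute algebra_simps)+
    show "continuous_on UNIV (\<lambda>x. ?G x \<bullet> i)"
      unfolding inner_add_left inner_scaleR_left by (intro continuous_intros *(5) *(6)[OF i])
  qed (use i *(3,7) in auto)
  moreover have "?G x \<bullet> i = \<phi> x * \<phi> x + 2 * (?\<psi> x * pderiv_fun i \<phi> x)" for x
    using i by (simp add: *(8) inner_add_left power2_eq_square)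
  ultimately have "(\<integral>x. \<phi> x * \<phi> x + 2 * (?\<psi> x * pderiv_fun i \<phi> x) \<partial>lborel) = 0" by simp
  then have "abs_l2 \<phi> \<bullet> abs_l2 \<phi> = - 2 * (abs_l2 ?\<psi> \<bullet> abs_l2 (pderiv_fun i \<phi>))"
    using sq_integrable_mult[OF sq(1) sq(1)] sq_integrable_mult[OF \<open>sq_integrable ?\<psi>\<close> sq(2)]
    by (simp add: inner_abs_abs_l2 sq \<open>sq_integrable ?\<psi>\<close>)
  also have "\<dots> \<le> 2 * (norm (abs_l2 ?\<psi>) * norm (abs_l2 (pderiv_fun i \<phi>)))"
    using Cauchy_Schwarz_ineq2[of "abs_l2 ?\<psi>" "abs_l2 (pderiv_fun i \<phi>)"] by linarith
  also have "norm (abs_l2 ?\<psi>) \<le> r * norm (abs_l2 \<phi>)"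
  proof -
    have "abs_l2 ?\<psi> \<bullet> abs_l2 ?\<psi> \<le> r\<^sup>2 * (abs_l2 \<phi> \<bullet> abs_l2 \<phi>)"
    proof -
      have "(\<integral>x. ?\<psi> x * ?\<psi> x \<partial>lborel) \<le> (\<integral>x. r\<^sup>2 * (\<phi> x * \<phi> x) \<partial>lborel)"
      proof (rule integral_mono)
        show "integrable lborel (\<lambda>x. ?\<psi> x * ?\<psi> x)" "integrable lborel (\<lambda>x. r\<^sup>2 * (\<phi> x * \<phi> x))"
          using sq_integrable_mult[OF sq(1) sq(1)] sq_integrable_mult[OF \<open>sq_integrable ?\<psi>\<close> \<open>sq_integrable ?\<psi>\<close>] by auto
        fix x
        show "?\<psi> x * ?\<psi> x \<le> r\<^sup>2 * (\<phi> x * \<phi> x)"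
        proof (cases "x \<in> S")
          case True
          then have "norm x \<le> r" using *(2) \<Omega> by auto
          then have "\<bar>x \<bullet> i\<bar> \<le> r" using Basis_le_norm[OF i, of x] by linarith
          then have "(x \<bullet> i)\<^sup>2 \<le> r\<^sup>2" using r by (simp add: abs_le_square_iff flip: abs_le_square_iff[of "x \<bullet> i" r])
          then show ?thesis using mult_right_mono[of "(x \<bullet> i)\<^sup>2" "r\<^sup>2" "\<phi> x * \<phi> x"] by (simp add: power2_eq_square mult_ac)
        qed (simp add: *(3))
      qed
      then show ?thesis by (simp add: inner_abs_abs_l2 sq \<open>sq_integrable ?\<psi>\<close>)
    qed
    then have "(norm (abs_l2 ?\<psi>))\<^sup>2 \<le> (r * norm (abs_l2 \<phi>))\<^sup>2" by (simp add: power_mult_distrib power2_norm_eq_inner)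
    then show ?thesis by (rule power2_le_imp_le) (use r in simp)
  qed
  finally have "norm (abs_l2 \<phi>) * norm (abs_l2 \<phi>) \<le> (2 * r * norm (abs_l2 (pderiv_fun i \<phi>))) * norm (abs_l2 \<phi>)"
    by (simp add: mult_ac mult_right_mono flip: power2_norm_eq_inner power2_eq_square)
  then show ?thesis using r by (cases "norm (abs_l2 \<phi>) = 0") auto
qed

lemma H10_Poincare:
  assumes \<Omega>: "\<Omega> \<subseteq> cball 0 r" "i \<in> Basis" and r: "r \<ge> 0" and u: "u \<in> H10 \<Omega>"
  shows "norm u \<le> 2 * r * norm (weak_pderiv \<Omega> i u)"
proof -
  obtain \<phi> where \<phi>: "\<And>k. test_fun \<Omega> (\<phi> k)" "(\<lambda>k. abs_l2 (\<phi> k)) \<longlonglongrightarrow> u"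
    "(\<lambda>k. abs_l2 (pderiv_fun i (\<phi> k))) \<longlonglongrightarrow> weak_pderiv \<Omega> i u"
    using u \<Omega>(2) by (auto simp: H10_def)
  have "(\<lambda>k. 2 * r * norm (abs_l2 (pderiv_fun i (\<phi> k)))) \<longlonglongrightarrow> 2 * r * norm (weak_pderiv \<Omega> i u)"
    by (intro tendsto_intros \<phi>)
  then show ?thesis
    using test_fun_Poincare[OF \<phi>(1) \<Omega> r] by (intro LIMSEQ_le[OF tendsto_norm[OF \<phi>(2)]]) auto
qed

text \<open>A single coordinate direction suffices; 4 r^2 is the square of the Poincare
  constant.\<close>

lemma dirichlet_laplacian_coercive:
  fixes \<Omega> :: "'a::euclidean_space set"
  assumes \<Omega>: "open \<Omega>" "\<Omega> \<subseteq> cball 0 r" and r: "r > 0" and uf: "(u, f) \<in> dirichlet_laplacian \<Omega>"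
  shows "1 / (4 * r\<^sup>2) * (norm u)\<^sup>2 \<le> f \<bullet> u"
proof -
  obtain i :: 'a where i: "i \<in> Basis" using nonempty_Basis by blast
  have u: "u \<in> H10 \<Omega>" using uf by (simp add: dirichlet_laplacian_def)
  have "(norm u)\<^sup>2 \<le> (2 * r * norm (weak_pderiv \<Omega> i u))\<^sup>2" 
    using H10_Poincare[OF \<Omega>(2) i less_imp_le[OF r] u] by (intro power_mono) auto
  then have "1 / (4 * r\<^sup>2) * (norm u)\<^sup>2 \<le> (norm (weak_pderiv \<Omega> i u))\<^sup>2"
    using r by (simp add: field_simps power2_eq_square)
  also have "\<dots> = weak_pderiv \<Omega> i u \<bullet> weak_pderiv \<Omega> i u" by (rule power2_norm_eq_inner)
  also have "\<dots> \<le> (\<Sum>i\<in>Basis. weak_pderiv \<Omega> i u \<bullet> weak_pderiv \<Omega> i u)"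
    using i by (intro member_le_sum) auto
  also have "\<dots> = f \<bullet> u" by (rule dirichlet_laplacian_form[OF \<Omega>(1) uf u, symmetric])
  finally show ?thesis .
qed

section \<open>The Lyapunov functional\<close>

lemma norm_add_sq_le: "(norm (x + y))\<^sup>2 \<le> 2 * (norm x)\<^sup>2 + 2 * (norm (y :: 'h::real_inner))\<^sup>2"
proof -
  have "0 \<le> (x - y) \<bullet> (x - y)" by (rule inner_ge_zero)
  then show ?thesis unfolding power2_norm_eq_inner by (simp add: inner_add_left inner_add_right inner_diff_left inner_diff_right inner_commute)
qed

lemma norm_diff_sq_le: "(norm (x - y))\<^sup>2 \<le> 2 * (norm x)\<^sup>2 + 2 * (norm (y :: 'h::real_inner))\<^sup>2"
  using norm_add_sq_le[of x "- y"] by simp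

lemma inner_weighted_le:
  fixes x y :: "'h::real_inner"
  assumes "r > 0"
  shows "x \<bullet> y \<le> r * (norm x)\<^sup>2 + (norm y)\<^sup>2 / (4 * r)"
proof -
  have "0 \<le> ((2 * r) *\<^sub>R x - y) \<bullet> ((2 * r) *\<^sub>R x - y)" by (rule inner_ge_zero)
  also have "\<dots> = 4 * r\<^sup>2 * (norm x)\<^sup>2 - 4 * r * (x \<bullet> y) + (norm y)\<^sup>2"
    unfolding power2_norm_eq_inner by (simp add: inner_diff_left inner_diff_right inner_commute power2_eq_square)
  finally have "4 * r * (x \<bullet> y) \<le> 4 * r\<^sup>2 * (norm x)\<^sup>2 + (norm y)\<^sup>2" by simp
  then have "4 * r * (x \<bullet> y) / (4 * r) \<le> (4 * r\<^sup>2 * (norm x)\<^sup>2 + (norm y)\<^sup>2) / (4 * r)"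
    using assms by (intro divide_right_mono) auto
  then show ?thesis using assms by (simp add: add_divide_distrib power2_eq_square)
qed

text \<open>\<kappa> stands for the constant in \<kappa> |u|^2 \<le> |A^(1/2) u|^2. Everything named
  in this locale that serves as a final constant depends on these five parameters alone, never on
  \<tau>.\<close>

locale lyapunov =
  fixes \<alpha> c \<delta> \<gamma>\<^sub>0 \<kappa> :: real
  assumes pos: "\<alpha> > 0" "c > 0" "\<delta> > 0" "\<gamma>\<^sub>0 > 0" "\<kappa> > 0"
begin

definition b\<^sub>1 where "b\<^sub>1 = \<delta> + c\<^sup>2"
definition k\<^sub>1 where "k\<^sub>1 = c\<^sup>2 / \<delta>"
text \<open>The first entry keeps the functional positive (\<open>eps_sq\<close>); the second keeps
  half of the lower bound of the damping after the error terms in |w|^2 are paid for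
  (\<open>eps_gamma\<close>).\<close>

definition \<epsilon> where "\<epsilon> = min (sqrt (\<delta> * \<kappa>) / 2) (\<gamma>\<^sub>0 / (2 * (\<alpha>\<^sup>2 / (\<delta> * \<kappa>) + 2)))"
text \<open>The second entry ensures 32 \<tau> k^2 \<le> \<kappa> \<delta>, which absorbs the term
  \<tau> k^2 |v|^2 in the dissipation estimate.\<close>

definition \<tau>\<^sub>0 where "\<tau>\<^sub>0 = min 1 (\<kappa> * \<delta> / (32 * k\<^sub>1\<^sup>2))"

definition admissible :: "real \<Rightarrow> real \<Rightarrow> real \<Rightarrow> real \<Rightarrow> bool" where
  "admissible \<tau> b k \<gamma> \<longleftrightarrow> 0 < \<tau> \<and> \<tau> \<le> \<tau>\<^sub>0 \<and> \<delta> \<le> b \<and> b \<le> b\<^sub>1 \<and> k * b = c\<^sup>2 \<and> \<gamma>\<^sub>0 \<le> \<gamma> \<and> \<gamma> \<le> \<alpha>"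

text \<open>To be read with a = A^(1/2) u, d = A^(1/2) v. The part outside the factor \<epsilon> is
  the energy of the multiplier w + k v; the part inside combines the multiplier v + k u with the
  term that recovers |a|^2.\<close>

definition lyap :: "real \<Rightarrow> real \<Rightarrow> real \<Rightarrow> real \<Rightarrow> 'h::real_inner \<Rightarrow> 'h \<Rightarrow> 'h \<Rightarrow> 'h \<Rightarrow> 'h \<Rightarrow> real" where
  "lyap \<tau> b k \<gamma> a d u v w = b / 2 * ((d + k *\<^sub>R a) \<bullet> (d + k *\<^sub>R a)) + \<tau> / 2 * ((w + k *\<^sub>R v) \<bullet> (w + k *\<^sub>R v))
     + k * \<gamma> / 2 * (v \<bullet> v) + \<epsilon> * (\<tau> * ((w + k *\<^sub>R v) \<bullet> (v + k *\<^sub>R u)) + b * k / 4 * (a \<bullet> a))"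

text \<open>Formal time derivative of \<open>lyap\<close> under a' = d, d' = e, u' = v, v' = w, w' =
  p, kept algebraic so that the estimates are free of calculus.\<close>

definition lyap_deriv :: "real \<Rightarrow> real \<Rightarrow> real \<Rightarrow> real \<Rightarrow> 'h::real_inner \<Rightarrow> 'h \<Rightarrow> 'h \<Rightarrow> 'h \<Rightarrow> 'h \<Rightarrow> 'h \<Rightarrow> 'h \<Rightarrow> real" where
  "lyap_deriv \<tau> b k \<gamma> a d e u v w p = b * ((d + k *\<^sub>R a) \<bullet> (e + k *\<^sub>R d)) + \<tau> * ((w + k *\<^sub>R v) \<bullet> (p + k *\<^sub>R w))
     + k * \<gamma> * (v \<bullet> w) + \<epsilon> * (\<tau> * ((p + k *\<^sub>R w) \<bullet> (v + k *\<^sub>R u) + (w + k *\<^sub>R v) \<bullet> (w + k *\<^sub>R v)) 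
     + b * k / 2 * (a \<bullet> d))"

lemma eps_pos: "\<epsilon> > 0"
  unfolding \<epsilon>_def using pos by (simp add: add_nonneg_pos)

lemma eps_sq: "\<epsilon>\<^sup>2 \<le> \<delta> * \<kappa> / 4"
proof -
  have "\<epsilon> \<le> sqrt (\<delta> * \<kappa>) / 2" unfolding \<epsilon>_def by (rule min.cobounded1)
  then have "\<epsilon>\<^sup>2 \<le> (sqrt (\<delta> * \<kappa>) / 2)\<^sup>2" using eps_pos by (intro power_mono) auto
  then show ?thesis using pos by (simp add: power_divide)
qed

lemma eps_gamma: "\<epsilon> * (\<alpha>\<^sup>2 / (\<delta> * \<kappa>) + 2) \<le> \<gamma>\<^sub>0 / 2"
proof -
  have "\<alpha>\<^sup>2 / (\<delta> * \<kappa>) + 2 > 0" using pos by (simp add: add_nonneg_pos)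
  moreover have "\<epsilon> \<le> \<gamma>\<^sub>0 / (2 * (\<alpha>\<^sup>2 / (\<delta> * \<kappa>) + 2))" by (simp add: \<epsilon>_def)
  ultimately show ?thesis by (simp add: field_simps)
qed

lemma k1_pos: "k\<^sub>1 > 0" unfolding k\<^sub>1_def using pos by simp
lemma b1_pos: "b\<^sub>1 > 0" unfolding b\<^sub>1_def using pos by (simp add: add_pos_nonneg)
lemma tau0_pos: "\<tau>\<^sub>0 > 0" unfolding \<tau>\<^sub>0_def using pos k1_pos by simp

lemma admissible_facts:
  assumes "admissible \<tau> b k \<gamma>"
  shows "0 < \<tau>" "\<tau> \<le> 1" "32 * \<tau> * k\<^sup>2 \<le> \<kappa> * \<delta>" "0 < k" "k \<le> k\<^sub>1" "k\<^sup>2 \<le> k\<^sub>1\<^sup>2" "0 < b" "\<delta> \<le> b" "b \<le> b\<^sub>1" 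
    "b * k = c\<^sup>2" "0 < \<gamma>" "\<gamma> \<le> \<alpha>" "\<gamma>\<^sub>0 \<le> \<gamma>"
proof -
  have a: "0 < \<tau>" "\<tau> \<le> \<tau>\<^sub>0" "\<delta> \<le> b" "b \<le> b\<^sub>1" "k * b = c\<^sup>2" "\<gamma>\<^sub>0 \<le> \<gamma>" "\<gamma> \<le> \<alpha>"
    using assms by (auto simp: admissible_def)
  show "0 < \<tau>" "\<delta> \<le> b" "b \<le> b\<^sub>1" "\<gamma> \<le> \<alpha>" "\<gamma>\<^sub>0 \<le> \<gamma>" by fact+
  show "b * k = c\<^sup>2" using a by (simp add: mult.commute)
  show b: "0 < b" "0 < \<gamma>" using a pos by linarith+
  have k: "k = c\<^sup>2 / b" using a(5) b by (simp add: field_simps)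
  show k0: "0 < k" unfolding k using pos b by simp
  show k1: "k \<le> k\<^sub>1" unfolding k k\<^sub>1_def using a pos by (intro divide_left_mono) auto
  show k2: "k\<^sup>2 \<le> k\<^sub>1\<^sup>2" using k0 k1 by (intro power_mono) auto
  show "\<tau> \<le> 1" using a(2) by (simp add: \<tau>\<^sub>0_def)
  have "\<tau> \<le> \<kappa> * \<delta> / (32 * k\<^sub>1\<^sup>2)" using a(2) by (simp add: \<tau>\<^sub>0_def)
  then have "32 * \<tau> * k\<^sub>1\<^sup>2 \<le> \<kappa> * \<delta>" using k1_pos by (simp add: field_simps)
  moreover have "32 * \<tau> * k\<^sup>2 \<le> 32 * \<tau> * k\<^sub>1\<^sup>2" using k2 a(1) by simp
  ultimately show "32 * \<tau> * k\<^sup>2 \<le> \<kappa> * \<delta>" by linarith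
qed

text \<open>Lower bounds for the coefficients of |w|^2, |Y|^2 and |a|^2 in the dissipation: half the
  damping survives by \<open>eps_gamma\<close>, then b \<ge> \<delta>, and finally b k^2 = c^4 / b
  with b at most \<open>b\<^sub>1\<close>.\<close>

definition m\<^sub>0 where "m\<^sub>0 = min (\<gamma>\<^sub>0 / 2) (min (\<epsilon> * (3 * \<delta> / 8)) (\<epsilon> * (c ^ 4 / (8 * b\<^sub>1))))"

lemma m0_pos: "m\<^sub>0 > 0" unfolding m\<^sub>0_def using pos eps_pos b1_pos by simp

text \<open>Here \<open>f\<close> plays A (c^2 u + b v), and the equation is \<tau> (p + k w) = - f
  - \<gamma> w. Tested with w + k v it cancels every indefinite energy term and leaves - \<gamma>
  |w|^2; tested with v + k u it produces - b |Y|^2.\<close>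

lemma lyap_dissipation:
  fixes a d e u v w p f :: "'h::real_inner"
  assumes adm: "admissible \<tau> b k \<gamma>"
    and p: "\<tau> *\<^sub>R p = - f - (\<gamma> + \<tau> * k) *\<^sub>R w"
    and f: "f \<bullet> u = b * ((d + k *\<^sub>R a) \<bullet> a)" "f \<bullet> v = b * ((d + k *\<^sub>R a) \<bullet> d)" "f \<bullet> w = b * ((d + k *\<^sub>R a) \<bullet> e)"
    and y: "\<kappa> * (norm (v + k *\<^sub>R u))\<^sup>2 \<le> (norm (d + k *\<^sub>R a))\<^sup>2" and v: "\<kappa> * (norm v)\<^sup>2 \<le> (norm d)\<^sup>2"
  shows "lyap_deriv \<tau> b k \<gamma> a d e u v w p \<le> - m\<^sub>0 * ((norm w)\<^sup>2 + (norm (d + k *\<^sub>R a))\<^sup>2 + (norm a)\<^sup>2)"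
proof -
  note A = admissible_facts[OF adm]
  define Y where "Y = d + k *\<^sub>R a"
  define q where "q = v + k *\<^sub>R u"
  have px: "\<tau> * (p \<bullet> x) = - (f \<bullet> x) - (\<gamma> + \<tau> * k) * (w \<bullet> x)" for x
    using arg_cong[OF p, of "\<lambda>z. z \<bullet> x"] by (simp add: inner_diff_left)
  have fx: "f \<bullet> (w + k *\<^sub>R v) = b * (Y \<bullet> (e + k *\<^sub>R d))" "f \<bullet> q = b * (Y \<bullet> Y)"
    unfolding q_def Y_def using f by (simp_all add: inner_add_right algebra_simps)
  have 1: "\<tau> * ((w + k *\<^sub>R v) \<bullet> (p + k *\<^sub>R w)) = - (b * (Y \<bullet> (e + k *\<^sub>R d))) - \<gamma> * (w \<bullet> (w + k *\<^sub>R v))"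
    using px[of "w + k *\<^sub>R v"] unfolding fx 
    by (simp add: inner_commute[of "w + k *\<^sub>R v" "p + k *\<^sub>R w"] inner_add_left[of p] distrib_left) (simp add: algebra_simps)
  have 2: "\<tau> * ((p + k *\<^sub>R w) \<bullet> q) = - (b * (Y \<bullet> Y)) - \<gamma> * (w \<bullet> q)"
    using px[of q] unfolding fx by (simp add: inner_add_left algebra_simps)
  have eq: "lyap_deriv \<tau> b k \<gamma> a d e u v w p = - \<gamma> * (norm w)\<^sup>2 
      + \<epsilon> * (- b * (norm Y)\<^sup>2 - \<gamma> * (w \<bullet> q) + \<tau> * (norm (w + k *\<^sub>R v))\<^sup>2 + b * k / 2 * (a \<bullet> d))"
    unfolding lyap_deriv_def Y_def[symmetric] q_def[symmetric] distrib_left[of \<tau>] 1 2 power2_norm_eq_inner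
    by (simp add: inner_add_right algebra_simps inner_commute)
  \<comment> \<open>The weight b \<kappa> / 4 in Young's inequality makes the coercivity bound cost
    exactly a quarter of b |Y|^2.\<close>
  have e1: "- \<gamma> * (w \<bullet> q) \<le> b / 4 * (norm Y)\<^sup>2 + \<alpha>\<^sup>2 / (\<delta> * \<kappa>) * (norm w)\<^sup>2"
  proof -
    have "q \<bullet> ((- \<gamma>) *\<^sub>R w) \<le> b * \<kappa> / 4 * (norm q)\<^sup>2 + (norm ((- \<gamma>) *\<^sub>R w))\<^sup>2 / (4 * (b * \<kappa> / 4))"
      using A pos by (intro inner_weighted_le) simp
    moreover have "b / 4 * (\<kappa> * (norm q)\<^sup>2) \<le> b / 4 * (norm Y)\<^sup>2"
      using y A unfolding Y_def q_def by (intro mult_left_mono) auto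
    moreover have "(norm ((- \<gamma>) *\<^sub>R w))\<^sup>2 / (4 * (b * \<kappa> / 4)) \<le> (\<alpha> * norm w)\<^sup>2 / (\<delta> * \<kappa>)"
      using A pos by (intro frac_le power_mono) (auto intro!: mult_right_mono)
    ultimately show ?thesis by (simp add: power_mult_distrib inner_commute)
  qed
  have dY: "(norm d)\<^sup>2 \<le> 2 * (norm Y)\<^sup>2 + 2 * (k\<^sup>2 * (norm a)\<^sup>2)"
    using norm_diff_sq_le[of Y "k *\<^sub>R a"] by (simp add: Y_def power_mult_distrib)
  \<comment> \<open>The wrong-signed term is controlled by small \<tau>; the constant 32 makes its
    share of |a|^2 half of what \<open>e3\<close> gains.\<close>
  have e2: "\<tau> * (norm (w + k *\<^sub>R v))\<^sup>2 \<le> 2 * (norm w)\<^sup>2 + b / 8 * (norm Y)\<^sup>2 + b * k\<^sup>2 / 8 * (norm a)\<^sup>2"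
  proof -
    have "\<tau> * (norm (w + k *\<^sub>R v))\<^sup>2 \<le> \<tau> * (2 * (norm w)\<^sup>2 + 2 * (k\<^sup>2 * (norm v)\<^sup>2))"
      using norm_add_sq_le[of w "k *\<^sub>R v"] A by (intro mult_left_mono) (auto simp: power_mult_distrib)
    moreover have "\<tau> * (2 * (norm w)\<^sup>2) \<le> 1 * (2 * (norm w)\<^sup>2)" using A by (intro mult_right_mono) auto
    moreover have "\<tau> * (2 * (k\<^sup>2 * (norm v)\<^sup>2)) \<le> b / 16 * (norm d)\<^sup>2"
    proof -
      have "32 * \<tau> * k\<^sup>2 * (norm v)\<^sup>2 \<le> \<kappa> * \<delta> * (norm v)\<^sup>2" using A by (intro mult_right_mono) auto
      also have "\<dots> = \<delta> * (\<kappa> * (norm v)\<^sup>2)" by simp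
      also have "\<dots> \<le> b * (norm d)\<^sup>2" using A v pos by (intro mult_mono) auto
      finally show ?thesis by simp
    qed
    moreover have "b / 16 * (norm d)\<^sup>2 \<le> b / 16 * (2 * (norm Y)\<^sup>2 + 2 * (k\<^sup>2 * (norm a)\<^sup>2))"
      using dY A by (intro mult_left_mono) auto
    ultimately show ?thesis by (simp add: algebra_simps)
  qed
  \<comment> \<open>Damping of a comes from d = Y - k a: the product a . d contains - k |a|^2, half
    of which pays for a . Y.\<close>
  have e3: "b * k / 2 * (a \<bullet> d) \<le> b / 4 * (norm Y)\<^sup>2 - b * k\<^sup>2 / 4 * (norm a)\<^sup>2"
  proof -
    have "a \<bullet> Y \<le> k / 2 * (norm a)\<^sup>2 + (norm Y)\<^sup>2 / (4 * (k / 2))" using A by (intro inner_weighted_le) simp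
    then have "b * k / 2 * (a \<bullet> Y) \<le> b * k / 2 * (k / 2 * (norm a)\<^sup>2 + (norm Y)\<^sup>2 / (4 * (k / 2)))"
      using A by (intro mult_left_mono) auto
    also have "\<dots> = b * k\<^sup>2 / 4 * (norm a)\<^sup>2 + b / 4 * (norm Y)\<^sup>2" using A(4) by (simp add: distrib_left power2_eq_square)
    finally have "b * k / 2 * (a \<bullet> Y) \<le> b * k\<^sup>2 / 4 * (norm a)\<^sup>2 + b / 4 * (norm Y)\<^sup>2" .
    moreover have "a \<bullet> Y = a \<bullet> d + k * (norm a)\<^sup>2" by (simp add: Y_def inner_add_right power2_norm_eq_inner)
    ultimately show ?thesis by (simp add: algebra_simps power2_eq_square)
  qed
  \<comment> \<open>Balance of the three estimates: -1 + 1/4 + 1/8 + 1/4 = -3/8 for b |Y|^2, and 1/8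
    - 1/4 = -1/8 for b k^2 |a|^2.\<close>
  have "- b * (norm Y)\<^sup>2 - \<gamma> * (w \<bullet> q) + \<tau> * (norm (w + k *\<^sub>R v))\<^sup>2 + b * k / 2 * (a \<bullet> d)
      \<le> (\<alpha>\<^sup>2 / (\<delta> * \<kappa>) + 2) * (norm w)\<^sup>2 - 3 * b / 8 * (norm Y)\<^sup>2 - b * k\<^sup>2 / 8 * (norm a)\<^sup>2"
    using e1 e2 e3 by (simp add: algebra_simps)
  then have "lyap_deriv \<tau> b k \<gamma> a d e u v w p \<le> - \<gamma> * (norm w)\<^sup>2 
      + \<epsilon> * ((\<alpha>\<^sup>2 / (\<delta> * \<kappa>) + 2) * (norm w)\<^sup>2 - 3 * b / 8 * (norm Y)\<^sup>2 - b * k\<^sup>2 / 8 * (norm a)\<^sup>2)"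
    unfolding eq using eps_pos by (intro add_left_mono mult_left_mono) auto
  also have "\<dots> = - (\<gamma> - \<epsilon> * (\<alpha>\<^sup>2 / (\<delta> * \<kappa>) + 2)) * (norm w)\<^sup>2 - \<epsilon> * (3 * b / 8) * (norm Y)\<^sup>2 - \<epsilon> * (b * k\<^sup>2 / 8) * (norm a)\<^sup>2"
    by (simp add: algebra_simps)
  also have "\<dots> \<le> - m\<^sub>0 * (norm w)\<^sup>2 - m\<^sub>0 * (norm Y)\<^sup>2 - m\<^sub>0 * (norm a)\<^sup>2"
  proof -
    have "m\<^sub>0 \<le> \<gamma> - \<epsilon> * (\<alpha>\<^sup>2 / (\<delta> * \<kappa>) + 2)" using eps_gamma A by (simp add: m\<^sub>0_def)
    then have i1: "m\<^sub>0 * (norm w)\<^sup>2 \<le> (\<gamma> - \<epsilon> * (\<alpha>\<^sup>2 / (\<delta> * \<kappa>) + 2)) * (norm w)\<^sup>2" by (intro mult_right_mono) auto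
    have "m\<^sub>0 \<le> \<epsilon> * (3 * \<delta> / 8)" by (simp add: m\<^sub>0_def)
    also have "\<dots> \<le> \<epsilon> * (3 * b / 8)" using eps_pos A by (intro mult_left_mono) auto
    finally have i2: "m\<^sub>0 * (norm Y)\<^sup>2 \<le> \<epsilon> * (3 * b / 8) * (norm Y)\<^sup>2" by (intro mult_right_mono) auto
    have "c ^ 4 / b\<^sub>1 \<le> c ^ 4 / b" using A pos b1_pos by (intro divide_left_mono) auto
    also have "\<dots> = (b * k)\<^sup>2 / b" unfolding A(10) by simp
    also have "\<dots> = b * k\<^sup>2" using A(7) by (simp add: power2_eq_square)
    finally have "\<epsilon> * (c ^ 4 / (8 * b\<^sub>1)) \<le> \<epsilon> * (b * k\<^sup>2 / 8)" using eps_pos by (intro mult_left_mono) auto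
    then have "m\<^sub>0 \<le> \<epsilon> * (b * k\<^sup>2 / 8)" by (simp add: m\<^sub>0_def)
    then have i3: "m\<^sub>0 * (norm a)\<^sup>2 \<le> \<epsilon> * (b * k\<^sup>2 / 8) * (norm a)\<^sup>2" by (intro mult_right_mono) auto
    show ?thesis using i1 i2 i3 by linarith
  qed
  finally show ?thesis unfolding Y_def by (simp add: algebra_simps)
qed

section \<open>Equivalence of the functional with the squared phase norm\<close>

definition C\<^sub>Y where "C\<^sub>Y = 2 + 2 * k\<^sub>1\<^sup>2"
definition C\<^sub>w where "C\<^sub>w = 2 + 2 * k\<^sub>1\<^sup>2 / \<kappa>"
definition m\<^sub>2 where "m\<^sub>2 = b\<^sub>1 / 2 * C\<^sub>Y + C\<^sub>w / 2 + k\<^sub>1 * \<alpha> / 2 * (1 / \<kappa>) + \<epsilon> * (C\<^sub>w / 2 + C\<^sub>Y / \<kappa> / 2 + c\<^sup>2 / 4)"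

lemma m2_pos: "m\<^sub>2 > 0"
proof -
  have "C\<^sub>Y > 0" "C\<^sub>w > 0" unfolding C\<^sub>Y_def C\<^sub>w_def using pos by (auto intro!: add_pos_nonneg)
  then show ?thesis unfolding m\<^sub>2_def using pos eps_pos b1_pos k1_pos
    by (intro add_pos_pos mult_pos_pos divide_pos_pos) auto
qed

text \<open>With G the squared phase norm, \<open>C\<^sub>Y\<close> and \<open>C\<^sub>w\<close>
  bound |d + k a|^2 and \<tau> |w + k v|^2 by multiples of G; the summands of
  \<open>m\<^sub>2\<close> follow those of \<open>lyap\<close>.\<close>

lemma lyap_upper:
  fixes a d u v w :: "'h::real_inner"
  assumes adm: "admissible \<tau> b k \<gamma>"
    and y: "\<kappa> * (norm (v + k *\<^sub>R u))\<^sup>2 \<le> (norm (d + k *\<^sub>R a))\<^sup>2" and v: "\<kappa> * (norm v)\<^sup>2 \<le> (norm d)\<^sup>2"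
  shows "lyap \<tau> b k \<gamma> a d u v w \<le> m\<^sub>2 * ((norm a)\<^sup>2 + (norm d)\<^sup>2 + \<tau> * (norm w)\<^sup>2)"
proof -
  note A = admissible_facts[OF adm]
  define G where "G = (norm a)\<^sup>2 + (norm d)\<^sup>2 + \<tau> * (norm w)\<^sup>2"
  have G: "0 \<le> \<tau> * (norm w)\<^sup>2" "(norm a)\<^sup>2 \<le> G" "(norm d)\<^sup>2 \<le> G" "\<tau> * (norm w)\<^sup>2 \<le> G" "0 \<le> G"
    using A by (auto simp: G_def)
  have kG: "k\<^sup>2 * x \<le> k\<^sub>1\<^sup>2 * x" if "x \<ge> 0" for x using A that by (intro mult_right_mono) auto
  have Y: "(norm (d + k *\<^sub>R a))\<^sup>2 \<le> C\<^sub>Y * G"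
  proof -
    have "(norm (d + k *\<^sub>R a))\<^sup>2 \<le> 2 * (norm d)\<^sup>2 + 2 * (k\<^sup>2 * (norm a)\<^sup>2)"
      using norm_add_sq_le[of d "k *\<^sub>R a"] by (simp add: power_mult_distrib)
    also have "\<dots> \<le> 2 * G + 2 * (k\<^sub>1\<^sup>2 * G)" using G A by (intro add_mono mult_left_mono mult_mono) auto
    finally show ?thesis by (simp add: C\<^sub>Y_def algebra_simps)
  qed
  have V: "(norm v)\<^sup>2 \<le> 1 / \<kappa> * G" using order_trans[OF v G(3)] pos by (simp add: field_simps)
  have Q: "(norm (v + k *\<^sub>R u))\<^sup>2 \<le> C\<^sub>Y / \<kappa> * G" using order_trans[OF y Y] pos by (simp add: field_simps)
  have W: "\<tau> * (norm (w + k *\<^sub>R v))\<^sup>2 \<le> C\<^sub>w * G"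
  proof -
    have "\<tau> * (norm (w + k *\<^sub>R v))\<^sup>2 \<le> \<tau> * (2 * (norm w)\<^sup>2 + 2 * (k\<^sup>2 * (norm v)\<^sup>2))"
      using norm_add_sq_le[of w "k *\<^sub>R v"] A by (intro mult_left_mono) (auto simp: power_mult_distrib)
    also have "\<dots> = 2 * (\<tau> * (norm w)\<^sup>2) + 2 * (\<tau> * (k\<^sup>2 * (norm v)\<^sup>2))" by (simp add: algebra_simps)
    also have "\<dots> \<le> 2 * G + 2 * (1 * (k\<^sub>1\<^sup>2 * (1 / \<kappa> * G)))"
      using G V A by (intro add_mono mult_left_mono mult_mono) auto
    finally show ?thesis by (simp add: C\<^sub>w_def algebra_simps)
  qed
  have t1: "b / 2 * (norm (d + k *\<^sub>R a))\<^sup>2 \<le> b\<^sub>1 / 2 * (C\<^sub>Y * G)" using Y A b1_pos by (intro mult_mono) auto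
  have t3: "k * \<gamma> / 2 * (norm v)\<^sup>2 \<le> k\<^sub>1 * \<alpha> / 2 * (1 / \<kappa> * G)"
    using V A k1_pos pos by (intro mult_mono divide_right_mono) auto
  have t4: "\<tau> * ((w + k *\<^sub>R v) \<bullet> (v + k *\<^sub>R u)) \<le> C\<^sub>w / 2 * G + C\<^sub>Y / \<kappa> / 2 * G"
  proof -
    have "(w + k *\<^sub>R v) \<bullet> (v + k *\<^sub>R u) \<le> 1 / 2 * (norm (w + k *\<^sub>R v))\<^sup>2 + (norm (v + k *\<^sub>R u))\<^sup>2 / (4 * (1 / 2))"
      by (intro inner_weighted_le) simp
    then have "\<tau> * ((w + k *\<^sub>R v) \<bullet> (v + k *\<^sub>R u)) \<le> \<tau> * (1 / 2 * (norm (w + k *\<^sub>R v))\<^sup>2 + (norm (v + k *\<^sub>R u))\<^sup>2 / (4 * (1 / 2)))"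
      using A by (intro mult_left_mono) auto
    also have "\<dots> = 1 / 2 * (\<tau> * (norm (w + k *\<^sub>R v))\<^sup>2) + 1 / 2 * (\<tau> * (norm (v + k *\<^sub>R u))\<^sup>2)" by (simp add: algebra_simps)
    also have "\<dots> \<le> 1 / 2 * (C\<^sub>w * G) + 1 / 2 * (1 * (C\<^sub>Y / \<kappa> * G))"
    proof (intro add_mono mult_left_mono W)
      show "\<tau> * (norm (v + k *\<^sub>R u))\<^sup>2 \<le> 1 * (C\<^sub>Y / \<kappa> * G)" using Q A by (intro mult_mono) auto
    qed auto
    finally show ?thesis by simp
  qed
  have t5: "b * k / 4 * (norm a)\<^sup>2 \<le> c\<^sup>2 / 4 * G" unfolding A(10) using G by (intro mult_left_mono) auto
  have "\<epsilon> * (\<tau> * ((w + k *\<^sub>R v) \<bullet> (v + k *\<^sub>R u)) + b * k / 4 * (norm a)\<^sup>2) \<le> \<epsilon> * (C\<^sub>w / 2 * G + C\<^sub>Y / \<kappa> / 2 * G + c\<^sup>2 / 4 * G)"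
    using t4 t5 eps_pos by (intro mult_left_mono add_mono) auto
  moreover have "\<tau> / 2 * (norm (w + k *\<^sub>R v))\<^sup>2 \<le> C\<^sub>w / 2 * G" using W by simp
  ultimately have "lyap \<tau> b k \<gamma> a d u v w \<le> b\<^sub>1 / 2 * (C\<^sub>Y * G) + C\<^sub>w / 2 * G + k\<^sub>1 * \<alpha> / 2 * (1 / \<kappa> * G)
     + \<epsilon> * (C\<^sub>w / 2 * G + C\<^sub>Y / \<kappa> / 2 * G + c\<^sup>2 / 4 * G)"
    unfolding lyap_def power2_norm_eq_inner[symmetric] using t1 t3 by (intro add_mono)
  also have "\<dots> = m\<^sub>2 * G" unfolding m\<^sub>2_def by (simp only: distrib_right distrib_left mult.assoc)
  finally show ?thesis by (simp add: G_def)
qed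

definition C\<^sub>d where "C\<^sub>d = 8 / \<delta> + 2 * (k\<^sub>1\<^sup>2 * (4 / (\<epsilon> * c\<^sup>2)))"
definition m\<^sub>1 where "m\<^sub>1 = 4 / (\<epsilon> * c\<^sup>2) + C\<^sub>d + (8 + 2 * (k\<^sub>1\<^sup>2 * (C\<^sub>d / \<kappa>)))"

lemma m1_pos: "m\<^sub>1 > 0"
proof -
  have "C\<^sub>d > 0" unfolding C\<^sub>d_def using pos eps_pos by (intro add_pos_nonneg) auto
  then show ?thesis unfolding m\<^sub>1_def using pos eps_pos by (intro add_pos_pos add_pos_nonneg) auto
qed

text \<open>Once the cross term is absorbed, the components are recovered in turn: a directly, d
  from d + k a, v from d by coercivity, and w, still weighted by \<tau>, from w + k v.
  \<open>C\<^sub>d\<close> and \<open>m\<^sub>1\<close> collect the losses.\<close>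

lemma lyap_lower:
  fixes a d u v w :: "'h::real_inner"
  assumes adm: "admissible \<tau> b k \<gamma>"
    and y: "\<kappa> * (norm (v + k *\<^sub>R u))\<^sup>2 \<le> (norm (d + k *\<^sub>R a))\<^sup>2" and v: "\<kappa> * (norm v)\<^sup>2 \<le> (norm d)\<^sup>2"
  shows "(norm a)\<^sup>2 + (norm d)\<^sup>2 + \<tau> * (norm w)\<^sup>2 \<le> m\<^sub>1 * lyap \<tau> b k \<gamma> a d u v w"
proof -
  note A = admissible_facts[OF adm]
  let ?L = "lyap \<tau> b k \<gamma> a d u v w"
  let ?Y = "d + k *\<^sub>R a" and ?W = "w + k *\<^sub>R v" and ?q = "v + k *\<^sub>R u"
  \<comment> \<open>By \<epsilon>^2 \<le> \<delta> \<kappa> / 4 and \<tau> \<le> 1 the cross term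
    takes at most half of each of the first two energy terms.\<close>
  have cross: "- (\<epsilon> * (\<tau> * (?W \<bullet> ?q))) \<le> \<tau> / 4 * (norm ?W)\<^sup>2 + b / 4 * (norm ?Y)\<^sup>2"
  proof -
    have "?W \<bullet> ((- \<epsilon>) *\<^sub>R ?q) \<le> 1 / 4 * (norm ?W)\<^sup>2 + (norm ((- \<epsilon>) *\<^sub>R ?q))\<^sup>2 / (4 * (1 / 4))"
      by (intro inner_weighted_le) simp
    then have "\<tau> * (?W \<bullet> ((- \<epsilon>) *\<^sub>R ?q)) \<le> \<tau> * (1 / 4 * (norm ?W)\<^sup>2 + \<epsilon>\<^sup>2 * (norm ?q)\<^sup>2)"
      using A by (intro mult_left_mono) (auto simp: power_mult_distrib)
    moreover have "\<tau> * (\<epsilon>\<^sup>2 * (norm ?q)\<^sup>2) \<le> 1 * (\<delta> * \<kappa> / 4 * (norm ?q)\<^sup>2)"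
      using A eps_sq pos by (intro mult_mono) auto
    moreover have "\<delta> / 4 * (\<kappa> * (norm ?q)\<^sup>2) \<le> b / 4 * (norm ?Y)\<^sup>2" using A y pos by (intro mult_mono) auto
    ultimately show ?thesis by (simp add: algebra_simps)
  qed
  have "0 \<le> k * \<gamma> / 2 * (norm v)\<^sup>2" using A by simp
  then have L: "b / 4 * (norm ?Y)\<^sup>2 + \<tau> / 4 * (norm ?W)\<^sup>2 + \<epsilon> * (c\<^sup>2 / 4 * (norm a)\<^sup>2) \<le> ?L"
    using cross unfolding lyap_def power2_norm_eq_inner[symmetric] A(10) by (simp add: distrib_left)
  have nn: "0 \<le> b / 4 * (norm ?Y)\<^sup>2" "0 \<le> \<tau> / 4 * (norm ?W)\<^sup>2" "0 \<le> \<epsilon> * (c\<^sup>2 / 4 * (norm a)\<^sup>2)"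
    using A eps_pos by auto
  then have L0: "0 \<le> ?L" using L by linarith
  have Y: "(norm ?Y)\<^sup>2 \<le> 4 / \<delta> * ?L"
  proof -
    have "\<delta> * (norm ?Y)\<^sup>2 \<le> b * (norm ?Y)\<^sup>2" using A by (intro mult_right_mono) auto
    also have "\<dots> \<le> 4 * ?L" using L nn by linarith
    finally show ?thesis using pos by (simp add: field_simps)
  qed
  have W: "\<tau> * (norm ?W)\<^sup>2 \<le> 4 * ?L" using L nn by simp
  have a: "(norm a)\<^sup>2 \<le> 4 / (\<epsilon> * c\<^sup>2) * ?L"
  proof -
    have "\<epsilon> * (c\<^sup>2 / 4 * (norm a)\<^sup>2) \<le> ?L" using L nn by linarith
    then show ?thesis using eps_pos pos by (simp add: field_simps)
  qed
  have d: "(norm d)\<^sup>2 \<le> C\<^sub>d * ?L"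
  proof -
    have "(norm d)\<^sup>2 \<le> 2 * (norm ?Y)\<^sup>2 + 2 * (k\<^sup>2 * (norm a)\<^sup>2)"
      using norm_diff_sq_le[of ?Y "k *\<^sub>R a"] by (simp add: power_mult_distrib)
    also have "\<dots> \<le> 2 * (4 / \<delta> * ?L) + 2 * (k\<^sub>1\<^sup>2 * (4 / (\<epsilon> * c\<^sup>2) * ?L))"
      using Y a A by (intro add_mono mult_left_mono mult_mono) auto
    also have "\<dots> = C\<^sub>d * ?L" unfolding C\<^sub>d_def by (simp add: algebra_simps)
    finally show ?thesis .
  qed
  have V: "(norm v)\<^sup>2 \<le> C\<^sub>d / \<kappa> * ?L" using order_trans[OF v d] pos by (simp add: field_simps)
  have w: "\<tau> * (norm w)\<^sup>2 \<le> (8 + 2 * (k\<^sub>1\<^sup>2 * (C\<^sub>d / \<kappa>))) * ?L"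
  proof -
    have "\<tau> * (norm w)\<^sup>2 \<le> \<tau> * (2 * (norm ?W)\<^sup>2 + 2 * (k\<^sup>2 * (norm v)\<^sup>2))"
      using norm_diff_sq_le[of ?W "k *\<^sub>R v"] A by (intro mult_left_mono) (auto simp: power_mult_distrib)
    also have "\<dots> = 2 * (\<tau> * (norm ?W)\<^sup>2) + 2 * (\<tau> * (k\<^sup>2 * (norm v)\<^sup>2))" by (simp add: algebra_simps)
    also have "\<dots> \<le> 2 * (4 * ?L) + 2 * (1 * (k\<^sub>1\<^sup>2 * (C\<^sub>d / \<kappa> * ?L)))"
    proof (intro add_mono mult_left_mono W)
      show "\<tau> * (k\<^sup>2 * (norm v)\<^sup>2) \<le> 1 * (k\<^sub>1\<^sup>2 * (C\<^sub>d / \<kappa> * ?L))" using V A by (intro mult_mono) auto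
    qed auto
    also have "\<dots> = (8 + 2 * (k\<^sub>1\<^sup>2 * (C\<^sub>d / \<kappa>))) * ?L" by (simp add: algebra_simps)
    finally show ?thesis .
  qed
  show ?thesis unfolding m\<^sub>1_def using a d w by (simp only: distrib_right)
qed

text \<open>The dissipation is at least \<open>m\<^sub>0\<close> times the quantity Q of
  \<open>lyap_decay\<close>, and \<open>m\<^sub>2 * (3 + 2 * k\<^sub>1\<^sup>2)\<close> bounds the
  functional by Q.\<close>

definition rate where "rate = m\<^sub>0 / (m\<^sub>2 * (3 + 2 * k\<^sub>1\<^sup>2))"

lemma rate_pos: "rate > 0"
  unfolding rate_def using m0_pos m2_pos by (intro divide_pos_pos mult_pos_pos add_pos_nonneg) auto

text \<open>Q contains the full |w|^2, which dominates \<tau> |w|^2 for \<tau> \<le> 1; this is what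
  makes \<open>rate\<close> independent of \<tau>.\<close>

lemma lyap_decay:
  fixes a d e u v w p f :: "'h::real_inner"
  assumes adm: "admissible \<tau> b k \<gamma>"
    and p: "\<tau> *\<^sub>R p = - f - (\<gamma> + \<tau> * k) *\<^sub>R w"
    and f: "f \<bullet> u = b * ((d + k *\<^sub>R a) \<bullet> a)" "f \<bullet> v = b * ((d + k *\<^sub>R a) \<bullet> d)" "f \<bullet> w = b * ((d + k *\<^sub>R a) \<bullet> e)"
    and y: "\<kappa> * (norm (v + k *\<^sub>R u))\<^sup>2 \<le> (norm (d + k *\<^sub>R a))\<^sup>2" and v: "\<kappa> * (norm v)\<^sup>2 \<le> (norm d)\<^sup>2"
  shows "lyap_deriv \<tau> b k \<gamma> a d e u v w p \<le> - rate * lyap \<tau> b k \<gamma> a d u v w"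
proof -
  note A = admissible_facts[OF adm]
  define Q where "Q = (norm w)\<^sup>2 + (norm (d + k *\<^sub>R a))\<^sup>2 + (norm a)\<^sup>2"
  have Q: "(norm (d + k *\<^sub>R a))\<^sup>2 \<le> Q" "(norm a)\<^sup>2 \<le> Q" "(norm w)\<^sup>2 + (norm a)\<^sup>2 \<le> Q" "0 \<le> Q" by (auto simp: Q_def)
  have "(norm d)\<^sup>2 \<le> 2 * (norm (d + k *\<^sub>R a))\<^sup>2 + 2 * (k\<^sup>2 * (norm a)\<^sup>2)"
    using norm_diff_sq_le[of "d + k *\<^sub>R a" "k *\<^sub>R a"] by (simp add: power_mult_distrib)
  also have "\<dots> \<le> 2 * Q + 2 * (k\<^sub>1\<^sup>2 * Q)" using A Q by (intro add_mono mult_left_mono mult_mono) auto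
  finally have "(norm d)\<^sup>2 \<le> 2 * Q + 2 * (k\<^sub>1\<^sup>2 * Q)" .
  moreover have "\<tau> * (norm w)\<^sup>2 \<le> 1 * (norm w)\<^sup>2" using A by (intro mult_right_mono) auto
  ultimately have "(norm a)\<^sup>2 + (norm d)\<^sup>2 + \<tau> * (norm w)\<^sup>2 \<le> 3 * Q + 2 * (k\<^sub>1\<^sup>2 * Q)" using Q(3) by linarith
  then have "(norm a)\<^sup>2 + (norm d)\<^sup>2 + \<tau> * (norm w)\<^sup>2 \<le> (3 + 2 * k\<^sub>1\<^sup>2) * Q" by (simp only: distrib_right mult.assoc)
  then have "m\<^sub>2 * ((norm a)\<^sup>2 + (norm d)\<^sup>2 + \<tau> * (norm w)\<^sup>2) \<le> m\<^sub>2 * ((3 + 2 * k\<^sub>1\<^sup>2) * Q)"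
    using m2_pos by (intro mult_left_mono) auto
  then have "lyap \<tau> b k \<gamma> a d u v w \<le> m\<^sub>2 * ((3 + 2 * k\<^sub>1\<^sup>2) * Q)"
    using lyap_upper[OF adm y v, of w] by linarith
  then have "rate * lyap \<tau> b k \<gamma> a d u v w \<le> rate * (m\<^sub>2 * ((3 + 2 * k\<^sub>1\<^sup>2) * Q))"
    using rate_pos by (intro mult_left_mono) auto
  also have "\<dots> = m\<^sub>0 * Q"
  proof -
    have "3 + 2 * k\<^sub>1\<^sup>2 > 0" by (intro add_pos_nonneg) auto
    then show ?thesis unfolding rate_def using m2_pos by simp
  qed
  finally show ?thesis using lyap_dissipation[OF adm p f y v] unfolding Q_def by linarith
qed

end

section \<open>Decay of the group\<close>

text \<open>A u = f is the fixed point equation u = K (f + \<mu> u) with K the inverse of A + \<mu>.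
  Coercivity bounds K by 1 / (\<kappa> + \<mu>), so the map contracts with factor \<mu> / (\<kappa>
  + \<mu>) for any size of \<mu>.\<close>

lemma positive_surjective_of_shift:
  fixes H :: "'h::real_inner set"
  assumes sub: "subspace H" and H: "complete H" and A: "A \<subseteq> H \<times> H" "single_valued A"
    and sym: "\<And>u f v g. (u, f) \<in> A \<Longrightarrow> (v, g) \<in> A \<Longrightarrow> f \<bullet> v = u \<bullet> g"
    and coercive: "\<And>u f. (u, f) \<in> A \<Longrightarrow> \<kappa> * (norm u)\<^sup>2 \<le> f \<bullet> u" and kappa: "\<kappa> > 0"
    and mu: "\<mu> \<ge> 0" and onto: "\<And>h. h \<in> H \<Longrightarrow> \<exists>(u, f)\<in>A. f + \<mu> *\<^sub>R u = h"
  shows "positive_surjective H A \<kappa>"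
proof -
  let ?A = "{(u, f + \<mu> *\<^sub>R u) | u f. (u, f) \<in> A}"
  interpret P: positive_surjective H ?A "\<kappa> + \<mu>"
  proof
    show "?A \<subseteq> H \<times> H" using A(1) sub by (auto intro!: subspace_add subspace_scale)
    show "single_valued ?A" using A(2) by (auto simp: single_valued_def)
    show "f \<bullet> v = u \<bullet> g" if "(u, f) \<in> ?A" "(v, g) \<in> ?A" for u f v g
      using that sym by (auto simp: inner_add_left inner_add_right)
    show "(\<kappa> + \<mu>) * (norm u)\<^sup>2 \<le> f \<bullet> u" if "(u, f) \<in> ?A" for u f
      using that coercive by (auto simp: inner_add_left distrib_right power2_norm_eq_inner)
    show "\<exists>u. (u, f) \<in> ?A" if "f \<in> H" for f using onto[OF that] by auto
  qed (use sub H kappa mu in auto)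
  show ?thesis
  proof
    fix f assume f: "f \<in> H"
    have "\<exists>!u. u \<in> H \<and> P.K (f + \<mu> *\<^sub>R u) = u"
    proof (rule Banach_fix[OF H])
      show "H \<noteq> {}" using f by auto
      show "0 \<le> \<mu> / (\<kappa> + \<mu>)" "\<mu> / (\<kappa> + \<mu>) < 1" using kappa mu by auto
      have fH: "f + \<mu> *\<^sub>R u \<in> H" if "u \<in> H" for u using f that sub by (intro subspace_add subspace_scale)
      then show "(\<lambda>u. P.K (f + \<mu> *\<^sub>R u)) ` H \<subseteq> H" using P.K_H by auto
      show "dist (P.K (f + \<mu> *\<^sub>R u)) (P.K (f + \<mu> *\<^sub>R v)) \<le> \<mu> / (\<kappa> + \<mu>) * dist u v" if "u \<in> H" "v \<in> H" for u v
      proof -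
        have d: "\<mu> *\<^sub>R (u - v) \<in> H" using that sub by (intro subspace_scale subspace_diff)
        have eq: "f + \<mu> *\<^sub>R u = (f + \<mu> *\<^sub>R v) + \<mu> *\<^sub>R (u - v)" by (simp add: algebra_simps)
        have "P.K (f + \<mu> *\<^sub>R u) - P.K (f + \<mu> *\<^sub>R v) = P.K (\<mu> *\<^sub>R (u - v))"
          unfolding eq P.K_add[OF fH[OF that(2)] d] by simp
        then have "(\<kappa> + \<mu>) * dist (P.K (f + \<mu> *\<^sub>R u)) (P.K (f + \<mu> *\<^sub>R v)) \<le> \<mu> * dist u v"
          using P.norm_K[OF d] mu by (simp add: dist_norm)
        then show ?thesis using kappa mu by (simp add: field_simps)
      qed
    qed
    then obtain u where u: "u \<in> H" "P.K (f + \<mu> *\<^sub>R u) = u" by blast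
    have "f + \<mu> *\<^sub>R u \<in> H" using f u sub by (intro subspace_add subspace_scale)
    from P.K_A[OF this] have "(u, f) \<in> A" unfolding u(2) by auto
    then show "\<exists>u. (u, f) \<in> A" ..
  qed (use assms in auto)
qed

lemma op_app_eqI: "single_valued A \<Longrightarrow> (u, f) \<in> A \<Longrightarrow> op_app A u = f"
  unfolding op_app_def by (rule the_equality) (auto dest: single_valuedD)

lemma op_app_in: "single_valued A \<Longrightarrow> u \<in> Domain A \<Longrightarrow> (u, op_app A u) \<in> A"
  using op_app_eqI by fastforce

section \<open>Calculus of the chosen square root\<close>

context positive_surjective
begin

abbreviation S :: "('h \<times> 'h) set" where "S \<equiv> op_sqrt H A"
abbreviation s :: "'h \<Rightarrow> 'h" where "s \<equiv> op_app S"

lemma S_basic: "S \<subseteq> H \<times> H" "subspace S" "single_valued S" "S \<subseteq> adjoint_on H S"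
  using op_sqrt_props(1) by (auto simp: self_adjoint_on_def)

lemma s_eqI: "(u, f) \<in> S \<Longrightarrow> s u = f" by (rule op_app_eqI[OF S_basic(3)])

lemma s_in: "u \<in> Domain S \<Longrightarrow> (u, s u) \<in> S" by (rule op_app_in[OF S_basic(3)])

lemma s_add: assumes "u \<in> Domain S" "v \<in> Domain S" shows "u + v \<in> Domain S" "s (u + v) = s u + s v"
proof -
  have "(u, s u) + (v, s v) \<in> S" using assms by (intro subspace_add[OF S_basic(2)] s_in)
  then have "(u + v, s u + s v) \<in> S" by simp
  then show "u + v \<in> Domain S" "s (u + v) = s u + s v" using s_eqI by auto
qed

lemma s_scale: assumes "u \<in> Domain S" shows "r *\<^sub>R u \<in> Domain S" "s (r *\<^sub>R u) = r *\<^sub>R s u"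
proof -
  have "r *\<^sub>R (u, s u) \<in> S" using assms by (intro subspace_scale[OF S_basic(2)] s_in)
  then have "(r *\<^sub>R u, r *\<^sub>R s u) \<in> S" by simp
  then show "r *\<^sub>R u \<in> Domain S" "s (r *\<^sub>R u) = r *\<^sub>R s u" using s_eqI by auto
qed

lemma s_diff: assumes "u \<in> Domain S" "v \<in> Domain S" shows "u - v \<in> Domain S" "s (u - v) = s u - s v"
  using s_add[OF assms(1) s_scale(1)[OF assms(2), of "-1"]] s_scale(2)[OF assms(2), of "-1"] by auto

lemma s_sym: assumes "u \<in> Domain S" "v \<in> Domain S" shows "s u \<bullet> v = u \<bullet> s v"
  using S_basic(4) s_in[OF assms(1)] s_in[OF assms(2)] by (auto simp: adjoint_on_def)

text \<open>An element of the domain of A admits \<open>S\<close> twice; the second application is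
  moved to \<open>v\<close> by symmetry, so \<open>v\<close> may range over the whole form
  domain.\<close>

lemma s_form:
  assumes "(z, f) \<in> A" "v \<in> Domain S" shows "f \<bullet> v = s z \<bullet> s v"
proof -
  have "(z, f) \<in> S O S" using assms(1) op_sqrt_props(3) by simp
  then obtain y where y: "(z, y) \<in> S" "(y, f) \<in> S" by auto
  then have "s z = y" "s y = f" "y \<in> Domain S" using s_eqI by auto
  then show ?thesis using s_sym[of y v] assms(2) by simp
qed

text \<open>Coercivity of A covers only the domain of A. It extends to the form domain by duality:
  |u|^2 = s (K u) . s u, where \<kappa> |s (K u)|^2 = \<kappa> u . K u \<le> |u|^2.\<close>

lemma s_coercive: assumes u: "u \<in> Domain S" shows "\<kappa> * (norm u)\<^sup>2 \<le> (norm (s u))\<^sup>2"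
proof (cases "u = 0")
  case False
  have uH: "u \<in> H" using s_in[OF u] S_basic(1) by auto
  have "(K u, u) \<in> S O S" using K_A[OF uH] op_sqrt_props(3) by simp
  then have KD: "K u \<in> Domain S" by auto
  have "(norm u)\<^sup>2 = s (K u) \<bullet> s u" using s_form[OF K_A[OF uH] u] by (simp add: power2_norm_eq_inner)
  also have "\<dots> \<le> norm (s (K u)) * norm (s u)" by (rule norm_cauchy_schwarz)
  finally have "((norm u)\<^sup>2)\<^sup>2 \<le> (norm (s (K u)))\<^sup>2 * (norm (s u))\<^sup>2"
    by (metis power_mono power_mult_distrib zero_le_power2)
  moreover have "\<kappa> * (norm (s (K u)))\<^sup>2 \<le> (norm u)\<^sup>2"
  proof -
    have "\<kappa> * (norm (s (K u)))\<^sup>2 = \<kappa> * (u \<bullet> K u)" 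
      using s_form[OF K_A[OF uH] KD] by (simp add: power2_norm_eq_inner)
    also have "\<dots> \<le> \<kappa> * (norm u * norm (K u))" using kappa norm_cauchy_schwarz by (intro mult_left_mono) auto
    also have "\<dots> = norm u * (\<kappa> * norm (K u))" by simp
    also have "\<dots> \<le> norm u * norm u" using norm_K[OF uH] by (intro mult_left_mono) auto
    finally show ?thesis by (simp add: power2_eq_square)
  qed
  then have "\<kappa> * (norm (s (K u)))\<^sup>2 * (norm (s u))\<^sup>2 \<le> (norm u)\<^sup>2 * (norm (s u))\<^sup>2"
    by (rule mult_right_mono) simp
  moreover from calculation have "\<kappa> * ((norm u)\<^sup>2)\<^sup>2 \<le> \<kappa> * ((norm (s (K u)))\<^sup>2 * (norm (s u))\<^sup>2)"
    using kappa by (intro mult_left_mono) auto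
  ultimately have "\<kappa> * ((norm u)\<^sup>2)\<^sup>2 \<le> (norm u)\<^sup>2 * (norm (s u))\<^sup>2" by simp
  then have "(norm u)\<^sup>2 * (\<kappa> * (norm u)\<^sup>2) \<le> (norm u)\<^sup>2 * (norm (s u))\<^sup>2"
    by (simp only: power2_eq_square[of "(norm u)\<^sup>2"] mult.left_commute)
  then show ?thesis using False by simp
qed simp

end

section \<open>What the group on the phase space implies about \<open>L2\<close> and the
  Laplacian\<close>

lemma complete_L2:
  assumes "\<tau> > 0" and B: "banach_on (phase_space \<Omega>) (phase_norm \<Omega> \<tau>)"
  shows "complete (L2 \<Omega>)"
proof -
  let ?V = "phase_space \<Omega>" and ?N = "phase_norm \<Omega> \<tau>"
  have "0 \<in> ?V" using B by (auto simp: banach_on_def intro: subspace_0)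
  moreover from this have "?N 0 = 0" using B by (auto simp: banach_on_def)
  \<comment> \<open>Linearity of the chosen root is not yet available here; its value at 0 is forced
    by the norm of 0 being 0. The third component then embeds \<open>L2\<close>, with norm scaled by
    the root of \<tau>.\<close>
  ultimately have 0: "0 \<in> Domain (sqrt_laplacian \<Omega>)" "op_app (sqrt_laplacian \<Omega>) 0 = 0"
    by (auto simp: phase_space_def phase_norm_def zero_prod_def)
  have N: "?N (0, 0, w) = sqrt \<tau> * norm w" for w
    by (simp add: phase_norm_def 0(2) real_sqrt_mult)
  show ?thesis unfolding complete_def
  proof (intro allI impI, elim conjE)
    fix f :: "nat \<Rightarrow> _" assume f: "\<forall>n. f n \<in> L2 \<Omega>" and cauchy: "Cauchy f"
    let ?f = "\<lambda>n. (0, 0, f n)"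
    have "range ?f \<subseteq> ?V" using f 0 by (auto simp: phase_space_def)
    moreover have "\<exists>K. \<forall>m\<ge>K. \<forall>n\<ge>K. ?N (?f m - ?f n) < e" if e: "e > 0" for e
    proof -
      have "e / sqrt \<tau> > 0" using e assms(1) by simp
      then obtain K where K: "\<forall>m\<ge>K. \<forall>n\<ge>K. dist (f m) (f n) < e / sqrt \<tau>" 
        using cauchy unfolding Cauchy_def by blast
      have "?N (?f m - ?f n) < e" if "m \<ge> K" "n \<ge> K" for m n
      proof -
        have "norm (f m - f n) < e / sqrt \<tau>" using K that by (simp add: dist_norm)
        then show ?thesis using assms(1) by (simp add: N pos_less_divide_eq mult.commute)
      qed
      then show ?thesis by blast
    qed
    moreover have "range ?f \<subseteq> ?V \<and> (\<forall>e>0. \<exists>K. \<forall>m\<ge>K. \<forall>n\<ge>K. ?N (?f m - ?f n) < e) \<longrightarrow>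
        (\<exists>x\<in>?V. (\<lambda>n. ?N (?f n - x)) \<longlonglongrightarrow> 0)"
      using B unfolding banach_on_def by (elim conjE allE[of _ ?f])
    ultimately obtain x where x: "x \<in> ?V" "(\<lambda>n. ?N (?f n - x)) \<longlonglongrightarrow> 0" by blast
    obtain x1 x2 x3 where xx: "x = (x1, x2, x3)" by (cases x)
    have le: "sqrt \<tau> * norm (f n - x3) \<le> ?N (?f n - x)" for n
    proof -
      have "sqrt \<tau> * norm (f n - x3) = sqrt (\<tau> * (norm (f n - x3))\<^sup>2)" by (simp add: real_sqrt_mult)
      also have "\<dots> \<le> ?N (?f n - x)" unfolding xx phase_norm_def by simp
      finally show ?thesis .
    qed
    have "(\<lambda>n. f n - x3) \<longlonglongrightarrow> 0"
    proof (rule Lim_null_comparison)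
      show "(\<lambda>n. ?N (?f n - x) / sqrt \<tau>) \<longlonglongrightarrow> 0" using tendsto_divide[OF x(2) tendsto_const, of "sqrt \<tau>"] assms(1) by simp
      show "\<forall>\<^sub>F n in sequentially. norm (f n - x3) \<le> ?N (?f n - x) / sqrt \<tau>"
        using le assms(1) by (simp add: pos_le_divide_eq mult.commute)
    qed
    then have "f \<longlonglongrightarrow> x3" by (rule LIM_zero_cancel)
    moreover have "x3 \<in> L2 \<Omega>" using x(1) by (simp add: xx phase_space_def)
    ultimately show "\<exists>l\<in>L2 \<Omega>. f \<longlonglongrightarrow> l" by blast
  qed
qed

text \<open>The resolvent equation for data \<open>(0, 0, h)\<close> reduces to an elliptic equation \<open>A z + \<mu> z = h'\<close>.\<close>

lemma dirichlet_laplacian_shift_onto: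
  assumes pos: "\<alpha> > 0" "c > 0" "\<delta> > 0" "\<tau> > 0"
    and G: "C0_group (phase_space \<Omega>) (phase_norm \<Omega> \<tau>) T"
    and gen: "generator_on (phase_space \<Omega>) (phase_norm \<Omega> \<tau>) T = MGT_operator \<Omega> \<alpha> c \<delta> \<tau>"
  obtains \<mu> where "\<mu> \<ge> 0" "\<And>h. h \<in> L2 \<Omega> \<Longrightarrow> \<exists>(u, f)\<in>dirichlet_laplacian \<Omega>. f + \<mu> *\<^sub>R u = h"
proof -
  interpret C0_group_on "phase_space \<Omega>" "phase_norm \<Omega> \<tau>" T by unfold_locales (rule G)
  obtain \<sigma> where l: "\<sigma> > 0" "\<And>x. x \<in> phase_space \<Omega> \<Longrightarrow> \<exists>y. (y, \<sigma> *\<^sub>R y - x) \<in> MGT_operator \<Omega> \<alpha> c \<delta> \<tau>"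
    using generator_resolvent unfolding gen by blast
  let ?b = "b_coeff c \<delta> \<tau>" and ?A = "dirichlet_laplacian \<Omega>"
  have b: "?b > 0" using pos by (simp add: b_coeff_def add_pos_nonneg)
  let ?r = "c\<^sup>2 + ?b * \<sigma>"
  have r: "?r > 0" using b l pos by (simp add: add_pos_nonneg)
  \<comment> \<open>The first two components of the resolvent equation give v = \<sigma> u, w =
    \<sigma>^2 u and z = ?r u; the third is then A z + (\<tau> \<sigma> + \<alpha>) w = h, and
    ?\<mu> expresses its last term through z.\<close>
  let ?\<mu> = "(\<tau> * \<sigma> + \<alpha>) * \<sigma>\<^sup>2 / ?r"
  have "\<exists>(u, f)\<in>?A. f + ?\<mu> *\<^sub>R u = h" if h: "h \<in> L2 \<Omega>" for h
  proof -
    have "0 \<in> Domain (sqrt_laplacian \<Omega>)" using V_0 by (auto simp: phase_space_def zero_prod_def)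
    then have "(0, 0, inverse \<tau> *\<^sub>R h) \<in> phase_space \<Omega>" 
      using subspace_scale[OF subspace_L2 h] by (simp add: phase_space_def)
    then obtain y where y: "(y, \<sigma> *\<^sub>R y - (0, 0, inverse \<tau> *\<^sub>R h)) \<in> MGT_operator \<Omega> \<alpha> c \<delta> \<tau>" using l(2) by blast
    obtain u v w where uvw: "y = (u, v, w)" by (cases y)
    let ?z = "c\<^sup>2 *\<^sub>R u + ?b *\<^sub>R v"
    have z: "?z \<in> Domain ?A" and v: "v = \<sigma> *\<^sub>R u" and w: "w = \<sigma> *\<^sub>R v" 
      and eq: "\<sigma> *\<^sub>R w - inverse \<tau> *\<^sub>R h = - (inverse \<tau> *\<^sub>R op_app ?A ?z) - (inverse \<tau> * \<alpha>) *\<^sub>R w"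
      using y unfolding uvw MGT_operator_def by auto
    have "\<tau> *\<^sub>R (\<sigma> *\<^sub>R w - inverse \<tau> *\<^sub>R h) = \<tau> *\<^sub>R (- (inverse \<tau> *\<^sub>R op_app ?A ?z) - (inverse \<tau> * \<alpha>) *\<^sub>R w)"
      using eq by simp
    then have "op_app ?A ?z + (\<tau> * \<sigma> + \<alpha>) *\<^sub>R w = h" 
      using pos by (simp add: scaleR_diff_right scaleR_add_left algebra_simps)
    moreover have "?\<mu> *\<^sub>R ?z = (\<tau> * \<sigma> + \<alpha>) *\<^sub>R w"
    proof -
      have "?z = ?r *\<^sub>R u" by (simp add: v scaleR_add_left)
      then have "?\<mu> *\<^sub>R ?z = (?\<mu> * ?r) *\<^sub>R u" by simp
      also have "?\<mu> * ?r = (\<tau> * \<sigma> + \<alpha>) * \<sigma>\<^sup>2" using r by simp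
      finally show ?thesis by (simp add: w v power2_eq_square)
    qed
    ultimately have "op_app ?A ?z + ?\<mu> *\<^sub>R ?z = h" by simp
    then show ?thesis using op_app_in[OF single_valued_dirichlet_laplacian z] by blast
  qed
  moreover have "?\<mu> \<ge> 0" using pos l r by simp
  ultimately show ?thesis using that by blast
qed

section \<open>Decay along classical solutions\<close>

lemma has_vector_derivative_quotientI:
  assumes "((\<lambda>h. norm ((f (t + h) - f t) /\<^sub>R h - g)) \<longlongrightarrow> 0) (at 0)"
  shows "(f has_vector_derivative g) (at t)"
  unfolding has_vector_derivative_def has_derivative_at
proof
  show "bounded_linear (\<lambda>x. x *\<^sub>R g)" by (rule bounded_linear_scaleR_left)
  have "norm ((f (t + h) - f t) /\<^sub>R h - g) = norm (f (t + h) - f t - h *\<^sub>R g) / norm h" if "h \<noteq> 0" for h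
  proof -
    have "(f (t + h) - f t) /\<^sub>R h - g = (f (t + h) - f t - h *\<^sub>R g) /\<^sub>R h"
      using that by (simp add: scaleR_diff_right)
    then show ?thesis by (simp add: divide_inverse mult.commute)
  qed
  then have "\<forall>\<^sub>F h in at 0. norm ((f (t + h) - f t) /\<^sub>R h - g) = norm (f (t + h) - f t - h *\<^sub>R g) / norm h"
    by (auto simp: eventually_at_filter)
  from Lim_transform_eventually[OF assms this]
  show "((\<lambda>h. norm (f (t + h) - f t - h *\<^sub>R g) / norm h) \<longlongrightarrow> 0) (at 0)" .
qed

lemma has_real_derivative_inner:
  assumes "(f has_vector_derivative f') (at t)" "(g has_vector_derivative g') (at t)"
  shows "((\<lambda>t. f t \<bullet> g t) has_real_derivative f t \<bullet> g' + f' \<bullet> g t) (at t)"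
  using bounded_bilinear.has_vector_derivative[OF bounded_bilinear_inner assms]
  by (simp add: has_real_derivative_iff_has_vector_derivative)

lemma exponential_decay:
  fixes L :: "real \<Rightarrow> real"
  assumes "\<And>t. (L has_real_derivative L' t) (at t)" "\<And>t. L' t \<le> - r * L t" "t \<ge> 0"
  shows "L t \<le> exp (- r * t) * L 0"
proof -
  have "exp (r * t) * L t \<le> exp (r * 0) * L 0"
  proof (rule DERIV_nonpos_imp_nonincreasing[OF assms(3)])
    fix x
    have "((\<lambda>t. exp (r * t) * L t) has_real_derivative exp (r * x) * (r * L x + L' x)) (at x)"
      by (auto intro!: derivative_eq_intros assms(1) simp: algebra_simps)
    moreover have "exp (r * x) * (r * L x + L' x) \<le> 0" using assms(2)[of x] by (intro mult_nonneg_nonpos) auto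
    ultimately show "\<exists>y. ((\<lambda>t. exp (r * t) * L t) has_real_derivative y) (at x) \<and> y \<le> 0" by blast
  qed
  then show ?thesis by (simp add: exp_minus field_simps)
qed

context lyapunov
begin

lemma lyap_has_derivative:
  assumes "(a has_vector_derivative d t) (at t)" "(d has_vector_derivative e) (at t)"
    "(u has_vector_derivative v t) (at t)" "(v has_vector_derivative w t) (at t)" "(w has_vector_derivative p) (at t)"
  shows "((\<lambda>t. lyap \<tau> b k \<gamma> (a t) (d t) (u t) (v t) (w t)) has_real_derivative
    lyap_deriv \<tau> b k \<gamma> (a t) (d t) e (u t) (v t) (w t) p) (at t)"
proof -
  have Y: "((\<lambda>t. d t + k *\<^sub>R a t) has_vector_derivative e + k *\<^sub>R d t) (at t)"
    and W: "((\<lambda>t. w t + k *\<^sub>R v t) has_vector_derivative p + k *\<^sub>R w t) (at t)"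
    and q: "((\<lambda>t. v t + k *\<^sub>R u t) has_vector_derivative w t + k *\<^sub>R v t) (at t)"
    using assms by (auto intro!: derivative_eq_intros)
  show ?thesis unfolding lyap_def lyap_deriv_def
    by (rule derivative_eq_intros has_real_derivative_inner[OF Y Y] has_real_derivative_inner[OF W W] 
        has_real_derivative_inner[OF W q] has_real_derivative_inner[OF assms(4,4)] 
        has_real_derivative_inner[OF assms(1,1)] refl)+
      (simp add: inner_commute[of e "d t"] inner_commute[of e "a t"] inner_commute[of p "w t"] inner_commute[of p "v t"]
        inner_commute[of "w t" "v t"] inner_commute[of "d t" "a t"] algebra_simps)
qed

text \<open>Data in the generator domain keep w(t) in the domain of A^(1/2) and z(t) in that of A,
  so all quantities in \<open>lyap_deriv\<close> exist. The components u and v are differentiable in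
  the form norm, w only in \<open>L2\<close>, which is just enough for \<open>lyap\<close>.\<close>

lemma MGT_orbit_decay:
  fixes \<Omega> :: "'a::euclidean_space set"
  assumes PS: "positive_surjective (L2 \<Omega>) (dirichlet_laplacian \<Omega>) \<kappa>"
    and adm: "admissible \<tau> (b_coeff c \<delta> \<tau>) (c\<^sup>2 / b_coeff c \<delta> \<tau>) (gamma_coeff \<alpha> c \<delta> \<tau>)"
    and G: "C0_group (phase_space \<Omega>) (phase_norm \<Omega> \<tau>) T"
    and gen: "generator_on (phase_space \<Omega>) (phase_norm \<Omega> \<tau>) T = MGT_operator \<Omega> \<alpha> c \<delta> \<tau>"
    and x: "(x, x') \<in> MGT_operator \<Omega> \<alpha> c \<delta> \<tau>" and t: "t \<ge> 0"
  shows "phase_norm \<Omega> \<tau> (T t x) \<le> sqrt (m\<^sub>1 * m\<^sub>2) * exp (- (rate / 2) * t) * phase_norm \<Omega> \<tau> x"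
proof -
  interpret PS: positive_surjective "L2 \<Omega>" "dirichlet_laplacian \<Omega>" \<kappa> by (rule PS)
  interpret C0_group_on "phase_space \<Omega>" "phase_norm \<Omega> \<tau>" T by unfold_locales (rule G)
  let ?N = "phase_norm \<Omega> \<tau>"
  define b where "b = b_coeff c \<delta> \<tau>"
  define k where "k = c\<^sup>2 / b"
  define \<gamma> where "\<gamma> = gamma_coeff \<alpha> c \<delta> \<tau>"
  have adm: "admissible \<tau> b k \<gamma>" using adm by (simp add: b_def k_def \<gamma>_def)
  note A = admissible_facts[OF adm]
  define u where "u t = fst (T t x)" for t
  define v where "v t = fst (snd (T t x))" for t
  define w where "w t = snd (snd (T t x))" for t
  define p where "p t = snd (snd (T t x'))" for t
  define z where "z t = c\<^sup>2 *\<^sub>R u t + b *\<^sub>R v t" for t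
  define f where "f t = op_app (dirichlet_laplacian \<Omega>) (z t)" for t
  have Tx: "T t x = (u t, v t, w t)" for t by (simp add: u_def v_def w_def)
  have "(T t x, T t x') \<in> MGT_operator \<Omega> \<alpha> c \<delta> \<tau>" for t
    using generator_invariant(1) x unfolding gen by blast
  then have orbit: "(u t, v t, w t) \<in> phase_space \<Omega>" "w t \<in> Domain PS.S" "z t \<in> Domain (dirichlet_laplacian \<Omega>)"
    "T t x' = (v t, w t, p t)" "p t = - (inverse \<tau> *\<^sub>R f t) - (inverse \<tau> * \<alpha>) *\<^sub>R w t" for t
    unfolding Tx p_def f_def z_def b_def MGT_operator_def by (auto simp: sqrt_laplacian_def)
  have D: "u t \<in> Domain PS.S" "v t \<in> Domain PS.S" "z t \<in> Domain PS.S" for t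
    using orbit(1)[of t] by (auto simp: phase_space_def sqrt_laplacian_def z_def intro!: PS.s_add PS.s_scale)
  have N_eq: "?N (y1, y2, y3) = sqrt ((norm (PS.s y1))\<^sup>2 + (norm (PS.s y2))\<^sup>2 + \<tau> * (norm y3)\<^sup>2)" for y1 y2 y3
    by (simp add: phase_norm_def sqrt_laplacian_def)
  have comp: "norm (PS.s y1) \<le> ?N (y1, y2, y3)" "norm (PS.s y2) \<le> ?N (y1, y2, y3)" 
    "sqrt \<tau> * norm y3 \<le> ?N (y1, y2, y3)" for y1 y2 y3
  proof -
    have "sqrt \<tau> * norm y3 = sqrt (\<tau> * (norm y3)\<^sup>2)" by (simp add: real_sqrt_mult)
    then show "sqrt \<tau> * norm y3 \<le> ?N (y1, y2, y3)" unfolding N_eq by simp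
  qed (use A in \<open>auto simp: N_eq intro!: real_le_rsqrt\<close>)
  let ?q = "\<lambda>g h t. (g (t + h) - g t) /\<^sub>R h"
  have quot: "((\<lambda>h. ?N (?q u h t - v t, ?q v h t - w t, ?q w h t - p t)) \<longlongrightarrow> 0) (at 0)" for t
    using generator_invariant(2)[of x x' t] x unfolding gen by (simp add: Tx orbit(4))
  \<comment> \<open>The phase norm controls the image of the error quotient under A^(1/2);
    coercivity transfers the convergence to the quotient itself.\<close>
  have sder: "((\<lambda>t. PS.s (g t)) has_vector_derivative PS.s g') (at t)" "(g has_vector_derivative g') (at t)"
    if g: "\<And>t. g t \<in> Domain PS.S" "g' \<in> Domain PS.S" 
      and le: "\<And>h. norm (PS.s (?q g h t - g')) \<le> ?N (?q u h t - v t, ?q v h t - w t, ?q w h t - p t)" for g g' t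
  proof -
    have dom: "?q g h t - g' \<in> Domain PS.S" for h using g by (intro PS.s_diff PS.s_scale)
    have lim: "((\<lambda>h. norm (PS.s (?q g h t - g'))) \<longlongrightarrow> 0) (at 0)"
      by (rule tendsto_sandwich[OF _ _ tendsto_const quot[of t]]) (use le in auto)
    have "PS.s (?q g h t - g') = (PS.s (g (t + h)) - PS.s (g t)) /\<^sub>R h - PS.s g'" for h
      using g by (simp add: PS.s_diff PS.s_scale)
    then show "((\<lambda>t. PS.s (g t)) has_vector_derivative PS.s g') (at t)"
      using lim by (intro has_vector_derivative_quotientI) simp
    have bound: "norm (?q g h t - g') \<le> norm (PS.s (?q g h t - g')) / sqrt \<kappa>" for h
    proof -
      have "sqrt (\<kappa> * (norm (?q g h t - g'))\<^sup>2) \<le> sqrt ((norm (PS.s (?q g h t - g')))\<^sup>2)"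
        by (rule real_sqrt_le_mono[OF PS.s_coercive[OF dom]])
      then show ?thesis using pos by (simp add: real_sqrt_mult pos_le_divide_eq mult.commute)
    qed
    have "((\<lambda>h. norm (PS.s (?q g h t - g')) / sqrt \<kappa>) \<longlongrightarrow> 0) (at 0)"
      using tendsto_divide[OF lim tendsto_const, of "sqrt \<kappa>"] pos by simp
    from Lim_null_comparison[OF always_eventually[OF allI[OF bound]] this, THEN tendsto_norm_zero]
    show "(g has_vector_derivative g') (at t)" by (intro has_vector_derivative_quotientI)
  qed
  have du: "((\<lambda>t. PS.s (u t)) has_vector_derivative PS.s (v t)) (at t)" "(u has_vector_derivative v t) (at t)" for t
    by (rule sder[OF D(1) D(2) comp(1)])+
  have dv: "((\<lambda>t. PS.s (v t)) has_vector_derivative PS.s (w t)) (at t)" "(v has_vector_derivative w t) (at t)" for t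
    by (rule sder[OF D(2) orbit(2) comp(2)])+
  have dw: "(w has_vector_derivative p t) (at t)" for t
  proof (rule has_vector_derivative_quotientI, rule tendsto_sandwich[OF _ _ tendsto_const])
    show "((\<lambda>h. ?N (?q u h t - v t, ?q v h t - w t, ?q w h t - p t) / sqrt \<tau>) \<longlongrightarrow> 0) (at 0)"
      using tendsto_divide[OF quot[of t] tendsto_const, of "sqrt \<tau>"] A by simp
    show "\<forall>\<^sub>F h in at 0. norm (?q w h t - p t) \<le> ?N (?q u h t - v t, ?q v h t - w t, ?q w h t - p t) / sqrt \<tau>"
      using comp(3) A(1) by (simp add: pos_le_divide_eq mult.commute)
  qed simp
  define L where "L t = lyap \<tau> b k \<gamma> (PS.s (u t)) (PS.s (v t)) (u t) (v t) (w t)" for t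
  define L' where "L' t = lyap_deriv \<tau> b k \<gamma> (PS.s (u t)) (PS.s (v t)) (PS.s (w t)) (u t) (v t) (w t) (p t)" for t
  have L: "(L has_real_derivative L' t) (at t)" for t
    unfolding L_def L'_def by (rule lyap_has_derivative[OF du(1) dv(1) du(2) dv(2) dw])
  have y: "\<kappa> * (norm (v t + k *\<^sub>R u t))\<^sup>2 \<le> (norm (PS.s (v t) + k *\<^sub>R PS.s (u t)))\<^sup>2" for t
    using PS.s_coercive[of "v t + k *\<^sub>R u t"] D[of t] by (simp add: PS.s_add PS.s_scale)
  have vv: "\<kappa> * (norm (v t))\<^sup>2 \<le> (norm (PS.s (v t)))\<^sup>2" for t by (rule PS.s_coercive[OF D(2)])
  have L'_le: "L' t \<le> - rate * L t" for t
    unfolding L_def L'_def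
  proof (rule lyap_decay[OF adm])
    \<comment> \<open>This identity is the reason for the form of
      \<open>gamma_coeff\<close>.\<close>
    have "\<gamma> + \<tau> * k = \<alpha>" by (simp add: \<gamma>_def gamma_coeff_def k_def b_def divide_inverse)
    then show "\<tau> *\<^sub>R p t = - f t - (\<gamma> + \<tau> * k) *\<^sub>R w t"
      using A(1) by (simp add: orbit(5) scaleR_diff_right)
    \<comment> \<open>Since c^2 = b k, z is b (v + k u); hence the form of A z is b times the form
      of v + k u.\<close>
    have "PS.s (z t) = b *\<^sub>R (PS.s (v t) + k *\<^sub>R PS.s (u t))"
      using D[of t] A(7,10) by (simp add: z_def PS.s_add PS.s_scale scaleR_add_right)
    then have "f t \<bullet> g = b * ((PS.s (v t) + k *\<^sub>R PS.s (u t)) \<bullet> PS.s g)" if "g \<in> Domain PS.S" for g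
      using PS.s_form[OF op_app_in[OF single_valued_dirichlet_laplacian orbit(3)] that, of t] by (simp add: f_def)
    then show "f t \<bullet> u t = b * ((PS.s (v t) + k *\<^sub>R PS.s (u t)) \<bullet> PS.s (u t))"
      "f t \<bullet> v t = b * ((PS.s (v t) + k *\<^sub>R PS.s (u t)) \<bullet> PS.s (v t))"
      "f t \<bullet> w t = b * ((PS.s (v t) + k *\<^sub>R PS.s (u t)) \<bullet> PS.s (w t))" using D orbit(2) by auto
  qed (rule y vv)+
  have N2: "(?N (T t x))\<^sup>2 = (norm (PS.s (u t)))\<^sup>2 + (norm (PS.s (v t)))\<^sup>2 + \<tau> * (norm (w t))\<^sup>2" for t
    using A(1) by (simp add: Tx N_eq)
  have "(?N (T t x))\<^sup>2 \<le> m\<^sub>1 * L t" unfolding N2 L_def by (rule lyap_lower[OF adm y vv])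
  also have "\<dots> \<le> m\<^sub>1 * (exp (- rate * t) * L 0)"
    using exponential_decay[OF L L'_le t] m1_pos by (intro mult_left_mono) auto
  also have "\<dots> \<le> m\<^sub>1 * (exp (- rate * t) * (m\<^sub>2 * (?N (T 0 x))\<^sup>2))"
    unfolding N2 L_def using lyap_upper[OF adm y vv] m1_pos by (intro mult_left_mono) auto
  \<comment> \<open>The functional is quadratic, so the norm decays at half its rate.\<close>
  also have "\<dots> = (sqrt (m\<^sub>1 * m\<^sub>2) * exp (- (rate / 2) * t) * ?N (T 0 x))\<^sup>2"
  proof -
    have "(exp (- (rate / 2) * t))\<^sup>2 = exp (- rate * t)" by (simp add: power2_eq_square flip: exp_add)
    moreover have "(sqrt (m\<^sub>1 * m\<^sub>2))\<^sup>2 = m\<^sub>1 * m\<^sub>2" using m1_pos m2_pos by simp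
    ultimately show ?thesis by (simp add: power_mult_distrib)
  qed
  finally have "(?N (T t x))\<^sup>2 \<le> (sqrt (m\<^sub>1 * m\<^sub>2) * exp (- (rate / 2) * t) * ?N (T 0 x))\<^sup>2" .
  moreover have xV: "x \<in> phase_space \<Omega>" using x unfolding gen[symmetric] by (simp add: generator_on_def)
  moreover have "0 \<le> sqrt (m\<^sub>1 * m\<^sub>2) * exp (- (rate / 2) * t) * ?N (T 0 x)"
    using m1_pos m2_pos N_nonneg[OF T_V[OF xV]] by simp
  ultimately have "?N (T t x) \<le> sqrt (m\<^sub>1 * m\<^sub>2) * exp (- (rate / 2) * t) * ?N (T 0 x)"
    by (metis power2_le_imp_le)
  then show ?thesis by (simp add: T_0[OF xV])
qed

end

text \<open>The a priori bound of T t may far exceed M, but it multiplies only the approximation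
  error, which density makes arbitrarily small.\<close>

lemma (in C0_group_on) bound_from_generator_domain:
  assumes M: "M \<ge> 0" and dom: "\<And>x x'. (x, x') \<in> generator_on V N T \<Longrightarrow> N (T t x) \<le> M * N x" and x: "x \<in> V"
  shows "N (T t x) \<le> M * N x"
proof (rule field_le_epsilon)
  fix e :: real assume e: "e > 0"
  obtain K where K: "K > 0" "\<And>x. x \<in> V \<Longrightarrow> N (T t x) \<le> K * N x" using T_bound by metis
  have "e / (M + K) > 0" using e K M by simp
  then obtain y y' where y: "(y, y') \<in> generator_on V N T" "N (y - x) < e / (M + K)"
    using generator_dense[OF x] by metis
  have yV: "y \<in> V" using y(1) by (simp add: generator_on_def)
  have d: "(M + K) * N (y - x) \<le> e" using y(2) K M by (simp add: pos_less_divide_eq mult.commute)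
  have "N (T t x) \<le> N (T t y) + N (T t x - T t y)" by (rule N_diff[OF T_V[OF x] T_V[OF yV]])
  also have "T t x - T t y = T t (x - y)" using x yV by (simp add: T_diff)
  also have "N (T t y) \<le> M * N y" by (rule dom[OF y(1)])
  also have "N (T t (x - y)) \<le> K * N (x - y)" by (rule K(2)[OF V_diff[OF x yV]])
  also have "M * N y \<le> M * (N x + N (y - x))" using N_diff[OF yV x] M by (rule mult_left_mono)
  finally show "N (T t x) \<le> M * N x + e" using d N_commute[OF x yV] by (simp add: algebra_simps)
qed

theorem theorem2p2:
  fixes \<Omega> :: "(real ^ 'n) set"
    and \<alpha> c \<delta> :: real
    and T :: "real \<Rightarrow> real \<Rightarrow> (real ^ 'n) state \<Rightarrow> (real ^ 'n) state"
  assumes "CARD('n) = 2 \<or> CARD('n) = 3"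
    and "bounded_C2_domain \<Omega>"
    and "\<alpha> > 0" and "c > 0" and "\<delta> > 0"
    and "\<And>\<tau>. \<tau> > 0 \<Longrightarrow> C0_group (phase_space \<Omega>) (phase_norm \<Omega> \<tau>) (T \<tau>)"
    and "\<And>\<tau>. \<tau> > 0 \<Longrightarrow>
           generator_on (phase_space \<Omega>) (phase_norm \<Omega> \<tau>) (T \<tau>) = MGT_operator \<Omega> \<alpha> c \<delta> \<tau>"
    and "\<exists>\<gamma>\<^sub>0>0. \<forall>\<tau>>0. gamma_coeff \<alpha> c \<delta> \<tau> \<ge> \<gamma>\<^sub>0"
  shows "\<exists>\<tau>\<^sub>0>0. \<exists>M>0. \<exists>\<omega>>0. \<forall>\<tau>\<in>{0<..\<tau>\<^sub>0}. \<forall>t\<ge>0.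
           onorm_on (phase_space \<Omega>) (phase_norm \<Omega> \<tau>) (T \<tau> t) \<le> M * exp (- \<omega> * t)"
proof -
  note pos = assms(3-5) and G = assms(6) and gen = assms(7)
  have \<Omega>: "open \<Omega>" "bounded \<Omega>" using assms(2) by (auto simp: bounded_C2_domain_def)
  obtain r where r: "r > 0" "\<Omega> \<subseteq> cball 0 r" using \<Omega>(2) unfolding bounded_pos by (auto simp: subset_iff)
  define \<kappa> where "\<kappa> = 1 / (4 * r\<^sup>2)"
  have kappa: "\<kappa> > 0" using r by (simp add: \<kappa>_def)
  obtain \<gamma>\<^sub>0 where g0: "\<gamma>\<^sub>0 > 0" "\<And>\<tau>. \<tau> > 0 \<Longrightarrow> gamma_coeff \<alpha> c \<delta> \<tau> \<ge> \<gamma>\<^sub>0" using assms(8) by blast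
  \<comment> \<open>Neither \<open>L2 \<Omega>\<close> nor the Laplacian depends on \<tau>, so both
    are analysed once through the group at \<tau> = 1.\<close>
  have "banach_on (phase_space \<Omega>) (phase_norm \<Omega> 1)" using G[of 1] by (simp add: C0_group_def)
  then have H: "complete (L2 \<Omega>)" by (intro complete_L2[of 1]) auto
  obtain \<mu> where mu: "\<mu> \<ge> 0" "\<And>h. h \<in> L2 \<Omega> \<Longrightarrow> \<exists>(u, f)\<in>dirichlet_laplacian \<Omega>. f + \<mu> *\<^sub>R u = h"
    using dirichlet_laplacian_shift_onto[OF pos zero_less_one G[OF zero_less_one] gen[OF zero_less_one]] by blast
  have PS: "positive_surjective (L2 \<Omega>) (dirichlet_laplacian \<Omega>) \<kappa>"
  proof (rule positive_surjective_of_shift[OF subspace_L2 H dirichlet_laplacian_subset[OF \<Omega>(1)] 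
        single_valued_dirichlet_laplacian _ _ kappa mu(1)])
    show "f \<bullet> v = u \<bullet> g" if "(u, f) \<in> dirichlet_laplacian \<Omega>" "(v, g) \<in> dirichlet_laplacian \<Omega>" for u f v g
      by (rule dirichlet_laplacian_symmetric[OF \<Omega>(1) that])
    show "\<kappa> * (norm u)\<^sup>2 \<le> f \<bullet> u" if "(u, f) \<in> dirichlet_laplacian \<Omega>" for u f
      unfolding \<kappa>_def by (rule dirichlet_laplacian_coercive[OF \<Omega>(1) r(2,1) that])
  qed (rule mu(2))
  interpret lyapunov \<alpha> c \<delta> \<gamma>\<^sub>0 \<kappa> by unfold_locales (use pos g0 kappa in auto)
  let ?M = "sqrt (m\<^sub>1 * m\<^sub>2)"
  have M: "?M > 0" using m1_pos m2_pos by simp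
  have "onorm_on (phase_space \<Omega>) (phase_norm \<Omega> \<tau>) (T \<tau> t) \<le> ?M * exp (- (rate / 2) * t)"
    if tau: "\<tau> \<in> {0<..\<tau>\<^sub>0}" and t: "t \<ge> 0" for \<tau> t
  proof -
    interpret C0_group_on "phase_space \<Omega>" "phase_norm \<Omega> \<tau>" "T \<tau>" by unfold_locales (use G tau in auto)
    have gen': "generator_on (phase_space \<Omega>) (phase_norm \<Omega> \<tau>) (T \<tau>) = MGT_operator \<Omega> \<alpha> c \<delta> \<tau>" using gen tau by simp
    have b: "b_coeff c \<delta> \<tau> > 0" using pos tau by (simp add: b_coeff_def add_pos_nonneg)
    \<comment> \<open>Gives the upper bound \<open>b\<^sub>1\<close> on the coefficient b, from the
      entry 1 in \<open>\<tau>\<^sub>0\<close>.\<close>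
    have "\<tau> * c\<^sup>2 \<le> 1 * c\<^sup>2" using tau by (intro mult_right_mono) (auto simp: \<tau>\<^sub>0_def)
    then have adm: "admissible \<tau> (b_coeff c \<delta> \<tau>) (c\<^sup>2 / b_coeff c \<delta> \<tau>) (gamma_coeff \<alpha> c \<delta> \<tau>)"
      using tau b g0(2)[of \<tau>] by (simp add: admissible_def b\<^sub>1_def gamma_coeff_def) (simp add: b_coeff_def)
    have "phase_norm \<Omega> \<tau> (T \<tau> t x) \<le> ?M * exp (- (rate / 2) * t) * phase_norm \<Omega> \<tau> x" if "x \<in> phase_space \<Omega>" for x
    proof (rule bound_from_generator_domain[OF _ _ that])
      show "0 \<le> ?M * exp (- (rate / 2) * t)" using M by simp
      show "phase_norm \<Omega> \<tau> (T \<tau> t y) \<le> ?M * exp (- (rate / 2) * t) * phase_norm \<Omega> \<tau> y"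
        if "(y, y') \<in> generator_on (phase_space \<Omega>) (phase_norm \<Omega> \<tau>) (T \<tau>)" for y y'
        using that unfolding gen' by (rule MGT_orbit_decay[OF PS adm C0 gen' _ t])
    qed
    then have "phase_norm \<Omega> \<tau> (T \<tau> t x) / phase_norm \<Omega> \<tau> x \<le> ?M * exp (- (rate / 2) * t)" if "x \<in> phase_space \<Omega>" for x
      using N_nonneg[OF that] that M by (cases "phase_norm \<Omega> \<tau> x = 0") (auto simp: divide_le_eq)
    then show ?thesis unfolding onorm_on_def using V_0 by (intro cSUP_least) auto
  qed
  then have "\<forall>\<tau>\<in>{0<..\<tau>\<^sub>0}. \<forall>t\<ge>0. onorm_on (phase_space \<Omega>) (phase_norm \<Omega> \<tau>) (T \<tau> t) \<le> ?M * exp (- (rate / 2) * t)"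
    by blast
  moreover have "rate / 2 > 0" using rate_pos by simp
  ultimately show ?thesis using tau0_pos M by blast
qed

end
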